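(* Let $G$ be a graph of order $n\geq 6$. Then: (1) If $G$ is disconnected, then for any integer $2\leq s\leq n-3$, $G\in\mathcal{G}^s(n)$ if and only if $G\cong H+K_1$ with $H\in\mathcal{G}^{s-1}(n-1)$, or $G\cong K_{t_1,\ldots,t_p}+K_{r_1,\ldots,r_q}$ with $[(t_1-1)+\cdots+(t_p-1)]+[(r_1-1)+\cdots+(r_q-1)]=s$. (2) If $G$ is connected, then $G\in\mathcal{G}^2(n)$ if and only if $G\in\mathcal{G}_1^2(n)\cup\mathcal{G}_2^2(n)\cup\mathcal{G}_3^2(n)$ or $G\in\mathcal{D}^\ast$; and for $3\leq s\leq n-3$, $G\in\mathcal{G}^s(n)$ if and only if $G\in\mathcal{G}_1^s(n)\cup\mathcal{G}_2^s(n)\cup\mathcal{G}_3^s(n)$.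
   Context: All graphs are finite, simple and undirected; eigenvalues are those of the adjacency matrix, listed as $\lambda_1\geq\lambda_2\geq\cdots$. $p(G)$ is the number of positive eigenvalues and $\eta(G)$ the nullity. $\mathcal{G}^s(m)$ is the set of graphs on $m$ vertices with $p(G)=2$ and $\eta(G)=s$. $G+H$ is disjoint union; $K_m$ complete graph; $K_{n_1,\ldots,n_l}$ complete multipartite graph. $N(u)$ is the neighbourhood of $u$. Congruent vertices: a vertex $u$ of $G$ is a congruent vertex of I-type if there is a vertex $v\neq u$ not adjacent to $u$ with $N(u)=N(v)$. A vertex $u$ is a congruent vertex of II-type if there exist two non-adjacent vertices $v,w$ (distinct from $u$) such that $N(u)$ is the disjoint union of $N(v)$ and $N(w)$. An induced $4$-cycle $uvxy$ (edges $uv,vx,xy,yu$) of $G$ is congruent if, for some pair of independent edges of it, say $uv$ and $xy$, we have $N(u)\setminus\{y,v\}=N(v)\setminus\{u,x\}$ and $N(x)\setminus\{v,y\}=N(y)\setminus\{x,u\}$; a vertex is a congruent vertex of III-type if it lies on some congruent induced $4$-cycle. For $i=1,2,3$ and $s\ge 2$, $\mathcal{G}_i^s(n)$ is the set of connected graphs $G$ of order $n$ obtained by adding to some graph $H\in\mathcal{G}^{s-1}(n-1)$ one vertex which is a congruent vertex of I-type ($i=1$), II-type ($i=2$), III-type ($i=3$) in the resulting graph $G$. The graph $G_m$ ($m\geq 2$): take disjoint cliques on $V=\{v_1,\ldots,v_{\lceil m/2\rceil}\}$ and $W=\{w_1,\ldots,w_{\lfloor m/2\rfloor}\}$, and join $v_i$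 to exactly the vertices $w_j$ with $j\geq \lfloor m/2\rfloor-i+2$ (so $N_W(v_1)=\emptyset\subset N_W(v_2)=\{w_{\lfloor m/2\rfloor}\}\subset\cdots$). For a graph $F$ on vertices $u_1,\dots,u_k$ and positive integers $n_1,\dots,n_k$, the generalized lexicographic product $F[K_{n_1},\ldots,K_{n_k}]$ is obtained by replacing each $u_j$ by a clique $K_{n_j}$ and joining every vertex of $K_{n_i}$ to every vertex of $K_{n_j}$ whenever $u_i\sim u_j$. $\mathcal{D}^\ast$ is the set of graphs $G_k[K_{n_1},\ldots,K_{n_k}]$ with $4\leq k\leq 14$, all $n_i\geq 1$, $n_1+\cdots+n_k\leq 14$, and $\lambda_3=\lambda_4=0$. *)

theory Defs
  imports
    "Graph_Theory.Graph_Theory"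
    "Jordan_Normal_Form.Char_Poly"
    "HOL-Library.Multiset"
begin

text \<open>
  Finite simple undirected graphs are the \<open>pair_graph\<close>s of the Graph Theory library: finite,
  loop-free, symmetric \<open>parcs\<close>.  Their isomorphism is \<open>digraph_iso\<close>.  The name \<open>connected\<close> is always
  qualified, because \<open>Complex_Main\<close> has a topological \<open>connected\<close>.
\<close>

section \<open>Spectrum\<close>

text \<open>
  The enumeration of the vertices is chosen arbitrarily; another choice conjugates the matrix by
  a permutation matrix and leaves the characteristic polynomial unchanged.
\<close>
definition adj_mat :: "'a pair_pre_digraph \<Rightarrow> real mat" where
  "adj_mat G =
    (let vs = (SOME vs. distinct vs \<and> set vs = pverts G)
     in mat (length vs) (length vs) (\<lambda>(i, j). if (vs ! i, vs ! j) \<in> parcs G then 1 else 0))"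

text \<open>
  The list \<open>\<lambda>\<^sub>1 \<ge> \<lambda>\<^sub>2 \<ge> \<dots>\<close>, repeated according to multiplicity.  The real roots are all
  the roots, since the adjacency matrix of an undirected graph is symmetric.
\<close>
definition eigenvalues :: "'a pair_pre_digraph \<Rightarrow> real list" where
  "eigenvalues G = rev (sorted_list_of_multiset (proots (char_poly (adj_mat G))))"

definition nth_eigenvalue :: "'a pair_pre_digraph \<Rightarrow> nat \<Rightarrow> real" where
  "nth_eigenvalue G i = eigenvalues G ! (i - 1)"

definition positive_index :: "'a pair_pre_digraph \<Rightarrow> nat" where
  "positive_index G = length (filter (\<lambda>x. x > 0) (eigenvalues G))"

definition nullity :: "'a pair_pre_digraph \<Rightarrow> nat" where
  "nullity G = length (filter (\<lambda>x. x = 0) (eigenvalues G))"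

text \<open>\<open>two_pos s m\<close> is \<open>\<G>\<^sup>s(m)\<close>.\<close>
definition two_pos :: "nat \<Rightarrow> nat \<Rightarrow> 'a pair_pre_digraph set" where
  "two_pos s m =
    {G. pair_graph G \<and> card (pverts G) = m \<and> positive_index G = 2 \<and> nullity G = s}"

section \<open>Graph constructions\<close>

definition disjoint_sum :: "'a pair_pre_digraph \<Rightarrow> 'b pair_pre_digraph \<Rightarrow> ('a + 'b) pair_pre_digraph"
  where
  "disjoint_sum G H =
    \<lparr> pverts = pverts G <+> pverts H,
      parcs = {(Inl u, Inl v) | u v. (u, v) \<in> parcs G} \<union> {(Inr u, Inr v) | u v. (u, v) \<in> parcs H} \<rparr>"

definition complete_graph :: "nat \<Rightarrow> nat pair_pre_digraph" where
  "complete_graph m = \<lparr> pverts = {..<m}, parcs = {(u, v). u < m \<and> v < m \<and> u \<noteq> v} \<rparr>"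

text \<open>The vertex \<open>(i, a)\<close> is the \<open>a\<close>-th vertex of the \<open>i\<close>-th part.\<close>
definition complete_multipartite :: "nat list \<Rightarrow> (nat \<times> nat) pair_pre_digraph" where
  "complete_multipartite ts =
    (let V = {(i, a). i < length ts \<and> a < ts ! i}
     in \<lparr> pverts = V, parcs = {(u, v). u \<in> V \<and> v \<in> V \<and> fst u \<noteq> fst v} \<rparr>)"

text \<open>
  \<open>lex_cliques F c\<close> is the generalized lexicographic product in which every vertex \<open>u\<close> of \<open>F\<close> is
  replaced by a clique with \<open>c u\<close> vertices.
\<close>
definition lex_cliques :: "'a pair_pre_digraph \<Rightarrow> ('a \<Rightarrow> nat) \<Rightarrow> ('a \<times> nat) pair_pre_digraph" where
  "lex_cliques F c =
    (let V = {(u, a). u \<in> pverts F \<and> a < c u}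
     in \<lparr> pverts = V,
          parcs = {(x, y). x \<in> V \<and> y \<in> V \<and>
                     ((fst x, fst y) \<in> parcs F \<or> fst x = fst y \<and> snd x \<noteq> snd y)} \<rparr>)"

text \<open>
  \<open>Inl i\<close> is \<open>v\<^sub>i\<close> and \<open>Inr j\<close> is \<open>w\<^sub>j\<close>, both numbered from 1; the sizes are
  \<open>\<lceil>m/2\<rceil> = (m + 1) div 2\<close> and \<open>\<lfloor>m/2\<rfloor> = m div 2\<close>.  The adjacency condition
  \<open>j \<ge> \<lfloor>m/2\<rfloor> - i + 2\<close> is written without subtraction, which truncates on \<open>nat\<close>.
\<close>
definition cross_adjacent :: "nat \<Rightarrow> nat \<Rightarrow> nat \<Rightarrow> bool" where
  "cross_adjacent m i j \<longleftrightarrow> m div 2 + 2 \<le> i + j"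

definition G_graph :: "nat \<Rightarrow> (nat + nat) pair_pre_digraph" where
  "G_graph m =
    (let V = {1..(m + 1) div 2}; W = {1..m div 2}
     in \<lparr> pverts = V <+> W,
          parcs = {(Inl i, Inl i') | i i'. i \<in> V \<and> i' \<in> V \<and> i \<noteq> i'}
                \<union> {(Inr j, Inr j') | j j'. j \<in> W \<and> j' \<in> W \<and> j \<noteq> j'}
                \<union> {(Inl i, Inr j) | i j. i \<in> V \<and> j \<in> W \<and> cross_adjacent m i j}
                \<union> {(Inr j, Inl i) | i j. i \<in> V \<and> j \<in> W \<and> cross_adjacent m i j} \<rparr>)"

text \<open>The class \<open>\<D>\<^sup>*\<close>, closed under isomorphism.\<close>
definition D_star :: "'a pair_pre_digraph set" where
  "D_star =
    {G. pair_graph G \<and>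
        (\<exists>k c. 4 \<le> k \<and> k \<le> 14 \<and>
               (\<forall>u \<in> pverts (G_graph k). c u \<ge> 1) \<and>
               (\<Sum>u \<in> pverts (G_graph k). c u) \<le> 14 \<and>
               digraph_iso (with_proj G) (with_proj (lex_cliques (G_graph k) c))) \<and>
        nth_eigenvalue G 3 = 0 \<and> nth_eigenvalue G 4 = 0}"

section \<open>Congruent vertices\<close>

definition nbhd :: "'a pair_pre_digraph \<Rightarrow> 'a \<Rightarrow> 'a set" where
  "nbhd G u = {v. (u, v) \<in> parcs G}"

definition congruent_I :: "'a pair_pre_digraph \<Rightarrow> 'a \<Rightarrow> bool" where
  "congruent_I G u \<longleftrightarrow>
    u \<in> pverts G \<and> (\<exists>v \<in> pverts G. v \<noteq> u \<and> (u, v) \<notin> parcs G \<and> nbhd G u = nbhd G v)"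

definition congruent_II :: "'a pair_pre_digraph \<Rightarrow> 'a \<Rightarrow> bool" where
  "congruent_II G u \<longleftrightarrow>
    u \<in> pverts G \<and>
    (\<exists>v \<in> pverts G. \<exists>w \<in> pverts G. v \<noteq> u \<and> w \<noteq> u \<and> v \<noteq> w \<and> (v, w) \<notin> parcs G \<and>
       nbhd G u = nbhd G v \<union> nbhd G w \<and> nbhd G v \<inter> nbhd G w = {})"

definition induced_C4 :: "'a pair_pre_digraph \<Rightarrow> 'a \<Rightarrow> 'a \<Rightarrow> 'a \<Rightarrow> 'a \<Rightarrow> bool" where
  "induced_C4 G u v x y \<longleftrightarrow>
    distinct [u, v, x, y] \<and> {u, v, x, y} \<subseteq> pverts G \<and>
    (u, v) \<in> parcs G \<and> (v, x) \<in> parcs G \<and> (x, y) \<in> parcs G \<and> (y, u) \<in> parcs G \<and>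
    (u, x) \<notin> parcs G \<and> (v, y) \<notin> parcs G"

text \<open>The condition on the 4-cycle \<open>uvxy\<close> for the pair of independent edges \<open>uv\<close>, \<open>xy\<close>.\<close>
definition congruent_pair :: "'a pair_pre_digraph \<Rightarrow> 'a \<Rightarrow> 'a \<Rightarrow> 'a \<Rightarrow> 'a \<Rightarrow> bool" where
  "congruent_pair G u v x y \<longleftrightarrow>
    nbhd G u - {y, v} = nbhd G v - {u, x} \<and> nbhd G x - {v, y} = nbhd G y - {x, u}"

text \<open>The second disjunct is the other pair of independent edges, \<open>vx\<close> and \<open>yu\<close>.\<close>
definition congruent_C4 :: "'a pair_pre_digraph \<Rightarrow> 'a \<Rightarrow> 'a \<Rightarrow> 'a \<Rightarrow> 'a \<Rightarrow> bool" where
  "congruent_C4 G u v x y \<longleftrightarrow>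
    induced_C4 G u v x y \<and> (congruent_pair G u v x y \<or> congruent_pair G v x y u)"

definition congruent_III :: "'a pair_pre_digraph \<Rightarrow> 'a \<Rightarrow> bool" where
  "congruent_III G z \<longleftrightarrow> (\<exists>u v x y. congruent_C4 G u v x y \<and> z \<in> {u, v, x, y})"

text \<open>
  Connected graphs of order \<open>n\<close> obtained from some \<open>H \<in> \<G>\<^sup>s\<^sup>-\<^sup>1(n-1)\<close> by adding one vertex \<open>u\<close>
  satisfying \<open>P\<close> in the resulting graph, i.e. \<open>H = G - u\<close>.
\<close>
definition one_vertex_ext ::
  "('a pair_pre_digraph \<Rightarrow> 'a \<Rightarrow> bool) \<Rightarrow> nat \<Rightarrow> nat \<Rightarrow> 'a pair_pre_digraph set" where
  "one_vertex_ext P s n =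
    {G. pair_graph G \<and> Digraph_Component.connected (with_proj G) \<and> card (pverts G) = n \<and>
        (\<exists>H \<in> two_pos (s - 1) (n - 1). \<exists>u \<in> pverts G.
           with_proj H = pre_digraph.del_vert (with_proj G) u \<and> P G u)}"

definition two_pos_I :: "nat \<Rightarrow> nat \<Rightarrow> 'a pair_pre_digraph set" where
  "two_pos_I = one_vertex_ext congruent_I"

definition two_pos_II :: "nat \<Rightarrow> nat \<Rightarrow> 'a pair_pre_digraph set" where
  "two_pos_II = one_vertex_ext congruent_II"

definition two_pos_III :: "nat \<Rightarrow> nat \<Rightarrow> 'a pair_pre_digraph set" where
  "two_pos_III = one_vertex_ext congruent_III"

end

theory Submission
  imports Defs "HOL-Analysis.Function_Topology"
begin

text \<open>
  A congruent vertex lies in the support of an explicit null vector, so deleting it lowers the nullity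
  by one and preserves the other two indices. Conversely, let there be exactly two positive
  eigenvalues and no congruent vertex. Totally isotropic subspaces modulo the kernel have dimension at
  most 2, so three independent vertices are linearly dependent, which yields a congruent vertex of
  type I or II, and an induced 4-cycle yields one of type III. Hence a connected graph without
  congruent vertices is a chain graph: two cliques with nested neighbourhoods, described by a word in
  two letters and thus by some \<open>G_graph k\<close> with its vertices replaced by cliques.

  For such a word a null vector is determined by its two clique sums, so the nullity is at most 2, and
  it is 2 iff the word, read in the two standard unipotent generators of \<open>SL\<^sub>2(\<int>)\<close>, evaluates
  to a certain element of order 6. The inertia is invariant under the braid relation, so the word may
  be put into Garside normal form: a power of the half twist times a word without half twists. The
  latter part grows too fast unless it has length at most 2, and five half twists already force three
  positive eigenvalues. This bounds the length by \<open>3 \<cdot> 4 + 2 = 14\<close>.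
\<close>

text \<open>Two invariants of a word have to cooperate. The nullity sees only the image in
  \<open>SL_2(Z)\<close>, where four half twists act trivially, so no condition on the action alone
  can bound the length; the inertia sees the braid itself. Hence the action bounds the part free of
  half twists, and the positive index bounds their number. The element required by nullity 2 is
  \<open>(a, b) -> (b, b - a)\<close>, a root of \<open>t^2 - t + 1\<close>. It keeps vectors with
  entries of absolute value 1 small, while words free of half twists expand suitable vectors of this
  kind; half twists only rotate these vectors among themselves. For the converse no graph of the
  exceptional class is inspected: its members are chain graphs, so their nullity is at most 2, and
  they contain an induced path on four vertices, so they have at least two positive eigenvalues. The
  conditions on the third and fourth eigenvalue then fix both numbers. Eigenvalues are given as
  roots of a characteristic polynomial. An orthonormal eigenbasis turns the indices into maximal
  sizes of definite families, and from there on mostly quadratic forms and explicit vectors are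
  handled.\<close>

lemma underdetermined_system:
  fixes a :: "'j \<Rightarrow> 'i \<Rightarrow> real"
  assumes "finite J" "finite I" "card J < card I"
  shows "\<exists>c. (\<exists>i\<in>I. c i \<noteq> 0) \<and> (\<forall>j\<in>J. (\<Sum>i\<in>I. a j i * c i) = 0)"
  using assms
proof (induction J arbitrary: I a rule: finite_induct)
  case empty
  then have "I \<noteq> {}" by auto
  then show ?case by (intro exI[of _ "\<lambda>_. 1"]) auto
next
  case (insert j0 J)
  have card: "card J + 1 < card I" using insert by simp
  show ?case
  proof (cases "\<forall>i\<in>I. a j0 i = 0")
    case True
    obtain c where "\<exists>i\<in>I. c i \<noteq> 0" "\<forall>j\<in>J. (\<Sum>i\<in>I. a j i * c i) = 0"
      using insert.IH[of I a] insert.prems card by auto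
    with True show ?thesis by (intro exI[of _ c]) auto
  next
    case False
    then obtain p where p: "p \<in> I" "a j0 p \<noteq> 0" by auto
    have "card J < card (I - {p})" using card p insert.prems by simp
    \<comment> \<open>Gaussian elimination with pivot \<open>p\<close>: row \<open>j0\<close> clears
      column \<open>p\<close> in the other rows, and the coefficient at \<open>p\<close> is
      recovered from row \<open>j0\<close> afterwards.\<close>
    from insert.IH[OF _ this, of "\<lambda>j i. a j i - a j p * a j0 i / a j0 p"] insert.prems
    obtain c where c: "\<exists>i\<in>I-{p}. c i \<noteq> 0"
      "\<forall>j\<in>J. (\<Sum>i\<in>I-{p}. (a j i - a j p * a j0 i / a j0 p) * c i) = 0" by auto
    define s where "s = (\<Sum>i\<in>I-{p}. a j0 i * c i)"
    define d where "d = c(p := - s / a j0 p)"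
    have split: "(\<Sum>i\<in>I. a j i * d i) = a j p * (- s / a j0 p) + (\<Sum>i\<in>I-{p}. a j i * c i)" for j
      using insert.prems(1) p by (subst sum.remove[of I p]) (auto simp: d_def intro!: sum.cong)
    have "(\<Sum>i\<in>I. a j i * d i) = 0" if "j \<in> J" for j
    proof -
      have "(\<Sum>i\<in>I-{p}. (a j i - a j p * a j0 i / a j0 p) * c i)
          = (\<Sum>i\<in>I-{p}. a j i * c i) - a j p / a j0 p * s"
        unfolding s_def sum_distrib_left sum_subtractf[symmetric]
        by (intro sum.cong) (auto simp: field_simps)
      then show ?thesis using c(2) that unfolding split by auto
    qed
    moreover have "(\<Sum>i\<in>I. a j0 i * d i) = 0" unfolding split using p by (simp add: s_def)
    moreover have "\<exists>i\<in>I. d i \<noteq> 0" using c(1) by (auto simp: d_def)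
    ultimately show ?thesis by auto
  qed
qed

section \<open>Spectral theorem for symmetric matrices on a finite index set\<close>

text \<open>Vectors are total functions of which only the values on \<open>V\<close> count, so
  identities between vectors are needed only pointwise on \<open>V\<close>.\<close>

definition ip :: "'a set \<Rightarrow> ('a \<Rightarrow> real) \<Rightarrow> ('a \<Rightarrow> real) \<Rightarrow> real" where
  "ip V x y = (\<Sum>v\<in>V. x v * y v)"

definition mat_op :: "'a set \<Rightarrow> ('a \<Rightarrow> 'a \<Rightarrow> real) \<Rightarrow> ('a \<Rightarrow> real) \<Rightarrow> 'a \<Rightarrow> real" where
  "mat_op V a x = (\<lambda>u. \<Sum>v\<in>V. a u v * x v)"

lemma ip_commute: "ip V x y = ip V y x"
  by (simp add: ip_def mult.commute)

lemma ip_add: "ip V (\<lambda>v. x v + y v) z = ip V x z + ip V y z"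
  by (simp add: ip_def algebra_simps sum.distrib)

lemma ip_scale: "ip V (\<lambda>v. c * x v) z = c * ip V x z"
  by (simp add: ip_def algebra_simps sum_distrib_left)

lemma ip_sum: "ip V (\<lambda>v. \<Sum>i\<in>I. c i * f i v) z = (\<Sum>i\<in>I. c i * ip V (f i) z)"
  unfolding ip_def sum_distrib_right sum_distrib_left
  by (subst sum.swap) (simp add: mult.assoc)

lemma ip_cong: "(\<And>v. v \<in> V \<Longrightarrow> x v = x' v) \<Longrightarrow> (\<And>v. v \<in> V \<Longrightarrow> y v = y' v) \<Longrightarrow> ip V x y = ip V x' y'"
  by (simp add: ip_def)

lemma ip_self_zero: "finite V \<Longrightarrow> ip V x x \<le> 0 \<Longrightarrow> v \<in> V \<Longrightarrow> x v = 0"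
  using sum_nonneg_eq_0_iff[of V "\<lambda>v. x v * x v"] sum_nonneg[of V "\<lambda>v. x v * x v"]
  by (force simp: ip_def)

lemma ip_self_nonneg: "ip V x x \<ge> 0"
  by (simp add: ip_def sum_nonneg)

lemma mat_op_add: "mat_op V a (\<lambda>v. x v + y v) u = mat_op V a x u + mat_op V a y u"
  by (simp add: mat_op_def algebra_simps sum.distrib)

lemma mat_op_scale: "mat_op V a (\<lambda>v. c * x v) u = c * mat_op V a x u"
  by (simp add: mat_op_def algebra_simps sum_distrib_left)

lemma mat_op_sum: "mat_op V a (\<lambda>v. \<Sum>i\<in>I. c i * f i v) u = (\<Sum>i\<in>I. c i * mat_op V a (f i) u)"
  unfolding mat_op_def sum_distrib_right sum_distrib_left
  by (subst sum.swap) (simp add: algebra_simps)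

lemma mat_op_cong: "(\<And>v. v \<in> V \<Longrightarrow> x v = y v) \<Longrightarrow> mat_op V a x u = mat_op V a y u"
  by (simp add: mat_op_def)

lemma mat_op_sym:
  assumes "\<And>u v. u \<in> V \<Longrightarrow> v \<in> V \<Longrightarrow> a u v = a v u"
  shows "ip V x (mat_op V a y) = ip V y (mat_op V a x)"
proof -
  have "ip V x (mat_op V a y) = (\<Sum>u\<in>V. \<Sum>v\<in>V. x u * a u v * y v)"
    by (simp add: ip_def mat_op_def sum_distrib_left mult.assoc)
  also have "\<dots> = (\<Sum>v\<in>V. \<Sum>u\<in>V. x u * a u v * y v)" by (rule sum.swap)
  also have "\<dots> = ip V y (mat_op V a x)"
    unfolding ip_def mat_op_def sum_distrib_left
    by (intro sum.cong) (auto simp: assms)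
  finally show ?thesis .
qed

text \<open>Near \<open>t = 0\<close> a linear term cannot stay below a quadratic one. This is the
  first-order condition at a maximum; \<open>D\<close> will be the squared norm of the residual of a
  maximiser.\<close>

lemma quadratic_bound_zero:
  fixes D C :: real
  assumes "\<And>t. 2 * t * D \<le> t\<^sup>2 * C" "D \<ge> 0"
  shows "D = 0"
proof (rule ccontr)
  assume "D \<noteq> 0"
  with assms have D: "D > 0" by simp
  define t where "t = D / (\<bar>C\<bar> + 1)"
  have t: "t > 0" using D by (simp add: t_def)
  have "2 * D \<le> t * C" using assms(1)[of t] t by (simp add: power2_eq_square mult.assoc)
  also have "\<dots> \<le> t * (\<bar>C\<bar> + 1)" using t by (intro mult_left_mono) auto
  also have "\<dots> = D" by (simp add: t_def)
  finally show False using D by simp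
qed

text \<open>The maximum of the Rayleigh quotient on the orthogonal complement of the eigenvectors found
  so far is attained at a further eigenvector.\<close>

lemma extend_orthonormal_eigenvectors:
  fixes a :: "'a \<Rightarrow> 'a \<Rightarrow> real"
  assumes fin: "finite V" and sym: "\<And>u v. u \<in> V \<Longrightarrow> v \<in> V \<Longrightarrow> a u v = a v u"
    and k: "k < card V"
    and eig: "\<And>i v. i < k \<Longrightarrow> v \<in> V \<Longrightarrow> mat_op V a (f i) v = lam i * f i v"
  shows "\<exists>w mu. ip V w w = 1 \<and> (\<forall>i<k. ip V w (f i) = 0) \<and> (\<forall>v\<in>V. mat_op V a w v = mu * w v)"
proof -
  \<comment> \<open>The functions live on the whole type; forcing them to be 0 outside
    \<open>V\<close> makes the constraint set a closed subset of a product of compact sets.\<close>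
  define B where "B = (PiE UNIV (\<lambda>v::'a. if v \<in> V then {-1..1::real} else {0}))"
  define S where "S = B \<inter> {x. ip V x x = 1} \<inter> (\<Inter>i\<in>{..<k}. {x. ip V x (f i) = 0})"
  define q where "q x = ip V x (mat_op V a x)" for x
  have S_iff: "x \<in> S \<longleftrightarrow> (\<forall>v. v \<notin> V \<longrightarrow> x v = 0) \<and> ip V x x = 1 \<and> (\<forall>i<k. ip V x (f i) = 0)" for x
  proof -
    have "\<bar>x v\<bar> \<le> 1" if "ip V x x = 1" "v \<in> V" for v
    proof -
      have "x v * x v \<le> ip V x x" unfolding ip_def
        using fin that by (intro member_le_sum) auto
      then have "(x v)\<^sup>2 \<le> 1" using that by (simp add: power2_eq_square)
      then show ?thesis by (simp add: abs_square_le_1)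
    qed
    then show ?thesis by (auto simp: S_def B_def PiE_iff abs_le_iff minus_le_iff)
  qed
  have cont_coord: "continuous_on UNIV (\<lambda>x::'a \<Rightarrow> real. x v)" for v
    by simp
  have cont_ip: "continuous_on UNIV (\<lambda>x. ip V x z)" "continuous_on UNIV (\<lambda>x. ip V x x)" for z
    unfolding ip_def by (intro continuous_intros cont_coord)+
  have cont_q: "continuous_on UNIV q"
    unfolding q_def ip_def mat_op_def by (intro continuous_intros cont_coord)
  have "compact B"
  proof -
    have "compactin (product_topology (\<lambda>i::'a. euclidean::real topology) UNIV) B"
      unfolding B_def compactin_PiE by (auto simp: compactin_euclidean_iff)
    then show ?thesis by (simp add: euclidean_product_topology compactin_euclidean_iff)
  qed
  moreover have "closed {x. ip V x x = 1}" "\<And>i. closed {x. ip V x (f i) = 0}"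
    by (intro closed_Collect_eq cont_ip continuous_intros)+
  ultimately have "compact S" unfolding S_def
    by (intro compact_Int_closed closed_INT) auto
  moreover have "S \<noteq> {}"
  proof -
    \<comment> \<open>Fewer than \<open>card V\<close> orthogonality conditions leave a nonzero
      vector, which is then normalised.\<close>
    obtain c where c: "\<exists>v\<in>V. c v \<noteq> 0" "\<forall>j\<in>{..<k}. (\<Sum>v\<in>V. f j v * c v) = 0"
      using underdetermined_system[of "{..<k}" V f] fin k by auto
    define y where "y = (\<lambda>v. if v \<in> V then c v / sqrt (ip V c c) else 0)"
    have pos: "ip V c c > 0" using c(1) ip_self_zero[OF fin, of c] by force
    have y: "ip V y z = ip V c z / sqrt (ip V c c)" for z
      unfolding y_def by (simp add: ip_def sum_divide_distrib)
    have "ip V y y = 1" unfolding y using pos by (subst ip_commute) (simp add: y)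
    moreover have "ip V y (f i) = 0" if "i < k" for i
      using c(2) that unfolding y by (simp add: ip_def mult.commute)
    ultimately have "y \<in> S" by (simp add: S_iff y_def)
    then show ?thesis by auto
  qed
  ultimately obtain w where w: "w \<in> S" "\<And>x. x \<in> S \<Longrightarrow> q x \<le> q w"
    using continuous_attains_sup[of S q] cont_q continuous_on_subset by blast
  have w1: "ip V w w = 1" "\<And>i. i < k \<Longrightarrow> ip V w (f i) = 0" using w(1) by (auto simp: S_iff)
  define l where "l = q w"
  have bound: "q y \<le> l * ip V y y" if "\<And>i. i < k \<Longrightarrow> ip V y (f i) = 0" for y
  proof (cases "ip V y y = 0")
    case True
    then have "\<And>v. v \<in> V \<Longrightarrow> y v = 0" using ip_self_zero[OF fin, of y] by simp
    then have "q y = 0" by (simp add: q_def ip_def)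
    then show ?thesis using True by simp
  next
    case False
    then have pos: "ip V y y > 0" using ip_self_nonneg[of V y] by simp
    define r where "r = 1 / sqrt (ip V y y)"
    define x where "x = (\<lambda>v. if v \<in> V then r * y v else 0)"
    have x: "ip V x z = r * ip V y z" for z
      unfolding x_def by (simp add: ip_def sum_distrib_left mult.assoc)
    have r2: "r * r * ip V y y = 1" using pos by (simp add: r_def)
    have "ip V x x = 1" unfolding x by (subst ip_commute) (simp add: x r2 mult.assoc[symmetric])
    then have "x \<in> S" using that by (simp add: S_iff x) (simp add: x_def)
    moreover have "q x = r * r * q y"
    proof -
      have "mat_op V a x u = r * mat_op V a y u" for u
        unfolding mat_op_def by (simp add: x_def sum_distrib_left algebra_simps)
      then show ?thesis unfolding q_def x by (simp add: ip_def sum_distrib_left algebra_simps)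
    qed
    ultimately have "r * r * q y \<le> l" using w(2)[of x] by (simp add: l_def)
    then have "r * r * q y * ip V y y \<le> l * ip V y y" using pos by (intro mult_right_mono) auto
    moreover have "r * r * q y * ip V y y = q y * (r * r * ip V y y)" by (simp only: ac_simps)
    ultimately show ?thesis using r2 by simp
  qed
  \<comment> \<open>The residual of \<open>w\<close> as an eigenvector for the value
    \<open>l\<close>. It is orthogonal to all \<open>f i\<close>, so \<open>w + t d\<close> is an
    admissible variation, and to first order it raises the quotient by \<open>2 * t\<close> times
    the squared norm of \<open>d\<close>.\<close>
  define d where "d = (\<lambda>v. mat_op V a w v + (- l) * w v)"
  have opw_d: "ip V (mat_op V a w) z = ip V d z + l * ip V w z" for z
    unfolding d_def ip_add ip_scale by simp
  have d_orth: "ip V d (f i) = 0" if "i < k" for i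
  proof -
    have "ip V (mat_op V a w) (f i) = ip V w (mat_op V a (f i))"
      using mat_op_sym[of V a w "f i"] sym by (metis ip_commute)
    also have "\<dots> = ip V w (\<lambda>v. lam i * f i v)" using eig that by (intro ip_cong) auto
    also have "\<dots> = lam i * ip V w (f i)" by (metis ip_commute ip_scale)
    finally show ?thesis using w1(2)[OF that] by (simp add: opw_d)
  qed
  have "ip V d d = 0"
  proof (rule quadratic_bound_zero[OF _ ip_self_nonneg])
    fix t
    define y where "y = (\<lambda>v. w v + t * d v)"
    have ipy: "ip V y z = ip V w z + t * ip V d z" for z
      by (simp add: y_def ip_add ip_scale)
    have ipy': "ip V z y = ip V z w + t * ip V z d" for z
      by (metis ip_commute ipy)
    have opy: "mat_op V a y = (\<lambda>v. mat_op V a w v + t * mat_op V a d v)"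
      by (simp add: y_def mat_op_add mat_op_scale fun_eq_iff)
    have "q y = q w + 2 * t * ip V d (mat_op V a w) + t\<^sup>2 * q d"
    proof -
      have *: "ip V z (mat_op V a y) = ip V z (mat_op V a w) + t * ip V z (mat_op V a d)" for z
        unfolding opy by (metis ip_add ip_commute ip_scale)
      have "ip V w (mat_op V a d) = ip V d (mat_op V a w)"
        by (rule mat_op_sym) (rule sym)
      then show ?thesis
        unfolding q_def by (simp add: ipy * power2_eq_square algebra_simps)
    qed
    moreover have "q y \<le> l * ip V y y"
      by (rule bound) (simp add: ipy w1 d_orth)
    moreover have "ip V y y = 1 + 2 * t * ip V w d + t\<^sup>2 * ip V d d"
      by (simp add: ipy ipy' w1 ip_commute[of V d w] power2_eq_square algebra_simps)
    moreover have "ip V d (mat_op V a w) = ip V d d + l * ip V w d"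
      using opw_d[of d] by (simp add: ip_commute)
    ultimately show "2 * t * ip V d d \<le> t\<^sup>2 * (l * ip V d d - q d)"
      by (simp add: l_def algebra_simps)
  qed
  then have "\<forall>v\<in>V. mat_op V a w v = l * w v"
    using ip_self_zero[OF fin, of d] by (auto simp: d_def)
  then show ?thesis using w1 by blast
qed

lemma orthonormal_eigenvectors:
  fixes a :: "'a \<Rightarrow> 'a \<Rightarrow> real"
  assumes fin: "finite V" and sym: "\<And>u v. u \<in> V \<Longrightarrow> v \<in> V \<Longrightarrow> a u v = a v u"
    and k: "k \<le> card V"
  shows "\<exists>f lam. (\<forall>i<k. \<forall>j<k. ip V (f i) (f j) = (if i = j then 1 else 0)) \<and>
    (\<forall>i<k. \<forall>v\<in>V. mat_op V a (f i) v = lam i * f i v)"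
  using k
proof (induction k)
  case 0
  then show ?case by auto
next
  case (Suc k)
  then obtain f :: "nat \<Rightarrow> 'a \<Rightarrow> real" and lam where
    f: "\<forall>i<k. \<forall>j<k. ip V (f i) (f j) = (if i = j then 1 else 0)"
      "\<forall>i<k. \<forall>v\<in>V. mat_op V a (f i) v = lam i * f i v" by auto
  obtain w mu where w: "ip V w w = 1" "\<forall>i<k. ip V w (f i) = 0"
    "\<forall>v\<in>V. mat_op V a w v = mu * w v"
    using extend_orthonormal_eigenvectors[of V a k f lam] fin sym Suc.prems f(2) by auto
  have "\<forall>i<k. ip V (f i) w = 0" using w(2) by (simp add: ip_commute)
  with f w show ?case
    by (intro exI[of _ "f(k := w)"] exI[of _ "lam(k := mu)"]) (auto simp: less_Suc_eq)
qed

section \<open>Inertia of a graph\<close>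

definition adj :: "'a pair_pre_digraph \<Rightarrow> 'a \<Rightarrow> 'a \<Rightarrow> real" where
  "adj G u v = (if (u, v) \<in> parcs G then 1 else 0)"

abbreviation adj_op :: "'a pair_pre_digraph \<Rightarrow> ('a \<Rightarrow> real) \<Rightarrow> 'a \<Rightarrow> real" where
  "adj_op G \<equiv> mat_op (pverts G) (adj G)"

definition qform :: "'a pair_pre_digraph \<Rightarrow> ('a \<Rightarrow> real) \<Rightarrow> real" where
  "qform G x = ip (pverts G) x (adj_op G x)"

text \<open>\<open>e = 1\<close> counts the positive and \<open>e = -1\<close> the negative
  eigenvalues; the parameter lets one proof serve both halves of the inertia.\<close>

definition sgn_index :: "real \<Rightarrow> 'a pair_pre_digraph \<Rightarrow> nat" where
  "sgn_index e G = length (filter (\<lambda>x. e * x > 0) (eigenvalues G))"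

lemma pair_graph_finite: "pair_graph G \<Longrightarrow> finite (pverts G)"
  using pair_fin_digraph.pair_finite_verts pair_graph.axioms(1) pair_digraph.axioms(1) by blast

lemma pair_graph_sym: "pair_graph G \<Longrightarrow> (u, v) \<in> parcs G \<longleftrightarrow> (v, u) \<in> parcs G"
proof -
  assume "pair_graph G"
  then interpret pair_graph G .
  show ?thesis using pair_sym_arcs by (auto simp: symmetric_def dest: symD)
qed

lemma pair_graph_irrefl: "pair_graph G \<Longrightarrow> (u, u) \<notin> parcs G"
proof -
  assume "pair_graph G"
  then interpret pair_graph G .
  show ?thesis using no_loops' by blast
qed

lemma pair_graph_verts:
  assumes "pair_graph G" "(u, v) \<in> parcs G" shows "u \<in> pverts G" "v \<in> pverts G"
proof -
  interpret pair_graph G by fact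
  show "u \<in> pverts G" "v \<in> pverts G" using assms(2) by (auto dest: in_arcsD1 in_arcsD2)
qed

lemma pair_graphI:
  assumes "finite (pverts G)" "parcs G \<subseteq> pverts G \<times> pverts G"
    "\<And>u v. (u, v) \<in> parcs G \<Longrightarrow> (v, u) \<in> parcs G" "\<And>u. (u, u) \<notin> parcs G"
  shows "pair_graph G"
proof -
  have "finite (parcs G)" using assms(1,2) finite_subset by blast
  with assms show ?thesis
    by unfold_locales (auto simp: symmetric_def intro!: symI)
qed

lemma adj_sym: "pair_graph G \<Longrightarrow> adj G u v = adj G v u"
  by (simp add: adj_def pair_graph_sym)

lemma sum_list_index:
  assumes "distinct vs" "set vs = V"
  shows "(\<Sum>k = 0..<length vs. g (vs ! k)) = (\<Sum>v\<in>V. g v)"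
  using sum.reindex_bij_betw[OF bij_betw_nth[of vs "{0..<length vs}" V]] assms
  by (simp add: lessThan_atLeast0)

text \<open>The third conjunct is \<open>U U^T = 1\<close> for the matrix \<open>U\<close> with
  columns \<open>f i\<close>; it yields the expansion of an arbitrary vector.\<close>

definition eigenbasis :: "'a pair_pre_digraph \<Rightarrow> nat \<Rightarrow> (nat \<Rightarrow> 'a \<Rightarrow> real) \<Rightarrow> (nat \<Rightarrow> real) \<Rightarrow> bool" where
  "eigenbasis G n f lam \<longleftrightarrow>
    (\<forall>i<n. \<forall>j<n. ip (pverts G) (f i) (f j) = (if i = j then 1 else 0)) \<and>
    (\<forall>i<n. \<forall>v\<in>pverts G. adj_op G (f i) v = lam i * f i v) \<and>
    (\<forall>u\<in>pverts G. \<forall>v\<in>pverts G. (\<Sum>i<n. f i u * f i v) = (if u = v then 1 else 0)) \<and>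
    mset (eigenvalues G) = mset (map lam [0..<n])"

lemma eigenbasisD:
  assumes "eigenbasis G n f lam"
  shows "i < n \<Longrightarrow> j < n \<Longrightarrow> ip (pverts G) (f i) (f j) = (if i = j then 1 else 0)"
    "i < n \<Longrightarrow> v \<in> pverts G \<Longrightarrow> adj_op G (f i) v = lam i * f i v"
    "u \<in> pverts G \<Longrightarrow> v \<in> pverts G \<Longrightarrow> (\<Sum>i<n. f i u * f i v) = (if u = v then 1 else 0)"
    "mset (eigenvalues G) = mset (map lam [0..<n])"
  using assms unfolding eigenbasis_def by blast+

text \<open>Here the index-free eigenvectors meet the enumerated matrix: they form an orthogonal
  \<open>U\<close> with \<open>A = U D U^T\<close>, similarity preserves the characteristic
  polynomial, and that of a diagonal matrix shows its roots. A left inverse of a square matrix is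
  also a right inverse, which gives completeness.\<close>

lemma eigenbasis_exists:
  assumes G: "pair_graph G"
  obtains f lam where "eigenbasis G (card (pverts G)) f lam"
proof -
  define n where n: "n = card (pverts G)"
  let ?V = "pverts G"
  have "\<exists>f lam. (\<forall>i<n. \<forall>j<n. ip ?V (f i) (f j) = (if i = j then 1 else 0)) \<and>
      (\<forall>i<n. \<forall>v\<in>?V. adj_op G (f i) v = lam i * f i v)"
    by (rule orthonormal_eigenvectors) (use pair_graph_finite[OF G] adj_sym[OF G] n in auto)
  then obtain f lam where
    f: "\<forall>i<n. \<forall>j<n. ip ?V (f i) (f j) = (if i = j then 1 else 0)"
      "\<forall>i<n. \<forall>v\<in>?V. adj_op G (f i) v = lam i * f i v" by (elim exE conjE)
  have orth: "ip ?V (f i) (f j) = (if i = j then 1 else 0)" if "i < n" "j < n" for i j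
    using f(1) that by blast
  have eig: "adj_op G (f i) v = lam i * f i v" if "i < n" "v \<in> ?V" for i v
    using f(2) that by blast
  define vs where "vs = (SOME vs. distinct vs \<and> set vs = ?V)"
  have "\<exists>vs. distinct vs \<and> set vs = ?V"
    using finite_distinct_list[OF pair_graph_finite[OF G]] by blast
  then have "distinct vs \<and> set vs = ?V" unfolding vs_def by (rule someI_ex)
  then have vs: "distinct vs" "set vs = ?V" by auto
  have len: "length vs = n" using distinct_card[OF vs(1)] vs(2) n by simp
  have vsV: "vs ! k \<in> ?V" if "k < n" for k using nth_mem[of k vs] that unfolding len vs(2) .
  have sum_vs: "(\<Sum>k = 0..<n. g (vs ! k)) = (\<Sum>v\<in>?V. g v)" for g :: "'a \<Rightarrow> real"
    using sum_list_index[OF vs, of g] unfolding len .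
  define A where "A = adj_mat G"
  have A: "A = mat n n (\<lambda>(i, j). adj G (vs ! i) (vs ! j))"
    unfolding A_def adj_mat_def vs_def[symmetric] Let_def len adj_def ..
  define U where "U = mat n n (\<lambda>(k, i). f i (vs ! k))"
  define Ut where "Ut = mat n n (\<lambda>(i, k). f i (vs ! k))"
  define D where "D = mat n n (\<lambda>(i, j). if i = j then lam i else 0)"
  note carr = A U_def Ut_def D_def
  have UtU: "Ut * U = 1\<^sub>m n"
  proof (intro eq_matI)
    fix i j assume "i < dim_row (1\<^sub>m n :: real mat)" "j < dim_col (1\<^sub>m n :: real mat)"
    then have ij: "i < n" "j < n" by auto
    have "(Ut * U) $$ (i, j) = (\<Sum>k = 0..<n. f i (vs ! k) * f j (vs ! k))"
      using ij by (simp add: Ut_def U_def times_mat_def scalar_prod_def)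
    also have "\<dots> = ip ?V (f i) (f j)" unfolding ip_def by (rule sum_vs)
    finally show "(Ut * U) $$ (i, j) = 1\<^sub>m n $$ (i, j)" using ij orth by simp
  qed (auto simp: Ut_def U_def)
  have UUt: "U * Ut = 1\<^sub>m n"
    by (rule mat_mult_left_right_inverse[OF _ _ UtU]) (auto simp: Ut_def U_def)
  have AU: "A * U = U * D"
  proof (intro eq_matI)
    fix k i assume "k < dim_row (U * D)" "i < dim_col (U * D)"
    then have ki: "k < n" "i < n" by (auto simp: U_def D_def)
    have "(A * U) $$ (k, i) = (\<Sum>l = 0..<n. adj G (vs ! k) (vs ! l) * f i (vs ! l))"
      using ki by (simp add: A U_def times_mat_def scalar_prod_def)
    also have "\<dots> = adj_op G (f i) (vs ! k)" unfolding mat_op_def by (rule sum_vs)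
    also have "\<dots> = lam i * f i (vs ! k)" using eig ki vsV by simp
    also have "\<dots> = (\<Sum>l = 0..<n. f l (vs ! k) * (if l = i then lam l else 0))"
      using ki by (simp add: if_distrib sum.delta cong: if_cong)
    also have "\<dots> = (U * D) $$ (k, i)"
      using ki by (simp add: D_def U_def times_mat_def scalar_prod_def)
    finally show "(A * U) $$ (k, i) = (U * D) $$ (k, i)" .
  qed (auto simp: A U_def D_def)
  have "A = A * (U * Ut)" unfolding UUt by (simp add: A)
  also have "\<dots> = A * U * Ut" by (rule assoc_mult_mat[symmetric]) (auto simp: carr)
  finally have "A = U * D * Ut" unfolding AU .
  then have "similar_mat A D"
    using UUt UtU by (intro similar_matI[of _ _ U Ut n]) (auto simp: carr)
  then have "char_poly A = char_poly D" by (rule char_poly_similar)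
  also have "\<dots> = (\<Prod>a\<leftarrow>diag_mat D. [:- a, 1:])"
    by (rule char_poly_upper_triangular[of _ n]) (auto simp: D_def)
  also have "diag_mat D = map lam [0..<n]"
    by (auto simp: diag_mat_def D_def)
  finally have cp: "char_poly A = (\<Prod>a\<leftarrow>map lam [0..<n]. [:- a, 1:])" .
  have proots_linear: "proots (\<Prod>a\<leftarrow>xs. [:- a, 1:]) = mset xs" for xs :: "real list"
  proof (induction xs)
    case (Cons x xs)
    have "(\<Prod>a\<leftarrow>xs. [:- a, 1:]) \<noteq> (0 :: real poly)" by (auto simp: prod_list_zero_iff)
    then show ?case using Cons by (simp add: proots_mult del: mult_pCons_left)
  qed simp
  have "mset (eigenvalues G) = mset (map lam [0..<n])"
    unfolding eigenvalues_def A_def[symmetric] cp proots_linear by simp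
  moreover have "(\<Sum>i<n. f i u * f i v) = (if u = v then 1 else 0)" if uv: "u \<in> ?V" "v \<in> ?V" for u v
  proof -
    obtain k l where kl: "k < n" "l < n" "u = vs ! k" "v = vs ! l"
      using uv unfolding vs(2)[symmetric] in_set_conv_nth len by blast
    have "(\<Sum>i<n. f i u * f i v) = (U * Ut) $$ (k, l)"
      using kl by (simp add: Ut_def U_def times_mat_def scalar_prod_def lessThan_atLeast0)
    then show ?thesis unfolding UUt using kl vs len by (auto simp: nth_eq_iff_index_eq)
  qed
  ultimately show thesis using that[of f lam] orth eig unfolding eigenbasis_def n[symmetric] by blast
qed

lemma length_filter_mset:
  assumes "mset xs = mset (map lam [0..<n])"
  shows "length (filter P xs) = card {i. i < n \<and> P (lam i)}"
proof -
  have "length (filter P xs) = size (filter_mset P (mset xs))"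
    by (metis mset_filter size_mset)
  also have "\<dots> = length (filter P (map lam [0..<n]))"
    unfolding assms by (metis mset_filter size_mset)
  also have "\<dots> = card {i. i < n \<and> P (lam i)}"
    by (simp add: filter_map o_def length_filter_conv_card)
      (metis (no_types, lifting) add.left_neutral nth_upt)
  finally show ?thesis .
qed

lemma eigen_expansion:
  assumes basis: "eigenbasis G n f lam"
    and fin: "finite (pverts G)"
  shows "v \<in> pverts G \<Longrightarrow> x v = (\<Sum>i<n. ip (pverts G) (f i) x * f i v)"
    and "v \<in> pverts G \<Longrightarrow> adj_op G x v = (\<Sum>i<n. ip (pverts G) (f i) x * (lam i * f i v))"
    and "qform G x = (\<Sum>i<n. lam i * (ip (pverts G) (f i) x)\<^sup>2)"
proof -
  note eig = eigenbasisD(2)[OF basis] and comp = eigenbasisD(3)[OF basis]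
  let ?V = "pverts G"
  have ex: "x v = (\<Sum>i<n. ip ?V (f i) x * f i v)" if "v \<in> ?V" for v
  proof -
    have "(\<Sum>i<n. ip ?V (f i) x * f i v) = (\<Sum>u\<in>?V. x u * (\<Sum>i<n. f i u * f i v))"
      unfolding ip_def sum_distrib_right sum_distrib_left
      by (subst sum.swap) (simp add: algebra_simps)
    also have "\<dots> = (\<Sum>u\<in>?V. if u = v then x u else 0)"
      by (intro sum.cong) (auto simp: comp that)
    finally show ?thesis using that fin by simp
  qed
  then show "v \<in> ?V \<Longrightarrow> x v = (\<Sum>i<n. ip ?V (f i) x * f i v)" .
  have op: "adj_op G x v = (\<Sum>i<n. ip ?V (f i) x * (lam i * f i v))" if "v \<in> ?V" for v
  proof -
    have "adj_op G x v = adj_op G (\<lambda>v. \<Sum>i<n. ip ?V (f i) x * f i v) v"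
      by (rule mat_op_cong) (rule ex)
    also have "\<dots> = (\<Sum>i<n. ip ?V (f i) x * adj_op G (f i) v)" by (rule mat_op_sum)
    finally show ?thesis using eig that by simp
  qed
  then show "v \<in> ?V \<Longrightarrow> adj_op G x v = (\<Sum>i<n. ip ?V (f i) x * (lam i * f i v))" .
  have "qform G x = ip ?V (\<lambda>v. \<Sum>i<n. (ip ?V (f i) x * lam i) * f i v) x"
    unfolding qform_def by (subst ip_commute, rule ip_cong) (auto simp: op mult.assoc)
  also have "\<dots> = (\<Sum>i<n. (ip ?V (f i) x * lam i) * ip ?V (f i) x)" by (rule ip_sum)
  also have "\<dots> = (\<Sum>i<n. lam i * (ip ?V (f i) x)\<^sup>2)"
    by (simp add: power2_eq_square algebra_simps)
  finally show "qform G x = (\<Sum>i<n. lam i * (ip ?V (f i) x)\<^sup>2)" .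
qed

lemma index_sum:
  assumes "pair_graph G"
  shows "sgn_index 1 G + sgn_index (-1) G + nullity G = card (pverts G)"
proof -
  define n where "n = card (pverts G)"
  obtain f lam where "eigenbasis G n f lam"
    using eigenbasis_exists[OF assms] unfolding n_def by blast
  note * = eigenbasisD(4)[OF this]
  have "sgn_index 1 G + sgn_index (-1) G + nullity G =
    card {i. i < n \<and> lam i > 0} + card {i. i < n \<and> lam i < 0} + card {i. i < n \<and> lam i = 0}"
    unfolding sgn_index_def nullity_def length_filter_mset[OF *] by simp
  also have "\<dots> = card ({i. i < n \<and> lam i > 0} \<union> {i. i < n \<and> lam i < 0} \<union> {i. i < n \<and> lam i = 0})"
    by (subst card_Un_disjoint; auto)+
  also have "{i. i < n \<and> lam i > 0} \<union> {i. i < n \<and> lam i < 0} \<union> {i. i < n \<and> lam i = 0} = {..<n}"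
    by auto
  finally show ?thesis by (simp add: n_def)
qed

lemma positive_index_eq: "positive_index G = sgn_index 1 G"
  by (simp add: positive_index_def sgn_index_def)

section \<open>Indices of inertia as maximal sizes of definite families\<close>

definition definite_family :: "real \<Rightarrow> 'a pair_pre_digraph \<Rightarrow> nat \<Rightarrow> (nat \<Rightarrow> 'a \<Rightarrow> real) \<Rightarrow> bool" where
  "definite_family e G k g \<longleftrightarrow>
    (\<forall>c. (\<exists>i<k. c i \<noteq> 0) \<longrightarrow> e * qform G (\<lambda>v. \<Sum>i<k. c i * g i v) > 0)"

text \<open>More vectors than eigenvalues of sign \<open>e\<close> admit a combination orthogonal to
  all eigenvectors of that sign. The form is semidefinite on such vectors, and an isotropic vector
  of a semidefinite form lies in the kernel. Applied to isotropic families, this is the source of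
  all null vectors in the structural part.\<close>

lemma semidefinite_combination:
  assumes G: "pair_graph G" and I: "finite I" "card I > sgn_index e G" and e: "e \<noteq> 0"
  shows "\<exists>c. (\<exists>i\<in>I. c i \<noteq> 0) \<and> e * qform G (\<lambda>v. \<Sum>i\<in>I. c i * g i v) \<le> 0 \<and>
    (qform G (\<lambda>v. \<Sum>i\<in>I. c i * g i v) = 0 \<longrightarrow>
      (\<forall>v\<in>pverts G. adj_op G (\<lambda>v. \<Sum>i\<in>I. c i * g i v) v = 0))"
proof -
  let ?V = "pverts G"
  define n where "n = card ?V"
  obtain f lam where basis: "eigenbasis G n f lam"
    using eigenbasis_exists[OF G] unfolding n_def by blast
  note orth = eigenbasisD(1)[OF basis] and eig = eigenbasisD(2)[OF basis] and ev = eigenbasisD(4)[OF basis]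
  note expand = eigen_expansion[OF basis pair_graph_finite[OF G]]
  define J where "J = {j. j < n \<and> e * lam j > 0}"
  have J: "finite J" "card J < card I"
    using I(2) unfolding J_def sgn_index_def length_filter_mset[OF ev] by auto
  obtain c where c: "\<exists>i\<in>I. c i \<noteq> 0" "\<forall>j\<in>J. (\<Sum>i\<in>I. ip ?V (g i) (f j) * c i) = 0"
    using underdetermined_system[OF J(1) I(1) J(2), of "\<lambda>j i. ip ?V (g i) (f j)"] by auto
  define z where "z = (\<lambda>v. \<Sum>i\<in>I. c i * g i v)"
  have zj: "ip ?V (f j) z = 0" if "j \<in> J" for j
  proof -
    have "ip ?V (f j) z = (\<Sum>i\<in>I. c i * ip ?V (g i) (f j))"
      unfolding z_def by (subst ip_commute) (rule ip_sum)
    then show ?thesis using c(2) that by (simp add: mult.commute)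
  qed
  have nonpos: "e * (lam j * (ip ?V (f j) z)\<^sup>2) \<le> 0" if "j < n" for j
  proof (cases "j \<in> J")
    case False
    then have "e * lam j \<le> 0" using that by (auto simp: J_def)
    then show ?thesis by (simp add: mult.assoc[symmetric] mult_nonpos_nonneg)
  qed (simp add: zj)
  have q: "e * qform G z = (\<Sum>j<n. e * (lam j * (ip ?V (f j) z)\<^sup>2))"
    by (simp add: expand(3) sum_distrib_left)
  have "e * qform G z \<le> 0" unfolding q by (intro sum_nonpos) (auto intro: nonpos)
  moreover have "adj_op G z v = 0" if "qform G z = 0" "v \<in> ?V" for v
  proof -
    have "(\<Sum>j<n. - (e * (lam j * (ip ?V (f j) z)\<^sup>2))) = 0"
      using q that(1) by (simp add: sum_negf)
    then have "\<forall>j\<in>{..<n}. - (e * (lam j * (ip ?V (f j) z)\<^sup>2)) = 0"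
      by (subst (asm) sum_nonneg_eq_0_iff) (use nonpos in auto)
    then have "\<forall>j<n. ip ?V (f j) z * (lam j * f j v) = 0" using e by auto
    then show ?thesis unfolding expand(2)[OF that(2)] by (auto intro!: sum.neutral)
  qed
  ultimately show ?thesis using c(1) unfolding z_def by blast
qed

lemma definite_family_le:
  assumes "pair_graph G" "e \<noteq> 0" "definite_family e G k g"
  shows "k \<le> sgn_index e G"
proof (rule ccontr)
  assume "\<not> k \<le> sgn_index e G"
  then have "card {..<k} > sgn_index e G" by simp
  from semidefinite_combination[OF assms(1) finite_lessThan this assms(2), of g]
  obtain c where "\<exists>i\<in>{..<k}. c i \<noteq> 0" "e * qform G (\<lambda>v. \<Sum>i<k. c i * g i v) \<le> 0" by blast
  moreover from this(1) have "\<exists>i<k. c i \<noteq> 0" by blast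
  ultimately show False using assms(3) unfolding definite_family_def by (meson not_less)
qed

text \<open>The eigenvectors of sign \<open>e\<close> themselves serve. Together with
  \<open>definite_family_le\<close> this makes \<open>sgn_index e G\<close> the largest size of a
  definite family.\<close>

lemma definite_family_exists:
  assumes G: "pair_graph G" and e: "e \<noteq> 0"
  shows "\<exists>g. definite_family e G (sgn_index e G) g"
proof -
  let ?V = "pverts G"
  define n where "n = card ?V"
  obtain f lam where basis: "eigenbasis G n f lam"
    using eigenbasis_exists[OF G] unfolding n_def by blast
  note orth = eigenbasisD(1)[OF basis] and eig = eigenbasisD(2)[OF basis] and ev = eigenbasisD(4)[OF basis]
  note expand = eigen_expansion[OF basis pair_graph_finite[OF G]]
  define J where "J = {j. j < n \<and> e * lam j > 0}"
  define k where "k = sgn_index e G"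
  have "finite J" "card J = k"
    unfolding J_def k_def sgn_index_def length_filter_mset[OF ev] by auto
  then obtain h where h: "bij_betw h {..<k} J"
    by (metis finite_same_card_bij card_lessThan finite_lessThan)
  have hJ: "h i < n" "e * lam (h i) > 0" if "i < k" for i
    using bij_betwE[OF h] that by (auto simp: J_def)
  have hinj: "h i = h j \<longleftrightarrow> i = j" if "i < k" "j < k" for i j
    using h that by (auto simp: bij_betw_def inj_on_def)
  have "definite_family e G k (\<lambda>i. f (h i))"
    unfolding definite_family_def
  proof (intro allI impI)
    fix c :: "nat \<Rightarrow> real" assume "\<exists>i<k. c i \<noteq> 0"
    then obtain i0 where i0: "i0 < k" "c i0 \<noteq> 0" by auto
    let ?z = "\<lambda>v. \<Sum>i<k. c i * f (h i) v"
    have coord: "ip ?V (f j) ?z = (\<Sum>i<k. c i * (if h i = j then 1 else 0))" if "j < n" for j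
    proof -
      have "ip ?V (f j) ?z = (\<Sum>i<k. c i * ip ?V (f (h i)) (f j))"
        by (subst ip_commute) (rule ip_sum)
      then show ?thesis using orth hJ that by simp
    qed
    have coord_h: "ip ?V (f (h l)) ?z = c l" if "l < k" for l
    proof -
      have "ip ?V (f (h l)) ?z = (\<Sum>i<k. if i = l then c i else 0)"
        unfolding coord[OF hJ(1)[OF that]] by (intro sum.cong) (auto simp: hinj that)
      then show ?thesis using that by simp
    qed
    have coord_0: "ip ?V (f j) ?z = 0" if "j < n" "j \<notin> J" for j
      unfolding coord[OF that(1)] using that(2) bij_betwE[OF h] by (intro sum.neutral) auto
    have "e * qform G ?z = (\<Sum>j<n. e * (lam j * (ip ?V (f j) ?z)\<^sup>2))"
      by (simp add: expand(3) sum_distrib_left)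
    also have "\<dots> \<ge> e * (lam (h i0) * (ip ?V (f (h i0)) ?z)\<^sup>2)"
    proof (rule member_le_sum)
      fix j assume "j \<in> {..<n} - {h i0}"
      then have j: "j < n" by auto
      show "0 \<le> e * (lam j * (ip ?V (f j) ?z)\<^sup>2)"
      proof (cases "j \<in> J")
        case True
        then have "0 \<le> e * lam j" by (auto simp: J_def)
        then show ?thesis by (simp add: mult.assoc[symmetric])
      qed (simp add: coord_0 j)
    qed (use hJ i0 in auto)
    moreover have "e * (lam (h i0) * (ip ?V (f (h i0)) ?z)\<^sup>2) > 0"
      unfolding coord_h[OF i0(1)] using hJ(2)[OF i0(1)] i0(2) by (simp add: mult.assoc[symmetric])
    ultimately show "e * qform G ?z > 0" by linarith
  qed
  then show ?thesis unfolding k_def by blast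
qed

text \<open>A linear map that preserves the forms carries definite families to definite families. It
  is used with pull-backs along bijections, with extension by zero, and with the shear that clears
  one coordinate along a null vector.\<close>

lemma sgn_index_mono:
  assumes G: "pair_graph G" and H: "pair_graph H" and e: "e \<noteq> 0"
    and lin: "\<And>k c g. T (\<lambda>v. \<Sum>i<k::nat. c i * g i v) = (\<lambda>w. \<Sum>i<k. c i * T (g i) w)"
    and q: "\<And>x. qform H (T x) = qform G x"
  shows "sgn_index e G \<le> sgn_index e H"
proof -
  have q_lin: "qform H (\<lambda>w. \<Sum>i<k. c i * T (g i) w) = qform G (\<lambda>v. \<Sum>i<k::nat. c i * g i v)" for k c g
    using q[of "\<lambda>v. \<Sum>i<k. c i * g i v"] unfolding lin .
  obtain g where "definite_family e G (sgn_index e G) g"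
    using definite_family_exists[OF G e] by auto
  then have "definite_family e H (sgn_index e G) (\<lambda>i. T (g i))"
    unfolding definite_family_def
    unfolding q_lin by blast
  then show ?thesis by (rule definite_family_le[OF H e])
qed

lemma nullity_kernel:
  assumes G: "pair_graph G" and k: "k \<le> nullity G"
  obtains g :: "nat \<Rightarrow> 'a \<Rightarrow> real" where "\<And>i v. i < k \<Longrightarrow> v \<in> pverts G \<Longrightarrow> adj_op G (g i) v = 0"
    "\<And>c. \<exists>i<k. c i \<noteq> 0 \<Longrightarrow> \<exists>v\<in>pverts G. (\<Sum>i<k. c i * g i v) \<noteq> 0"
proof -
  let ?V = "pverts G"
  define n where "n = card ?V"
  obtain f lam where basis: "eigenbasis G n f lam"
    using eigenbasis_exists[OF G] unfolding n_def by blast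
  note orth = eigenbasisD(1)[OF basis] and eig = eigenbasisD(2)[OF basis] and ev = eigenbasisD(4)[OF basis]
  define J where "J = {j. j < n \<and> lam j = 0}"
  have "finite J" "k \<le> card J"
    using k unfolding J_def nullity_def length_filter_mset[OF ev] by auto
  then obtain J' where J': "J' \<subseteq> J" "card J' = k" by (meson obtain_subset_with_card_n)
  then have "finite J'" using \<open>finite J\<close> finite_subset by blast
  with J' obtain h where h: "bij_betw h {..<k} J'"
    by (metis finite_same_card_bij card_lessThan finite_lessThan)
  have hJ: "h i < n" "lam (h i) = 0" if "i < k" for i
    using bij_betwE[OF h] J'(1) that by (auto simp: J_def)
  have hinj: "h i = h j \<longleftrightarrow> i = j" if "i < k" "j < k" for i j
    using h that by (auto simp: bij_betw_def inj_on_def)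
  have "\<exists>v\<in>?V. (\<Sum>i<k. c i * f (h i) v) \<noteq> 0" if c: "\<exists>i<k. c i \<noteq> 0" for c
  proof (rule ccontr)
    assume *: "\<not> ?thesis"
    obtain l where l: "l < k" "c l \<noteq> 0" using c by auto
    have "0 = ip ?V (\<lambda>v. \<Sum>i<k. c i * f (h i) v) (f (h l))"
      using * by (simp add: ip_def)
    also have "\<dots> = (\<Sum>i<k. c i * ip ?V (f (h i)) (f (h l)))" by (rule ip_sum)
    also have "\<dots> = (\<Sum>i<k. if i = l then c i else 0)"
      by (intro sum.cong) (auto simp: orth hJ hinj l)
    finally show False using l by simp
  qed
  then show thesis using that[of "\<lambda>i. f (h i)"] eig hJ by simp
qed

text \<open>A rank bound: if the operator vanishes wherever \<open>card J\<close> functionals do,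
  its rank is at most \<open>card J\<close>. Otherwise a nonzero combination of eigenvectors with
  nonzero eigenvalues would be killed by all functionals but not by the operator.\<close>

lemma card_le_nullity_plus:
  assumes G: "pair_graph G" and J: "finite J"
    and ker: "\<And>x v. (\<And>j. j \<in> J \<Longrightarrow> ip (pverts G) (l j) x = 0) \<Longrightarrow> v \<in> pverts G \<Longrightarrow> adj_op G x v = 0"
  shows "card (pverts G) \<le> nullity G + card J"
proof (rule ccontr)
  assume less: "\<not> card (pverts G) \<le> nullity G + card J"
  let ?V = "pverts G"
  define n where "n = card ?V"
  obtain f lam where basis: "eigenbasis G n f lam"
    using eigenbasis_exists[OF G] unfolding n_def by blast
  note orth = eigenbasisD(1)[OF basis] and eig = eigenbasisD(2)[OF basis] and ev = eigenbasisD(4)[OF basis]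
  define I where "I = {i. i < n \<and> lam i \<noteq> 0}"
  have I: "finite I" by (simp add: I_def)
  have "nullity G = card {i. i < n \<and> lam i = 0}"
    unfolding nullity_def length_filter_mset[OF ev] ..
  moreover have "card {i. i < n \<and> lam i = 0} + card I = card ({i. i < n \<and> lam i = 0} \<union> I)"
    by (subst card_Un_disjoint) (auto simp: I_def)
  moreover have "{i. i < n \<and> lam i = 0} \<union> I = {..<n}" by (auto simp: I_def)
  ultimately have "card J < card I" using less by (simp add: n_def)
  from underdetermined_system[OF J I this, of "\<lambda>j i. ip ?V (f i) (l j)"] obtain c where
    c: "\<exists>i\<in>I. c i \<noteq> 0" "\<forall>j\<in>J. (\<Sum>i\<in>I. ip ?V (f i) (l j) * c i) = 0" by auto
  define z where "z = (\<lambda>v. \<Sum>i\<in>I. c i * f i v)"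
  have "adj_op G z v = 0" if "v \<in> ?V" for v
  proof (rule ker[OF _ that])
    fix j assume "j \<in> J"
    have "ip ?V (l j) z = (\<Sum>i\<in>I. c i * ip ?V (f i) (l j))"
      unfolding z_def by (subst ip_commute) (rule ip_sum)
    then show "ip ?V (l j) z = 0" using c(2) \<open>j \<in> J\<close> by (simp add: mult.commute)
  qed
  moreover have "adj_op G z v = (\<Sum>i\<in>I. (c i * lam i) * f i v)" if "v \<in> ?V" for v
    unfolding z_def mat_op_sum using eig that by (intro sum.cong) (auto simp: I_def)
  ultimately have zero: "(\<Sum>i\<in>I. (c i * lam i) * f i v) = 0" if "v \<in> ?V" for v using that by simp
  obtain m where m: "m \<in> I" "c m \<noteq> 0" using c(1) by auto
  have "0 = ip ?V (\<lambda>v. \<Sum>i\<in>I. (c i * lam i) * f i v) (f m)" using zero by (simp add: ip_def)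
  also have "\<dots> = (\<Sum>i\<in>I. (c i * lam i) * ip ?V (f i) (f m))" by (rule ip_sum)
  also have "\<dots> = (\<Sum>i\<in>I. if i = m then c i * lam i else 0)"
    using m by (intro sum.cong) (auto simp: orth I_def)
  finally show False using m I by (simp add: I_def)
qed

lemma qform_support:
  assumes "finite (pverts G)" "I \<subseteq> pverts G" "\<And>v. v \<in> pverts G \<Longrightarrow> v \<notin> I \<Longrightarrow> x v = 0"
  shows "qform G x = (\<Sum>u\<in>I. \<Sum>v\<in>I. adj G u v * x u * x v)"
proof -
  have "qform G x = (\<Sum>u\<in>pverts G. \<Sum>v\<in>pverts G. adj G u v * x u * x v)"
    by (simp add: qform_def ip_def mat_op_def sum_distrib_left algebra_simps)
  also have "\<dots> = (\<Sum>u\<in>I. \<Sum>v\<in>pverts G. adj G u v * x u * x v)"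
    using assms by (intro sum.mono_neutral_right) auto
  also have "\<dots> = (\<Sum>u\<in>I. \<Sum>v\<in>I. adj G u v * x u * x v)"
    using assms by (intro sum.cong refl sum.mono_neutral_right) auto
  finally show ?thesis .
qed

lemma adj_op_support:
  assumes "finite (pverts G)" "I \<subseteq> pverts G" "\<And>v. v \<in> pverts G \<Longrightarrow> v \<notin> I \<Longrightarrow> x v = 0"
  shows "adj_op G x w = (\<Sum>v\<in>I. adj G w v * x v)"
  unfolding mat_op_def using assms by (intro sum.mono_neutral_right) auto

lemma qform_cong: "(\<And>v. v \<in> pverts G \<Longrightarrow> x v = y v) \<Longrightarrow> qform G x = qform G y"
  by (simp add: qform_def ip_def mat_op_def)

section \<open>Isomorphism invariance\<close>

text \<open>In a \<open>pair_graph\<close> an arc is the pair of its ends, so an isomorphism is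
  determined by its vertex map and can be handled as a bijection of vertices.\<close>

definition graph_iso :: "('a \<Rightarrow> 'b) \<Rightarrow> 'a pair_pre_digraph \<Rightarrow> 'b pair_pre_digraph \<Rightarrow> bool" where
  "graph_iso h G H \<longleftrightarrow> bij_betw h (pverts G) (pverts H) \<and>
    (\<forall>u\<in>pverts G. \<forall>v\<in>pverts G. (u, v) \<in> parcs G \<longleftrightarrow> (h u, h v) \<in> parcs H)"

lemma digraph_iso_iff:
  assumes G: "pair_graph G" and H: "pair_graph H"
  shows "digraph_iso (with_proj G) (with_proj H) \<longleftrightarrow> (\<exists>h. graph_iso h G H)"
proof
  assume "digraph_iso (with_proj G) (with_proj H)"
  then obtain f where f: "pre_digraph.digraph_isomorphism (with_proj G) f"
    "with_proj H = app_iso f (with_proj G)" by (auto simp: digraph_iso_def)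
  let ?h = "iso_verts f"
  have inj: "inj_on ?h (pverts G)" and arc: "\<And>a. a \<in> parcs G \<Longrightarrow>
    ?h (fst a) = iso_tail f (iso_arcs f a) \<and> ?h (snd a) = iso_head f (iso_arcs f a)"
    using f(1) by (auto simp: pre_digraph.digraph_isomorphism_def)
  have eqs: "pverts H = ?h ` pverts G" "parcs H = iso_arcs f ` parcs G"
    "fst = iso_tail f" "snd = iso_head f"
    using f(2) by (auto simp: with_proj_def app_iso_def)
  have arcs: "iso_arcs f (u, v) = (?h u, ?h v)" if "(u, v) \<in> parcs G" for u v
    using arc[OF that] unfolding eqs(3,4)[symmetric] by (metis fst_conv snd_conv prod.collapse)
  have "(u, v) \<in> parcs G \<longleftrightarrow> (?h u, ?h v) \<in> parcs H" if uv: "u \<in> pverts G" "v \<in> pverts G" for u v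
  proof
    assume "(u, v) \<in> parcs G"
    then show "(?h u, ?h v) \<in> parcs H" using arcs unfolding eqs by (metis image_eqI)
  next
    assume "(?h u, ?h v) \<in> parcs H"
    then obtain a b where ab: "(a, b) \<in> parcs G" "(?h u, ?h v) = iso_arcs f (a, b)"
      unfolding eqs by auto
    with arcs have "?h u = ?h a" "?h v = ?h b" by auto
    then show "(u, v) \<in> parcs G"
      using ab(1) pair_graph_verts[OF G ab(1)] uv inj by (metis inj_onD)
  qed
  then show "\<exists>h. graph_iso h G H"
    using inj eqs(1) by (auto simp: graph_iso_def bij_betw_def)
next
  assume "\<exists>h. graph_iso h G H"
  then obtain h where h: "graph_iso h G H" by auto
  have bij: "inj_on h (pverts G)" "pverts H = h ` pverts G"
    using h by (auto simp: graph_iso_def bij_betw_def)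
  have arcs: "parcs H = map_prod h h ` parcs G"
  proof (intro equalityI subsetI)
    fix e assume e: "e \<in> parcs H"
    obtain a b where ab: "e = (a, b)" by force
    then have "a \<in> pverts H" "b \<in> pverts H" using e pair_graph_verts[OF H] by auto
    then obtain u v where uv: "u \<in> pverts G" "v \<in> pverts G" "a = h u" "b = h v"
      unfolding bij(2) by blast
    then have "(u, v) \<in> parcs G" using h e ab unfolding graph_iso_def by blast
    then show "e \<in> map_prod h h ` parcs G"
      using ab uv(3,4) by (intro image_eqI[of _ _ "(u, v)"]) simp_all
  next
    fix e assume "e \<in> map_prod h h ` parcs G"
    then obtain u v where "(u, v) \<in> parcs G" "e = (h u, h v)" by force
    then show "e \<in> parcs H"
      using h pair_graph_verts[OF G] unfolding graph_iso_def by blast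
  qed
  define f where "f = \<lparr>iso_verts = h, iso_arcs = map_prod h h, iso_head = snd, iso_tail = fst\<rparr>"
  interpret G: pair_graph G by fact
  have "inj_on (map_prod h h) (parcs G)"
    using bij(1) pair_graph_verts[OF G] by (auto simp: inj_on_def)
  then have "pre_digraph.digraph_isomorphism (with_proj G) f"
    using bij(1) G.wf_digraph by (auto simp: pre_digraph.digraph_isomorphism_def f_def)
  moreover have "with_proj H = app_iso f (with_proj G)"
    by (auto simp: with_proj_def app_iso_def f_def bij arcs)
  ultimately show "digraph_iso (with_proj G) (with_proj H)" by (auto simp: digraph_iso_def)
qed

lemma qform_iso:
  assumes "graph_iso h G H"
  shows "qform H x = qform G (\<lambda>v. x (h v))"
proof -
  have bij: "bij_betw h (pverts G) (pverts H)" using assms by (simp add: graph_iso_def)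
  have sum_h: "(\<Sum>v\<in>pverts H. k v) = (\<Sum>v\<in>pverts G. k (h v))" for k :: "_ \<Rightarrow> real"
    using sum.reindex_bij_betw[OF bij] by metis
  have "qform H x = (\<Sum>u\<in>pverts G. x (h u) * (\<Sum>v\<in>pverts G. adj H (h u) (h v) * x (h v)))"
    by (simp add: qform_def ip_def mat_op_def sum_h)
  also have "\<dots> = (\<Sum>u\<in>pverts G. x (h u) * (\<Sum>v\<in>pverts G. adj G u v * x (h v)))"
    using assms by (intro sum.cong refl) (auto simp: graph_iso_def adj_def)
  finally show ?thesis by (simp add: qform_def ip_def mat_op_def)
qed

lemma graph_iso_index:
  assumes G: "pair_graph G" and H: "pair_graph H" and h: "graph_iso h G H"
  shows "e \<noteq> 0 \<Longrightarrow> sgn_index e G = sgn_index e H" "nullity G = nullity H"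
    "card (pverts G) = card (pverts H)"
proof -
  have bij: "bij_betw h (pverts G) (pverts H)" using h by (simp add: graph_iso_def)
  show c: "card (pverts G) = card (pverts H)" using bij by (rule bij_betw_same_card)
  have s: "sgn_index e G = sgn_index e H" if e: "e \<noteq> 0" for e
  proof (rule antisym)
    show "sgn_index e H \<le> sgn_index e G"
      by (rule sgn_index_mono[OF H G e, where T = "\<lambda>x v. x (h v)"]) (auto simp: qform_iso[OF h])
    let ?i = "inv_into (pverts G) h"
    have "qform H (\<lambda>w. x (?i w)) = qform G x" for x
      unfolding qform_iso[OF h]
      by (rule qform_cong) (use bij in \<open>auto simp: bij_betw_def\<close>)
    then show "sgn_index e G \<le> sgn_index e H"
      by (intro sgn_index_mono[OF G H e, where T = "\<lambda>x w. x (?i w)"]) auto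
  qed
  then show "e \<noteq> 0 \<Longrightarrow> sgn_index e G = sgn_index e H" .
  show "nullity G = nullity H"
    using index_sum[OF G] index_sum[OF H] s[of 1] s[of "-1"] c by simp
qed

lemma two_pos_iff:
  assumes "pair_graph G"
  shows "G \<in> two_pos s m \<longleftrightarrow> card (pverts G) = m \<and> sgn_index 1 G = 2 \<and> nullity G = s"
  using assms by (auto simp: two_pos_def positive_index_eq)

section \<open>Deleting a vertex in the support of a null vector\<close>

text \<open>Vertex deletion that stays within \<open>pair_pre_digraph\<close>, so that the spectral
  notions apply to the result.\<close>

definition del_v :: "'a \<Rightarrow> 'a pair_pre_digraph \<Rightarrow> 'a pair_pre_digraph" where
  "del_v u G = \<lparr>pverts = pverts G - {u}, parcs = {e \<in> parcs G. fst e \<noteq> u \<and> snd e \<noteq> u}\<rparr>"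

lemma with_proj_del_v: "with_proj (del_v u G) = pre_digraph.del_vert (with_proj G) u"
  by (auto simp: del_v_def pre_digraph.del_vert_def with_proj_def)

lemma with_proj_inj: "with_proj G = with_proj H \<Longrightarrow> G = H"
  by (auto simp: with_proj_def intro: pair_pre_digraph.equality)

lemma pair_graph_del_v:
  assumes G: "pair_graph G" shows "pair_graph (del_v u G)"
proof (rule pair_graphI)
  show "finite (pverts (del_v u G))" using pair_graph_finite[OF G] by (simp add: del_v_def)
  show "parcs (del_v u G) \<subseteq> pverts (del_v u G) \<times> pverts (del_v u G)"
    by (auto simp: del_v_def dest: pair_graph_verts[OF G])
  show "(b, a) \<in> parcs (del_v u G)" if "(a, b) \<in> parcs (del_v u G)" for a b
    using that pair_graph_sym[OF G, of a b] by (simp add: del_v_def)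
  show "(a, a) \<notin> parcs (del_v u G)" for a
    using pair_graph_irrefl[OF G] by (simp add: del_v_def)
qed

lemma qform_del_v:
  assumes G: "pair_graph G" and x: "x u = 0"
  shows "qform (del_v u G) x = qform G x"
proof -
  have "qform G x = (\<Sum>a\<in>pverts G - {u}. \<Sum>b\<in>pverts G - {u}. adj G a b * x a * x b)"
    by (rule qform_support) (use pair_graph_finite[OF G] x in auto)
  moreover have "qform (del_v u G) x =
      (\<Sum>a\<in>pverts G - {u}. \<Sum>b\<in>pverts G - {u}. adj (del_v u G) a b * x a * x b)"
    by (rule qform_support) (use pair_graph_finite[OF G] in \<open>auto simp: del_v_def\<close>)
  moreover have "adj (del_v u G) a b = adj G a b" if "a \<noteq> u" "b \<noteq> u" for a b
    using that by (auto simp: adj_def del_v_def)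
  ultimately show ?thesis by simp
qed

lemma qform_add_null:
  assumes G: "pair_graph G" and z: "\<And>v. v \<in> pverts G \<Longrightarrow> adj_op G z v = 0"
  shows "qform G (\<lambda>v. x v + c * z v) = qform G x"
proof -
  let ?V = "pverts G"
  have zz: "ip ?V y (adj_op G z) = 0" for y using z by (simp add: ip_def)
  have "adj_op G (\<lambda>v. x v + c * z v) = (\<lambda>v. adj_op G x v + c * adj_op G z v)"
    by (simp add: mat_op_add mat_op_scale fun_eq_iff)
  moreover have "ip ?V z (adj_op G x) = 0"
    using mat_op_sym[of ?V "adj G" z x] adj_sym[OF G] zz by metis
  moreover have "ip ?V (\<lambda>v. x v + c * z v) y = ip ?V x y + c * ip ?V z y" for y
    by (simp add: ip_add ip_scale)
  moreover have "ip ?V y (\<lambda>v. adj_op G x v + c * adj_op G z v)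
      = ip ?V y (adj_op G x) + c * ip ?V y (adj_op G z)" for y
    by (simp add: ip_def algebra_simps sum.distrib sum_distrib_left)
  ultimately show ?thesis unfolding qform_def by (simp add: zz)
qed

text \<open>Subtracting a suitable multiple of \<open>z\<close> clears the coordinate at
  \<open>u\<close> without changing the form. So both graphs have the same positive and negative
  index, and the lost vertex is charged to the nullity.\<close>

lemma delete_null_support:
  assumes G: "pair_graph G" and u: "u \<in> pverts G" "z u \<noteq> 0"
    and z: "\<And>v. v \<in> pverts G \<Longrightarrow> adj_op G z v = 0"
  shows "sgn_index 1 (del_v u G) = sgn_index 1 G" "nullity G = nullity (del_v u G) + 1"
proof -
  note D = pair_graph_del_v[OF G, of u]
  have s: "sgn_index e (del_v u G) = sgn_index e G" if e: "e \<noteq> 0" for e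
  proof (rule antisym)
    have "qform G (\<lambda>v. if v = u then 0 else x v) = qform (del_v u G) x" for x
    proof -
      have "qform G (\<lambda>v. if v = u then 0 else x v) = qform (del_v u G) (\<lambda>v. if v = u then 0 else x v)"
        by (rule qform_del_v[OF G, symmetric]) simp
      also have "\<dots> = qform (del_v u G) x" by (rule qform_cong) (auto simp: del_v_def)
      finally show ?thesis .
    qed
    then show "sgn_index e (del_v u G) \<le> sgn_index e G"
      by (intro sgn_index_mono[OF D G e, where T = "\<lambda>x v. if v = u then 0 else x v"]) auto
    have "qform (del_v u G) (\<lambda>v. x v + (- x u / z u) * z v) = qform G x" for x
    proof -
      have "qform (del_v u G) (\<lambda>v. x v + (- x u / z u) * z v) = qform G (\<lambda>v. x v + (- x u / z u) * z v)"
        by (rule qform_del_v[OF G]) (use u(2) in simp)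
      also have "\<dots> = qform G x" by (rule qform_add_null[OF G z])
      finally show ?thesis .
    qed
    then show "sgn_index e G \<le> sgn_index e (del_v u G)"
      by (intro sgn_index_mono[OF G D e, where T = "\<lambda>x v. x v + (- x u / z u) * z v"])
        (auto simp: fun_eq_iff sum_distrib_left sum_distrib_right sum_divide_distrib algebra_simps
          sum_subtractf)
  qed
  then show "sgn_index 1 (del_v u G) = sgn_index 1 G" by simp
  have "card (pverts G) = card (pverts (del_v u G)) + 1"
    using card_Suc_Diff1[OF pair_graph_finite[OF G] u(1)] by (simp add: del_v_def)
  then show "nullity G = nullity (del_v u G) + 1"
    using index_sum[OF G] index_sum[OF D] s[of 1] s[of "-1"] by simp
qed

lemma two_pos_del_v:
  assumes G: "pair_graph G" and u: "u \<in> pverts G" "z u \<noteq> 0"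
    and z: "\<And>v. v \<in> pverts G \<Longrightarrow> adj_op G z v = 0" and s: "s \<ge> 1"
  shows "G \<in> two_pos s n \<longleftrightarrow> n \<ge> 1 \<and> del_v u G \<in> two_pos (s - 1) (n - 1)"
proof -
  have "card (pverts G) = card (pverts (del_v u G)) + 1"
    using card_Suc_Diff1[OF pair_graph_finite[OF G] u(1)] by (simp add: del_v_def)
  moreover have "sgn_index 1 (del_v u G) = sgn_index 1 G" "nullity G = nullity (del_v u G) + 1"
    by (rule delete_null_support[OF G u z], assumption)+
  ultimately show ?thesis
    unfolding two_pos_iff[OF G] two_pos_iff[OF pair_graph_del_v[OF G]] using s by linarith
qed

lemma adj_nbhd: "pair_graph G \<Longrightarrow> adj G w v = (if w \<in> nbhd G v then 1 else 0)"
  using pair_graph_sym[of G w v] unfolding adj_def nbhd_def mem_Collect_eq by presburger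

lemma congruent_I_null:
  assumes G: "pair_graph G" and c: "congruent_I G u"
  obtains z where "z u \<noteq> 0" "\<And>v. v \<in> pverts G \<Longrightarrow> adj_op G z v = 0"
proof -
  obtain v where v: "u \<in> pverts G" "v \<in> pverts G" "v \<noteq> u" "nbhd G u = nbhd G v"
    using c by (auto simp: congruent_I_def)
  define z where "z = (\<lambda>w. if w = u then 1 else if w = v then - 1 else 0 :: real)"
  have "adj_op G z w = (\<Sum>a\<in>{u, v}. adj G w a * z a)" for w
    by (rule adj_op_support) (use v pair_graph_finite[OF G] in \<open>auto simp: z_def\<close>)
  moreover have "adj G w u = adj G w v" for w
    using v(4) by (simp add: adj_nbhd[OF G])
  ultimately show thesis using v by (intro that[of z]) (auto simp: z_def)
qed

text \<open>The column of \<open>u\<close> is the sum of the columns of \<open>v\<close> and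
  \<open>w\<close>.\<close>

lemma congruent_II_null:
  assumes G: "pair_graph G" and c: "congruent_II G u"
  obtains z where "z u \<noteq> 0" "\<And>v. v \<in> pverts G \<Longrightarrow> adj_op G z v = 0"
proof -
  obtain v w where v: "u \<in> pverts G" "v \<in> pverts G" "w \<in> pverts G" "v \<noteq> u" "w \<noteq> u" "v \<noteq> w"
    "nbhd G u = nbhd G v \<union> nbhd G w" "nbhd G v \<inter> nbhd G w = {}"
    using c by (auto simp: congruent_II_def)
  define z where "z = (\<lambda>a. if a = u then 1 else if a = v \<or> a = w then - 1 else 0 :: real)"
  have "adj_op G z b = (\<Sum>a\<in>{u, v, w}. adj G b a * z a)" for b
    by (rule adj_op_support) (use v pair_graph_finite[OF G] in \<open>auto simp: z_def\<close>)
  moreover have "adj G b u = adj G b v + adj G b w" for b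
    using v(7,8) by (auto simp: adj_nbhd[OF G])
  ultimately show thesis using v by (intro that[of z]) (auto simp: z_def)
qed

text \<open>The null vector is 1 on \<open>u\<close>, \<open>y\<close> and -1 on \<open>v\<close>,
  \<open>x\<close>. Outside the cycle the contributions of \<open>u\<close>, \<open>v\<close> and of
  \<open>x\<close>, \<open>y\<close> cancel by congruence; on the cycle each vertex has one
  neighbour of either sign. The other pair of independent edges is reached by rotating the
  cycle.\<close>

lemma congruent_III_null:
  assumes G: "pair_graph G" and c: "congruent_III G t"
  obtains z where "t \<in> pverts G" "z t \<noteq> 0" "\<And>v. v \<in> pverts G \<Longrightarrow> adj_op G z v = 0"
proof -
  have main: "\<exists>z. z t \<noteq> 0 \<and> (\<forall>b\<in>pverts G. adj_op G z b = 0)"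
    if C: "induced_C4 G u v x y" "congruent_pair G u v x y" "t \<in> {u, v, x, y}" for u v x y
  proof -
    have d: "distinct [u, v, x, y]" "{u, v, x, y} \<subseteq> pverts G" using C by (auto simp: induced_C4_def)
    define z where "z = (\<lambda>a. if a = u \<or> a = y then 1 else if a = v \<or> a = x then - 1 else 0 :: real)"
    have "adj_op G z b = (\<Sum>a\<in>{u, v, x, y}. adj G b a * z a)" for b
      by (rule adj_op_support) (use d pair_graph_finite[OF G] in \<open>auto simp: z_def\<close>)
    then have op: "adj_op G z b = adj G b u + adj G b y - adj G b v - adj G b x" for b
      using d by (auto simp: z_def)
    have "(u, v) \<in> parcs G" "(v, x) \<in> parcs G" "(x, y) \<in> parcs G" "(y, u) \<in> parcs G"
      "(v, u) \<in> parcs G" "(x, v) \<in> parcs G" "(y, x) \<in> parcs G" "(u, y) \<in> parcs G"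
      "(u, x) \<notin> parcs G" "(v, y) \<notin> parcs G" "(x, u) \<notin> parcs G" "(y, v) \<notin> parcs G"
      using C(1) pair_graph_sym[OF G] unfolding induced_C4_def by blast+
    note edges = this pair_graph_irrefl[OF G]
    have "adj_op G z b = 0" if "b \<notin> {u, v, x, y}" for b
      using C(2) that unfolding congruent_pair_def op adj_nbhd[OF G] by (auto simp: set_eq_iff)
    moreover have "adj_op G z b = 0" if "b \<in> {u, v, x, y}" for b
      using that edges unfolding op adj_def by auto
    ultimately have "\<forall>b\<in>pverts G. adj_op G z b = 0" by blast
    moreover have "z t \<noteq> 0" using C(3) by (auto simp: z_def)
    ultimately show ?thesis by blast
  qed
  obtain u v x y where C: "congruent_C4 G u v x y" "t \<in> {u, v, x, y}"
    using c by (auto simp: congruent_III_def)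
  have "t \<in> pverts G" using C by (auto simp: congruent_C4_def induced_C4_def)
  moreover have "\<exists>z. z t \<noteq> 0 \<and> (\<forall>b\<in>pverts G. adj_op G z b = 0)"
  proof (cases "congruent_pair G u v x y")
    case True
    then show ?thesis using main C by (auto simp: congruent_C4_def)
  next
    case False
    then have "congruent_pair G v x y u" using C by (auto simp: congruent_C4_def)
    moreover have "induced_C4 G v x y u"
      using C pair_graph_sym[OF G] by (auto simp: congruent_C4_def induced_C4_def)
    ultimately show ?thesis using main[of v x y u] C(2) by blast
  qed
  ultimately show thesis using that by blast
qed

definition congruent :: "'a pair_pre_digraph \<Rightarrow> 'a \<Rightarrow> bool" where
  "congruent G u \<longleftrightarrow> congruent_I G u \<or> congruent_II G u \<or> congruent_III G u"

lemma congruent_null: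
  assumes G: "pair_graph G" and c: "congruent G u"
  obtains z where "u \<in> pverts G" "z u \<noteq> 0" "\<And>v. v \<in> pverts G \<Longrightarrow> adj_op G z v = 0"
proof -
  consider "congruent_I G u" | "congruent_II G u" | "congruent_III G u"
    using c by (auto simp: congruent_def)
  then show thesis
  proof cases
    case 1
    moreover from 1 have "u \<in> pverts G" by (simp add: congruent_I_def)
    ultimately show thesis using congruent_I_null[OF G] that by metis
  next
    case 2
    moreover from 2 have "u \<in> pverts G" by (simp add: congruent_II_def)
    ultimately show thesis using congruent_II_null[OF G] that by metis
  next
    case 3
    then show thesis using congruent_III_null[OF G] that by metis
  qed
qed

text \<open>A congruent vertex supports a null vector, so its deletion is reversible between the
  classes for \<open>s\<close> and \<open>s - 1\<close>. The three extension classes together thus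
  consist of the members having some congruent vertex, and only graphs without one remain to be
  studied.\<close>

lemma one_vertex_ext_union:
  assumes G: "pair_graph G" and conn: "Digraph_Component.connected (with_proj G)"
    and n: "card (pverts G) = n" "n \<ge> 1" and s: "s \<ge> 1"
  shows "G \<in> two_pos_I s n \<union> two_pos_II s n \<union> two_pos_III s n \<longleftrightarrow>
    G \<in> two_pos s n \<and> (\<exists>u. congruent G u)"
proof -
  have del: "G \<in> two_pos s n \<longleftrightarrow> del_v u G \<in> two_pos (s - 1) (n - 1)" if c: "congruent G u" for u
  proof -
    obtain z where "u \<in> pverts G" "z u \<noteq> 0" "\<And>v. v \<in> pverts G \<Longrightarrow> adj_op G z v = 0"
      using congruent_null[OF G c] by blast
    from two_pos_del_v[OF G this s, of n] n(2) show ?thesis by blast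
  qed
  have verts: "u \<in> pverts G" if "congruent G u" for u
    by (rule congruent_null[OF G that])
  have "G \<in> two_pos_I s n \<union> two_pos_II s n \<union> two_pos_III s n \<longleftrightarrow>
    (\<exists>H\<in>two_pos (s - 1) (n - 1). \<exists>u\<in>pverts G. with_proj H = with_proj (del_v u G) \<and> congruent G u)"
    using G conn n(1) unfolding two_pos_I_def two_pos_II_def two_pos_III_def one_vertex_ext_def
      with_proj_del_v[symmetric] congruent_def by blast
  also have "\<dots> \<longleftrightarrow> (\<exists>u. congruent G u \<and> del_v u G \<in> two_pos (s - 1) (n - 1))"
    using verts with_proj_inj by metis
  also have "\<dots> \<longleftrightarrow> G \<in> two_pos s n \<and> (\<exists>u. congruent G u)" using del by blast
  finally show ?thesis .
qed

section \<open>Graphs with two positive eigenvalues and no congruent vertex\<close>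

definition indep3 :: "'a pair_pre_digraph \<Rightarrow> 'a \<Rightarrow> 'a \<Rightarrow> 'a \<Rightarrow> bool" where
  "indep3 G a b c \<longleftrightarrow> distinct [a, b, c] \<and> {a, b, c} \<subseteq> pverts G \<and>
    (a, b) \<notin> parcs G \<and> (a, c) \<notin> parcs G \<and> (b, c) \<notin> parcs G"

text \<open>Independent vertices span a totally isotropic space; with two positive eigenvalues its dimension
  modulo the kernel is at most 2.\<close>

lemma indep3_dependent:
  assumes G: "pair_graph G" and p: "sgn_index 1 G = 2" and I: "indep3 G a b c"
  obtains \<alpha> \<beta> \<gamma> where "\<alpha> \<noteq> 0 \<or> \<beta> \<noteq> 0 \<or> \<gamma> \<noteq> 0"
    "\<And>w. w \<in> pverts G \<Longrightarrow> \<alpha> * adj G w a + \<beta> * adj G w b + \<gamma> * adj G w c = 0"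
proof -
  have d: "a \<noteq> b" "a \<noteq> c" "b \<noteq> c" "{a, b, c} \<subseteq> pverts G"
    "(a, b) \<notin> parcs G" "(a, c) \<notin> parcs G" "(b, c) \<notin> parcs G"
    "(b, a) \<notin> parcs G" "(c, a) \<notin> parcs G" "(c, b) \<notin> parcs G"
    using I pair_graph_sym[OF G] unfolding indep3_def by auto
  define e where "e = (\<lambda>i w::'a. if w = i then 1 else 0 :: real)"
  have "card {a, b, c} > sgn_index 1 G" using d p by simp
  from semidefinite_combination[OF G _ this, where g = e] obtain k where
    k: "\<exists>i\<in>{a, b, c}. k i \<noteq> 0"
      "qform G (\<lambda>v. \<Sum>i\<in>{a, b, c}. k i * e i v) = 0 \<longrightarrow>
      (\<forall>v\<in>pverts G. adj_op G (\<lambda>v. \<Sum>i\<in>{a, b, c}. k i * e i v) v = 0)"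
    by auto
  define z where "z = (\<lambda>v. \<Sum>i\<in>{a, b, c}. k i * e i v)"
  have z: "z a = k a" "z b = k b" "z c = k c" "\<And>v. v \<notin> {a, b, c} \<Longrightarrow> z v = 0"
    using d by (auto simp: z_def e_def)
  have "qform G z = (\<Sum>u\<in>{a, b, c}. \<Sum>v\<in>{a, b, c}. adj G u v * z u * z v)"
    by (rule qform_support) (use d z pair_graph_finite[OF G] in auto)
  also have "\<dots> = 0" using d by (simp add: adj_def pair_graph_irrefl[OF G])
  finally have op: "adj_op G z w = 0" if "w \<in> pverts G" for w
    using k(2) that unfolding z_def by blast
  have "adj_op G z w = (\<Sum>v\<in>{a, b, c}. adj G w v * z v)" for w
    by (rule adj_op_support) (use d z pair_graph_finite[OF G] in auto)
  then have "adj_op G z w = k a * adj G w a + k b * adj G w b + k c * adj G w c" for w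
    using d by (simp add: z algebra_simps)
  with op k(1) show thesis by (intro that[of "k a" "k b" "k c"]) auto
qed

text \<open>No coefficient can vanish, since a relation between two of the sets would force equality
  or emptiness. Then no point lies in exactly one set, and none lies in all three. If all pairs of
  sets met, all pair sums of coefficients would vanish; so two sets are disjoint and the third is
  their union.\<close>

lemma indicator_relation:
  fixes \<alpha> \<beta> \<gamma> :: real
  assumes nz: "\<alpha> \<noteq> 0 \<or> \<beta> \<noteq> 0 \<or> \<gamma> \<noteq> 0"
    and rel: "\<And>w. \<alpha> * of_bool (w \<in> A) + \<beta> * of_bool (w \<in> B) + \<gamma> * of_bool (w \<in> C) = 0"
    and ne: "A \<noteq> {}" "B \<noteq> {}" "C \<noteq> {}" and df: "A \<noteq> B" "A \<noteq> C" "B \<noteq> C"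
  shows "A = B \<union> C \<and> B \<inter> C = {} \<or> B = A \<union> C \<and> A \<inter> C = {} \<or> C = A \<union> B \<and> A \<inter> B = {}"
proof -
  have pair: "X = Y" if "s \<noteq> 0" "t \<noteq> 0" "\<And>w. s * of_bool (w \<in> X) + t * of_bool (w \<in> Y) = (0::real)"
    for X Y :: "'a set" and s t
  proof (rule Set.set_eqI)
    fix w show "w \<in> X \<longleftrightarrow> w \<in> Y" using that(3)[of w] that(1,2) by (cases "w \<in> X"; cases "w \<in> Y") auto
  qed
  have single: "s = 0" if sX: "\<And>w. s * of_bool (w \<in> X) = (0::real)" and neX: "X \<noteq> {}" for X :: "'a set" and s
  proof -
    obtain w where "w \<in> X" using neX by blast
    then show ?thesis using sX[of w] by simp
  qed
  have two: "s = 0 \<and> t = 0" if "X \<noteq> Y" "X \<noteq> {}" "Y \<noteq> {}"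
    "\<And>w. s * of_bool (w \<in> X) + t * of_bool (w \<in> Y) = (0::real)" for X Y :: "'a set" and s t
  proof (cases "s = 0")
    case True
    then have "t * of_bool (w \<in> Y) = 0" for w using that(4)[of w] by simp
    from single[OF this that(3)] True show ?thesis by simp
  next
    case False
    have "t = 0" using pair[OF False _ that(4)] that(1) by blast
    then have "s * of_bool (w \<in> X) = 0" for w using that(4)[of w] by simp
    from single[OF this that(2)] False show ?thesis by simp
  qed
  have a: "\<alpha> \<noteq> 0"
  proof
    assume 0: "\<alpha> = 0"
    then have "\<beta> * of_bool (w \<in> B) + \<gamma> * of_bool (w \<in> C) = 0" for w using rel[of w] by simp
    from two[OF df(3) ne(2,3) this] nz 0 show False by simp
  qed
  have b: "\<beta> \<noteq> 0"
  proof
    assume "\<beta> = 0"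
    then have "\<alpha> * of_bool (w \<in> A) + \<gamma> * of_bool (w \<in> C) = 0" for w using rel[of w] by simp
    from two[OF df(2) ne(1,3) this] a show False by simp
  qed
  have c: "\<gamma> \<noteq> 0"
  proof
    assume "\<gamma> = 0"
    then have "\<alpha> * of_bool (w \<in> A) + \<beta> * of_bool (w \<in> B) = 0" for w using rel[of w] by simp
    from two[OF df(1) ne(1,2) this] a show False by simp
  qed
  have one: "w \<in> A \<Longrightarrow> w \<in> B \<or> w \<in> C" "w \<in> B \<Longrightarrow> w \<in> A \<or> w \<in> C" "w \<in> C \<Longrightarrow> w \<in> A \<or> w \<in> B" for w
    using rel[of w] a b c by (cases "w \<in> A"; cases "w \<in> B"; cases "w \<in> C"; simp)+
  have AB: "\<alpha> + \<beta> = 0" if "w \<in> A" "w \<in> B" "w \<notin> C" for w using rel[of w] that by simp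
  have AC: "\<alpha> + \<gamma> = 0" if "w \<in> A" "w \<in> C" "w \<notin> B" for w using rel[of w] that by simp
  have BC: "\<beta> + \<gamma> = 0" if "w \<in> B" "w \<in> C" "w \<notin> A" for w using rel[of w] that by simp
  \<comment> \<open>Such a point makes the three coefficients sum to 0. As none is 0, no pair sum
    vanishes, so no point lies in exactly two sets and the sets coincide.\<close>
  have three: False if "w \<in> A" "w \<in> B" "w \<in> C" for w
  proof -
    have "\<alpha> + \<beta> + \<gamma> = 0" using rel[of w] that by simp
    with AB AC BC a b c have "\<And>v. \<not> (v \<in> A \<and> v \<in> B \<and> v \<notin> C)" "\<And>v. \<not> (v \<in> A \<and> v \<in> C \<and> v \<notin> B)"
      "\<And>v. \<not> (v \<in> B \<and> v \<in> C \<and> v \<notin> A)" by fastforce+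
    then have "A = B" using one by blast
    then show False using df by simp
  qed
  have "A \<inter> B = {} \<or> A \<inter> C = {} \<or> B \<inter> C = {}"
  proof (rule ccontr)
    assume "\<not> ?thesis"
    then have "\<alpha> + \<beta> = 0" "\<alpha> + \<gamma> = 0" "\<beta> + \<gamma> = 0" using AB AC BC three by blast+
    then show False using a by simp
  qed
  then show ?thesis using one by blast
qed

text \<open>Equal neighbourhoods give type I, and otherwise the relation between three indicator
  functions gives type II. Isolated vertices are excluded because a zero column is dependent on its
  own.\<close>

lemma indep3_congruent:
  assumes G: "pair_graph G" and p: "sgn_index 1 G = 2" and I: "indep3 G a b c"
    and iso: "\<And>v. v \<in> pverts G \<Longrightarrow> nbhd G v \<noteq> {}"
  shows "\<exists>u. congruent G u"
proof (cases "nbhd G a = nbhd G b \<or> nbhd G a = nbhd G c \<or> nbhd G b = nbhd G c")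
  case True
  then have "congruent_I G a \<or> congruent_I G b"
    using I unfolding congruent_I_def indep3_def by auto
  then show ?thesis by (auto simp: congruent_def)
next
  case False
  obtain \<alpha> \<beta> \<gamma> where nz: "\<alpha> \<noteq> 0 \<or> \<beta> \<noteq> 0 \<or> \<gamma> \<noteq> 0"
    and r: "\<And>w. w \<in> pverts G \<Longrightarrow> \<alpha> * adj G w a + \<beta> * adj G w b + \<gamma> * adj G w c = 0"
    using indep3_dependent[OF G p I] by blast
  have "\<alpha> * of_bool (w \<in> nbhd G a) + \<beta> * of_bool (w \<in> nbhd G b) + \<gamma> * of_bool (w \<in> nbhd G c) = 0" for w
  proof (cases "w \<in> pverts G")
    case True
    then show ?thesis using r[of w] by (auto simp: adj_nbhd[OF G] of_bool_def)
  next
    case False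
    then have "w \<notin> nbhd G v" for v using pair_graph_verts(2)[OF G] by (auto simp: nbhd_def)
    then show ?thesis by simp
  qed
  from indicator_relation[OF nz this] have
    "nbhd G a = nbhd G b \<union> nbhd G c \<and> nbhd G b \<inter> nbhd G c = {} \<or>
     nbhd G b = nbhd G a \<union> nbhd G c \<and> nbhd G a \<inter> nbhd G c = {} \<or>
     nbhd G c = nbhd G a \<union> nbhd G b \<and> nbhd G a \<inter> nbhd G b = {}"
    using iso I False unfolding indep3_def by blast
  moreover have "distinct [a, b, c]" "{a, b, c} \<subseteq> pverts G"
    "(a, b) \<notin> parcs G" "(a, c) \<notin> parcs G" "(b, c) \<notin> parcs G"
    using I unfolding indep3_def by auto
  moreover have "congruent_II G r" if "r \<in> pverts G" "s \<in> pverts G" "t \<in> pverts G" "s \<noteq> r" "t \<noteq> r" "s \<noteq> t"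
    "(s, t) \<notin> parcs G" "nbhd G r = nbhd G s \<union> nbhd G t \<and> nbhd G s \<inter> nbhd G t = {}" for r s t
    unfolding congruent_II_def using that by blast
  ultimately have "congruent_II G a \<or> congruent_II G b \<or> congruent_II G c"
    by (metis distinct_length_2_or_more insert_subset)
  then show ?thesis by (auto simp: congruent_def)
qed

text \<open>On the span of \<open>e_u - e_x\<close>, \<open>e_v - e_y\<close> and the all-ones
  vector of the cycle the form is \<open>8 * (k 2)^2\<close>. Three vectors exceed the index, so a
  combination of the first two is null. Differences of columns have entries -1, 0, 1; hence either
  two opposite vertices are twins, which is type I, or the coefficients agree up to sign, and the
  sign selects the pair of independent edges for type III.\<close>

lemma induced_C4_congruent:
  assumes G: "pair_graph G" and p: "sgn_index 1 G = 2" and C: "induced_C4 G u v x y"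
    and no3: "\<And>a b c. \<not> indep3 G a b c"
  shows "\<exists>u. congruent G u"
proof -
  have d: "distinct [u, v, x, y]" "{u, v, x, y} \<subseteq> pverts G" using C by (auto simp: induced_C4_def)
  have edges: "(u, v) \<in> parcs G" "(v, x) \<in> parcs G" "(x, y) \<in> parcs G" "(y, u) \<in> parcs G"
    "(v, u) \<in> parcs G" "(x, v) \<in> parcs G" "(y, x) \<in> parcs G" "(u, y) \<in> parcs G"
    "(u, x) \<notin> parcs G" "(v, y) \<notin> parcs G" "(x, u) \<notin> parcs G" "(y, v) \<notin> parcs G"
    using C pair_graph_sym[OF G] unfolding induced_C4_def by blast+
  have irr: "(a, a) \<notin> parcs G" for a by (rule pair_graph_irrefl[OF G])
  define g where "g = (\<lambda>i::nat. \<lambda>w.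
    if i = 0 then (if w = u then 1 else if w = x then - 1 else 0 :: real)
    else if i = 1 then (if w = v then 1 else if w = y then - 1 else 0)
    else (if w \<in> {u, v, x, y} then 1 else 0))"
  have "sgn_index 1 G < card {0, 1, 2::nat}" using p by simp
  from semidefinite_combination[OF G _ this, where g = g] obtain k where
    k: "\<exists>i\<in>{0, 1, 2}. k i \<noteq> 0" "1 * qform G (\<lambda>v. \<Sum>i\<in>{0, 1, 2}. k i * g i v) \<le> 0"
      "qform G (\<lambda>v. \<Sum>i\<in>{0, 1, 2}. k i * g i v) = 0 \<longrightarrow>
      (\<forall>v\<in>pverts G. adj_op G (\<lambda>v. \<Sum>i\<in>{0, 1, 2}. k i * g i v) v = 0)"
    by auto
  define z where "z = (\<lambda>v. \<Sum>i\<in>{0, 1, 2}. k i * g i v)"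
  have z: "z u = k 0 + k 2" "z x = - k 0 + k 2" "z v = k 1 + k 2" "z y = - k 1 + k 2"
    "\<And>w. w \<notin> {u, v, x, y} \<Longrightarrow> z w = 0"
    using d by (auto simp: z_def g_def)
  have "qform G z = (\<Sum>a\<in>{u, v, x, y}. \<Sum>b\<in>{u, v, x, y}. adj G a b * z a * z b)"
    by (rule qform_support) (use d z pair_graph_finite[OF G] in auto)
  also have "\<dots> = 8 * (k 2 * k 2)"
    using d edges irr by (simp add: adj_def z algebra_simps)
  finally have q: "qform G z = 8 * (k 2 * k 2)" .
  then have "k 2 * k 2 \<le> 0" using k(2) unfolding z_def by simp
  then have k2: "k 2 = 0" using not_sum_squares_lt_zero[of "k 2" 0] zero_le_square[of "k 2"] by (smt (verit) mult_eq_0_iff)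
  have op: "adj_op G z w = 0" if "w \<in> pverts G" for w
    using k(3) q k2 that unfolding z_def by simp
  have "adj_op G z w = (\<Sum>b\<in>{u, v, x, y}. adj G w b * z b)" for w
    by (rule adj_op_support) (use d z pair_graph_finite[OF G] in auto)
  then have rel: "k 0 * (adj G w u - adj G w x) + k 1 * (adj G w v - adj G w y) = 0"
    if "w \<in> pverts G" for w
    using d k2 op[OF that] by (simp add: z algebra_simps)
  have nz: "k 0 \<noteq> 0 \<or> k 1 \<noteq> 0" using k(1) k2 by auto
  have inV: "w \<in> pverts G" if "w \<in> nbhd G t" for w t
    using that pair_graph_verts(2)[OF G] by (auto simp: nbhd_def)
  have twinI: "congruent_I G s" if "s \<in> pverts G" "t \<in> pverts G" "t \<noteq> s" "(s, t) \<notin> parcs G"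
    "\<And>w. w \<in> pverts G \<Longrightarrow> adj G w s = adj G w t" for s t
  proof -
    have "w \<in> nbhd G s \<longleftrightarrow> w \<in> nbhd G t" for w
      using that(5)[of w] inV[of w] by (auto simp: adj_nbhd[OF G] split: if_splits)
    then have "nbhd G s = nbhd G t" by blast
    then show ?thesis using that(1-4) unfolding congruent_I_def by blast
  qed
  have sym: "(a, b) \<in> parcs G \<longleftrightarrow> (b, a) \<in> parcs G" for a b by (rule pair_graph_sym[OF G])
  consider "\<forall>w\<in>pverts G. adj G w u = adj G w x" | "\<forall>w\<in>pverts G. adj G w v = adj G w y"
    | "\<forall>w\<in>pverts G. adj G w u - adj G w x = adj G w v - adj G w y"
    | "\<forall>w\<in>pverts G. adj G w u - adj G w x = - (adj G w v - adj G w y)"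
  proof (cases "\<forall>w\<in>pverts G. adj G w u = adj G w x")
    case False
    then obtain w0 where w0: "w0 \<in> pverts G" "adj G w0 u \<noteq> adj G w0 x" by blast
    have dv: "adj G w a - adj G w b \<in> {-1, 0, 1}" for w a b by (auto simp: adj_def)
    show thesis
    proof (cases "k 0 = 0")
      case True
      then show thesis using rel nz that(2) by auto
    next
      case False
      then have "adj G w0 v - adj G w0 y \<noteq> 0" using rel[OF w0(1)] w0(2) by auto
      then have "k 1 = k 0 \<or> k 1 = - k 0"
        using rel[OF w0(1)] w0(2) dv[of w0 u x] dv[of w0 v y] by auto
      then show thesis
      proof
        assume "k 1 = k 0"
        then have "k 0 * ((adj G w u - adj G w x) + (adj G w v - adj G w y)) = 0" if "w \<in> pverts G" for w
          using rel[OF that] by (simp add: algebra_simps)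
        then have "(adj G w u - adj G w x) + (adj G w v - adj G w y) = 0" if "w \<in> pverts G" for w
          using \<open>k 0 \<noteq> 0\<close> that by (metis mult_eq_0_iff)
        then show thesis by (intro that(4)) force
      next
        assume "k 1 = - k 0"
        then have "k 0 * ((adj G w u - adj G w x) - (adj G w v - adj G w y)) = 0" if "w \<in> pverts G" for w
          using rel[OF that] by (simp add: algebra_simps)
        then show thesis using \<open>k 0 \<noteq> 0\<close> by (intro that(3)) simp
      qed
    qed
  qed (use that in blast)
  then show ?thesis
  proof cases
    case 1
    then have "congruent_I G u" using d edges by (intro twinI[of u x]) auto
    then show ?thesis by (auto simp: congruent_def)
  next
    case 2
    then have "congruent_I G v" using d edges by (intro twinI[of v y]) auto
    then show ?thesis by (auto simp: congruent_def)
  next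
    case 3
    \<comment> \<open>Without independent triples \<open>w\<close> sees at least one of
      \<open>u\<close>, \<open>x\<close> and one of \<open>v\<close>, \<open>y\<close>. So a zero
      difference means that \<open>w\<close> sees both ends, and equal differences give equal
      adjacencies.\<close>
    have eq: "((w, u) \<in> parcs G \<longleftrightarrow> (w, v) \<in> parcs G) \<and> ((w, x) \<in> parcs G \<longleftrightarrow> (w, y) \<in> parcs G)"
      if w: "w \<in> pverts G" "w \<notin> {u, v, x, y}" for w
    proof -
      have "\<not> ((w, v) \<notin> parcs G \<and> (w, y) \<notin> parcs G)" "\<not> ((w, u) \<notin> parcs G \<and> (w, x) \<notin> parcs G)"
        using no3[of w v y] no3[of w u x] w d edges unfolding indep3_def by auto
      moreover have "adj G w u - adj G w x = adj G w v - adj G w y" using 3 w by blast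
      ultimately show ?thesis by (auto simp: adj_def split: if_splits)
    qed
    have "congruent_pair G u v x y"
    proof -
      have "w \<in> nbhd G u - {y, v} \<longleftrightarrow> w \<in> nbhd G v - {u, x}"
        "w \<in> nbhd G x - {v, y} \<longleftrightarrow> w \<in> nbhd G y - {x, u}" for w
        using eq[of w] inV[of w] edges irr sym[of w] unfolding nbhd_def
        by (cases "w \<in> {u, v, x, y}"; auto)+
      then show ?thesis unfolding congruent_pair_def by blast
    qed
    then have "congruent_III G u" using C unfolding congruent_III_def congruent_C4_def by blast
    then show ?thesis by (auto simp: congruent_def)
  next
    case 4
    have eq: "((w, v) \<in> parcs G \<longleftrightarrow> (w, x) \<in> parcs G) \<and> ((w, y) \<in> parcs G \<longleftrightarrow> (w, u) \<in> parcs G)"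
      if w: "w \<in> pverts G" "w \<notin> {u, v, x, y}" for w
    proof -
      have "\<not> ((w, v) \<notin> parcs G \<and> (w, y) \<notin> parcs G)" "\<not> ((w, u) \<notin> parcs G \<and> (w, x) \<notin> parcs G)"
        using no3[of w v y] no3[of w u x] w d edges unfolding indep3_def by auto
      moreover have "adj G w u - adj G w x = - (adj G w v - adj G w y)" using 4 w by blast
      ultimately show ?thesis by (auto simp: adj_def split: if_splits)
    qed
    have "congruent_pair G v x y u"
    proof -
      have "w \<in> nbhd G v - {u, x} \<longleftrightarrow> w \<in> nbhd G x - {v, y}"
        "w \<in> nbhd G y - {x, u} \<longleftrightarrow> w \<in> nbhd G u - {y, v}" for w
        using eq[of w] inV[of w] edges irr sym[of w] unfolding nbhd_def
        by (cases "w \<in> {u, v, x, y}"; auto)+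
      then show ?thesis unfolding congruent_pair_def by blast
    qed
    then have "congruent_III G u" using C unfolding congruent_III_def congruent_C4_def by blast
    then show ?thesis by (auto simp: congruent_def)
  qed
qed

lemma no_induced_C5:
  assumes G: "pair_graph G" and p: "sgn_index 1 G \<le> 2"
    and d: "distinct [a, b, c, d, e]" "{a, b, c, d, e} \<subseteq> pverts G"
    and E: "(a, b) \<in> parcs G" "(b, c) \<in> parcs G" "(c, d) \<in> parcs G" "(d, e) \<in> parcs G" "(e, a) \<in> parcs G"
    and N: "(a, c) \<notin> parcs G" "(a, d) \<notin> parcs G" "(b, d) \<notin> parcs G" "(b, e) \<notin> parcs G" "(c, e) \<notin> parcs G"
  shows False
proof -
  have ne: "b \<noteq> a" "c \<noteq> a" "d \<noteq> a" "e \<noteq> a" "c \<noteq> b" "d \<noteq> b" "e \<noteq> b" "d \<noteq> c" "e \<noteq> c" "e \<noteq> d"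
    using d(1) by auto
  have E': "(b, a) \<in> parcs G" "(c, b) \<in> parcs G" "(d, c) \<in> parcs G" "(e, d) \<in> parcs G" "(a, e) \<in> parcs G"
    "(c, a) \<notin> parcs G" "(d, a) \<notin> parcs G" "(d, b) \<notin> parcs G" "(e, b) \<notin> parcs G" "(e, c) \<notin> parcs G"
    using E N pair_graph_sym[OF G] by blast+
  \<comment> \<open>Integer approximations of the three eigenvectors of the 5-cycle with positive eigenvalue.\<close>
  define g where "g = (\<lambda>i::nat. \<lambda>w. if i = 0 then (if w \<in> {a, b, c, d, e} then 1 else 0 :: real)
    else if i = 1 then (if w = a then 4 else if w = b \<or> w = e then 1 else if w = c \<or> w = d then - 3 else 0)
    else (if w = b then 3 else if w = c then 2 else if w = d then - 2 else if w = e then - 3 else 0))"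
  have "definite_family 1 G 3 g"
    unfolding definite_family_def
  proof (intro allI impI)
    fix k :: "nat \<Rightarrow> real" assume k: "\<exists>i<3. k i \<noteq> 0"
    define z where "z = (\<lambda>v. \<Sum>i<3. k i * g i v)"
    have z_eq: "z v = k 0 * g 0 v + k 1 * g 1 v + k 2 * g 2 v" for v
      by (simp add: z_def eval_nat_numeral)
    have z: "z a = k 0 + 4 * k 1" "z b = k 0 + k 1 + 3 * k 2" "z c = k 0 - 3 * k 1 + 2 * k 2"
      "z d = k 0 - 3 * k 1 - 2 * k 2" "z e = k 0 + k 1 - 3 * k 2"
      "\<And>w. w \<notin> {a, b, c, d, e} \<Longrightarrow> z w = 0"
      using d ne unfolding z_eq by (simp_all add: g_def)
    have "qform G z = (\<Sum>u\<in>{a, b, c, d, e}. \<Sum>v\<in>{a, b, c, d, e}. adj G u v * z u * z v)"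
      by (rule qform_support) (use d z pair_graph_finite[OF G] in auto)
    \<comment> \<open>The three vectors are orthogonal with respect to the form, so only squares
      survive.\<close>
    also have "\<dots> = 10 * (k 0)\<^sup>2 + 22 * (k 1)\<^sup>2 + 16 * (k 2)\<^sup>2"
      using d E N E' by (simp add: adj_def z pair_graph_irrefl[OF G] algebra_simps power2_eq_square)
    finally have q: "qform G z = 10 * (k 0)\<^sup>2 + 22 * (k 1)\<^sup>2 + 16 * (k 2)\<^sup>2" .
    have "k 0 \<noteq> 0 \<or> k 1 \<noteq> 0 \<or> k 2 \<noteq> 0" using k by (auto simp: numeral_3_eq_3 less_Suc_eq numeral_2_eq_2)
    then have "qform G z > 0" unfolding q
      by (smt (verit) zero_le_power2 zero_less_power2)
    then show "0 < 1 * qform G (\<lambda>v. \<Sum>i<3. k i * g i v)" by (simp add: z_def)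
  qed
  from definite_family_le[OF G _ this] p show False by simp
qed


section \<open>Words in two letters\<close>

text \<open>A word encodes the graph on its positions in which two positions are non-adjacent iff the
  earlier one carries the letter True and the later one the letter False.\<close>

definition tot :: "bool \<Rightarrow> (bool \<times> real) list \<Rightarrow> real" where
  "tot b zs = (\<Sum>p\<leftarrow>zs. if fst p = b then snd p else 0)"

text \<open>The quadratic form of the graph encoded by the word, with \<open>z\<close> as the
  coordinates: a position meets the later positions adjacent to it, and the factor 2 counts each
  edge in both directions.\<close>

fun wform :: "(bool \<times> real) list \<Rightarrow> real" where
  "wform [] = 0"
| "wform ((b, z) # r) = 2 * z * (tot True r + (if b then 0 else tot False r)) + wform r"

lemma tot_simps [simp]:
  "tot b [] = 0" "tot b (p # r) = (if fst p = b then snd p else 0) + tot b r"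
  "tot b (r @ r') = tot b r + tot b r'"
  by (simp_all add: tot_def)

lemma wform_append:
  "wform (r @ r') = wform r + wform r' + 2 * (tot True r * tot True r' + tot False r * (tot True r' + tot False r'))"
  by (induction r rule: wform.induct) (simp_all add: algebra_simps)

definition lin3 :: "(nat \<Rightarrow> real) \<Rightarrow> (nat \<Rightarrow> real) \<Rightarrow> real" where
  "lin3 c l = c 0 * l 0 + c 1 * l 1 + c 2 * l 2"

text \<open>There is a three-dimensional positive definite space. Each entry of \<open>ls\<close>
  holds the coordinates of three spanning vectors at one position; storing them by position lets a
  braid move act locally on the list.\<close>

definition pos3 :: "bool list \<Rightarrow> bool" where
  "pos3 ws \<longleftrightarrow> (\<exists>ls. length ls = length ws \<and>
    (\<forall>c. (\<exists>i<3. c i \<noteq> 0) \<longrightarrow> wform (zip ws (map (lin3 c) ls)) > 0))"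

lemma ex_less_3: "(\<exists>i<3::nat. c i \<noteq> (0 :: real)) \<longleftrightarrow> c 0 \<noteq> 0 \<or> c 1 \<noteq> 0 \<or> c 2 \<noteq> 0"
  by (auto simp: numeral_3_eq_3 numeral_2_eq_2 less_Suc_eq)

lemma tot_zero: "(\<And>p. p \<in> set r \<Longrightarrow> snd p = 0) \<Longrightarrow> tot b r = 0"
  by (induction r) auto

lemma wform_zero: "(\<And>p. p \<in> set r \<Longrightarrow> snd p = 0) \<Longrightarrow> wform r = 0"
proof (induction r)
  case (Cons p r)
  then have "wform r = 0" "tot b r = 0" "snd p = 0" for b by (simp_all add: tot_zero)
  then show ?case by (cases p) auto
qed simp

lemma pos3_append: "pos3 v \<Longrightarrow> pos3 (v @ w)"
proof -
  assume "pos3 v"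
  then obtain ls where ls: "length ls = length v"
    "\<And>c. \<exists>i<3. c i \<noteq> 0 \<Longrightarrow> wform (zip v (map (lin3 c) ls)) > 0" by (auto simp: pos3_def)
  let ?ls = "ls @ replicate (length w) (\<lambda>_. 0)"
  have "wform (zip (v @ w) (map (lin3 c) ?ls)) = wform (zip v (map (lin3 c) ls))" for c
  proof -
    have z: "snd p = 0" if "p \<in> set (zip w (replicate (length w) (lin3 c (\<lambda>_. 0))))" for p
    proof -
      have "snd p \<in> set (replicate (length w) (lin3 c (\<lambda>_. 0)))"
        using that by (metis prod.collapse set_zip_rightD)
      then show ?thesis by (simp add: lin3_def)
    qed
    show ?thesis using ls(1) by (simp add: wform_append wform_zero[OF z] tot_zero[OF z])
  qed
  with ls show ?thesis unfolding pos3_def by (intro exI[of _ ?ls]) auto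
qed

lemma pos3_half_twist5: "pos3 [True, False, True, True, False, True, True, False, True, True, False, True, True, False, True]"
proof -
  define l where "l = (\<lambda>a b c. \<lambda>i::nat. if i = 0 then a else if i = 1 then b else c :: real)"
  \<comment> \<open>Integer approximations of the first three eigenvectors of an induced subgraph on 10 vertices
    with three positive eigenvalues.\<close>
  define ls where "ls = [l (-1) 1 1, l 0 0 0, l (-1) 1 1, l (-1) 1 1, l (-1) (-1) (-1), l 0 0 0, l 0 0 0,
    l (-1) (-1) (-1), l (-1) 0 (-1), l (-1) 0 (-1), l (-1) (-1) 1, l 0 0 0, l 0 0 0, l (-1) (-1) 1, l (-1) 0 1]"
  show ?thesis
    unfolding pos3_def
  proof (intro exI[of _ ls] conjI allI impI)
    fix c :: "nat \<Rightarrow> real" assume "\<exists>i<3. c i \<noteq> 0"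
    then have nz: "c 0 \<noteq> 0 \<or> c 1 \<noteq> 0 \<or> c 2 \<noteq> 0" by (simp add: ex_less_3)
    \<comment> \<open>Completed squares in triangular order with positive weights: the form can
      vanish only if \<open>c 0\<close>, \<open>c 1\<close> and \<open>c 2\<close> do.\<close>
    have "wform (zip [True, False, True, True, False, True, True, False, True, True, False, True, True, False, True] (map (lin3 c) ls))
      = 2 * (c 2 + 3/2 * c 1 - 3 * c 0)\<^sup>2 + 27/2 * (c 1 + 28/27 * c 0)\<^sup>2 + 688/27 * (c 0)\<^sup>2"
      by (simp add: ls_def l_def lin3_def power2_eq_square algebra_simps)
    moreover have "\<dots> > 0"
    proof (cases "c 0 = 0")
      case True
      then show ?thesis using nz
        by (cases "c 1 = 0") (auto intro: add_pos_nonneg add_nonneg_pos)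
    next
      case False
      then have "688/27 * (c 0)\<^sup>2 > 0" by simp
      then show ?thesis by (intro add_nonneg_pos add_nonneg_nonneg) auto
    qed
    ultimately show "0 < wform (zip [True, False, True, True, False, True, True, False, True, True, False, True, True, False, True] (map (lin3 c) ls))"
      by simp
  qed (simp add: ls_def)
qed

text \<open>The form only depends on the braid represented by the word: replacing one of three consecutive
  vertices \<open>x\<close>, \<open>y\<close>, \<open>x'\<close> by \<open>y - x + x'\<close> realises the braid relation.\<close>

inductive braid :: "bool list \<Rightarrow> bool list \<Rightarrow> bool" where
  braid_refl: "braid w w"
| braid_step: "braid w (v @ [l, \<not> l, l] @ v') \<Longrightarrow> braid w (v @ [\<not> l, l, \<not> l] @ v')"

lemma braid_trans: "braid v w \<Longrightarrow> braid u v \<Longrightarrow> braid u w"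
proof (induction rule: braid.induct)
  case (braid_step w v l v')
  then show ?case using braid.braid_step by blast
qed

lemma braid_context: "braid v w \<Longrightarrow> braid (a @ v @ b) (a @ w @ b)"
proof (induction rule: braid.induct)
  case (braid_step w v l v')
  then show ?case using braid.braid_step[of "a @ w @ b" "a @ v" l "v' @ b"] by simp
qed (rule braid_refl)

lemma braid_length: "braid v w \<Longrightarrow> length v = length w"
  by (induction rule: braid.induct) auto

lemma pos3_braid_step: "pos3 (v @ [\<not> l, l, \<not> l] @ v') \<Longrightarrow> pos3 (v @ [l, \<not> l, l] @ v')"
proof -
  assume "pos3 (v @ [\<not> l, l, \<not> l] @ v')"
  then obtain ls where ls: "length ls = length (v @ [\<not> l, l, \<not> l] @ v')"
    "\<And>c. \<exists>i<3. c i \<noteq> 0 \<Longrightarrow> wform (zip (v @ [\<not> l, l, \<not> l] @ v') (map (lin3 c) ls)) > 0"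
    unfolding pos3_def by blast
  define la where "la = take (length v) ls"
  obtain p q r lb where lb: "drop (length v) ls = p # q # r # lb" "length lb = length v'"
  proof -
    have "length (drop (length v) ls) = Suc (Suc (Suc (length v')))" using ls(1) by simp
    then show thesis using that by (metis length_Suc_conv)
  qed
  have ls_eq: "ls = la @ [p, q, r] @ lb" "length la = length v"
    using lb ls(1) append_take_drop_id[of "length v" ls] by (auto simp: la_def)
  \<comment> \<open>The new labels preserve the form inside the three positions and the sums of the
    True labels and of the False labels there. By \<open>wform_append\<close> the other positions
    see nothing but these two sums.\<close>
  define m where "m = (if l then [\<lambda>i. q i - p i, \<lambda>i. p i + r i, p] else [r, \<lambda>i. p i + r i, \<lambda>i. q i - r i])"
  have len: "length m = 3" by (simp add: m_def)
  have "wform (zip (v @ [l, \<not> l, l] @ v') (map (lin3 c) (la @ m @ lb))) = wform (zip (v @ [\<not> l, l, \<not> l] @ v') (map (lin3 c) ls))" for c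
    unfolding ls_eq m_def using ls_eq(2) lb(2)
    by (cases l) (simp_all add: wform_append lin3_def algebra_simps)
  then show ?thesis using ls ls_eq len lb(2)
    unfolding pos3_def by (intro exI[of _ "la @ m @ lb"]) auto
qed

lemma pos3_braid: "braid v w \<Longrightarrow> pos3 w \<Longrightarrow> pos3 v"
proof (induction rule: braid.induct)
  case (braid_step w v l v')
  then show ?case using pos3_braid_step by blast
qed

text \<open>The action of a word on the plane by the standard generators of the modular group.\<close>

fun act :: "bool list \<Rightarrow> real \<times> real \<Rightarrow> real \<times> real" where
  "act [] s = s"
| "act (b # w) (x, y) = act w (if b then (x, y - x) else (x + y, y))"

lemma act_append: "act (v @ w) s = act w (act v s)"
proof (induction v arbitrary: s)
  case (Cons b v)
  then show ?case by (cases s) (simp del: if_split)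
qed simp

lemma act_braid: "braid v w \<Longrightarrow> act v = act w"
proof (induction rule: braid.induct)
  case (braid_step w v l v')
  have "act [l, \<not> l, l] s = act [\<not> l, l, \<not> l] s" for s by (cases s; cases l) auto
  then have "act (v @ [l, \<not> l, l] @ v') = act (v @ [\<not> l, l, \<not> l] @ v')"
    by (intro ext) (simp only: act_append)
  with braid_step show ?case by simp
qed simp

section \<open>Garside normal form for positive words in the braid group on three strands\<close>

abbreviation half_twist :: "bool list" where
  "half_twist \<equiv> [True, False, True]"

lemma braid_half_twist: "braid [l, \<not> l, l] half_twist"
  using braid_step[OF braid_refl[of "[] @ [False, \<not> False, False] @ []"]] braid_refl
  by (cases l) auto

text \<open>Moving the Garside element past a generator exchanges the two generators, so half twists
  can be collected at the front at the price of negating letters.\<close>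

lemma braid_commute: "braid (w @ half_twist) (half_twist @ map Not w)"
proof (induction w)
  case (Cons l w)
  have "braid ((l # w) @ half_twist) ([l] @ half_twist @ map Not w)"
    using braid_context[OF Cons, of "[l]" "[]"] by simp
  moreover have "braid ([l] @ half_twist) (half_twist @ [\<not> l])"
  proof (cases l)
    case True
    then show ?thesis
      using braid_step[OF braid_refl[of "[True] @ [True, \<not> True, True] @ []"]] by simp
  next
    case False
    then show ?thesis
      using braid_step[OF braid_refl[of "[] @ [False, \<not> False, False] @ [True]"]] by simp
  qed
  then have "braid ([l] @ half_twist @ map Not w) (half_twist @ map Not (l # w))"
    using braid_context[of "[l] @ half_twist" "half_twist @ [\<not> l]" "[]" "map Not w"] by simp
  ultimately show ?case using braid_trans by blast
qed (simp add: braid_refl)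

text \<open>A word without a factor \<open>[l, \<not> l, l]\<close> admits no braid move at all, so
  the literal absence of half twists is also their absence up to the braid relation.\<close>

fun twist_free :: "bool list \<Rightarrow> bool" where
  "twist_free (a # b # c # r) \<longleftrightarrow> \<not> (a \<noteq> b \<and> c = a) \<and> twist_free (b # c # r)"
| "twist_free _ = True"

lemma not_twist_free: "\<not> twist_free w \<Longrightarrow> \<exists>v l v'. w = v @ [l, \<not> l, l] @ v'"
proof (induction w rule: twist_free.induct)
  case (1 a b c r)
  show ?case
  proof (cases "a \<noteq> b \<and> c = a")
    case True
    then show ?thesis by (intro exI[of _ "[]"] exI[of _ a] exI[of _ r]) auto
  next
    case False
    then obtain v l v' where "b # c # r = v @ [l, \<not> l, l] @ v'" using 1 by auto
    then show ?thesis by (intro exI[of _ "a # v"] exI[of _ l] exI[of _ v']) simp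
  qed
qed auto

text \<open>Pulling one half twist to the front shortens the rest by three letters. Negating the
  prefix may create new half twists, so the recursion is on the length.\<close>

lemma braid_normal_form:
  "\<exists>m u. braid w (concat (replicate m half_twist) @ u) \<and> twist_free u"
proof (induction "length w" arbitrary: w rule: less_induct)
  case less
  show ?case
  proof (cases "twist_free w")
    case True
    then show ?thesis by (intro exI[of _ 0] exI[of _ w]) (simp add: braid_refl)
  next
    case False
    then obtain v l v' where w: "w = v @ [l, \<not> l, l] @ v'" using not_twist_free by blast
    let ?w = "map Not v @ v'"
    have b1: "braid w ((v @ half_twist) @ v')"
      unfolding w using braid_context[OF braid_half_twist, of v l v'] by simp
    have b2: "braid ((v @ half_twist) @ v') (half_twist @ ?w)"
      using braid_context[OF braid_commute, of "[]" v v'] by simp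
    obtain m u where mu: "braid ?w (concat (replicate m half_twist) @ u)" "twist_free u"
      using less[of ?w] w by auto
    have b3: "braid (half_twist @ ?w) (half_twist @ concat (replicate m half_twist) @ u)"
      using braid_context[OF mu(1), of half_twist "[]"] by simp
    have "braid w (concat (replicate (Suc m) half_twist) @ u)"
      using braid_trans[OF b3 braid_trans[OF b2 b1]] by simp
    with mu(2) show ?thesis by blast
  qed
qed

text \<open>The threshold comes from the target \<open>(b, b - a)\<close>: if \<open>a\<close> and
  \<open>b\<close> have absolute value 1, its entries have absolute value at most 2.\<close>

definition large :: "real \<times> real \<Rightarrow> bool" where
  "large s \<longleftrightarrow> \<bar>fst s\<bar> \<ge> 3 \<or> \<bar>snd s\<bar> \<ge> 3"

lemma twist_free_tl: "twist_free (a # w) \<Longrightarrow> twist_free w"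
  by (cases "a # w" rule: twist_free.cases) auto

text \<open>The four cones distinguish the last letters read: after at least two letters True, after the
  first False following them, and symmetrically.\<close>

lemma act_twist_free_large_aux:
  fixes x y :: real
  shows "(0 < x \<and> x < - y \<and> - y \<ge> 3 \<or> x < 0 \<and> - x < y \<and> y \<ge> 3 \<longrightarrow>
      twist_free (True # r) \<longrightarrow> large (act r (x, y))) \<and>
    (y < x \<and> x < 0 \<and> - y \<ge> 3 \<or> 0 < x \<and> x < y \<and> y \<ge> 3 \<longrightarrow>
      twist_free (True # False # r) \<longrightarrow> large (act r (x, y))) \<and>
    (x < y \<and> y < 0 \<and> - x \<ge> 3 \<or> 0 < y \<and> y < x \<and> x \<ge> 3 \<longrightarrow>
      twist_free (False # r) \<longrightarrow> large (act r (x, y))) \<and>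
    (0 < y \<and> y < - x \<and> - x \<ge> 3 \<or> y < 0 \<and> - y < x \<and> x \<ge> 3 \<longrightarrow>
      twist_free (False # True # r) \<longrightarrow> large (act r (x, y)))"
proof (induction r arbitrary: x y)
  case Nil
  then show ?case by (auto simp: large_def)
next
  case (Cons b r)
  have tl: "twist_free (c # r)" if "twist_free (a # c # r)" for a c
    using that by (rule twist_free_tl)
  show ?case
  proof (cases b)
    case True
    then show ?thesis using Cons[of x "y - x"] tl[of _ True] by auto
  next
    case False
    then show ?thesis using Cons[of "x + y" y] tl[of _ False] by auto
  qed
qed

text \<open>The start vector is chosen by the first letter so that reading this letter enlarges it.
  After two equal letters, or else after three letters, an entry has absolute value 3 and the vector
  lies in one of the four cones, which the remaining letters cannot leave while shrinking.\<close>

lemma act_twist_free_large: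
  assumes "twist_free u" "length u \<ge> 3"
  shows "large (act u (if hd u then (1, - 1) else (1, 1)))"
proof -
  obtain a b c r where u: "u = a # b # c # r"
    using assms(2) by (metis length_Cons list.exhaust list.size(3) not_less_eq_eq numeral_3_eq_3 zero_le)
  moreover from u assms(1) have "twist_free (b # c # r)" "twist_free (c # r)"
    by (metis twist_free_tl)+
  ultimately show ?thesis
    using assms(1) act_twist_free_large_aux[of 1 "-3" "c # r"] act_twist_free_large_aux[of "-3" "-2" r]
      act_twist_free_large_aux[of 3 1 "c # r"] act_twist_free_large_aux[of 2 "-3" r]
    by (cases a; cases b; cases c) auto
qed

text \<open>A half twist acts as the quarter turn \<open>(x, y) -> (y, - x)\<close>, which permutes
  the vectors with entries of absolute value 1. So the start vector needed by the remaining word is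
  available behind any number of half twists.\<close>

lemma act_half_twists_surj:
  assumes "\<bar>fst v\<bar> = 1" "\<bar>snd v\<bar> = 1"
  shows "\<exists>s. act (concat (replicate m half_twist)) s = v \<and> \<bar>fst s\<bar> = 1 \<and> \<bar>snd s\<bar> = 1"
proof (induction m)
  case 0
  then show ?case using assms by auto
next
  case (Suc m)
  then obtain s where s: "act (concat (replicate m half_twist)) s = v" "\<bar>fst s\<bar> = 1" "\<bar>snd s\<bar> = 1"
    by blast
  have "act half_twist (- snd s, fst s) = s" by simp
  then have "act (concat (replicate (Suc m) half_twist)) (- snd s, fst s) = v"
    using s(1) by (simp only: replicate_Suc concat.simps act_append)
  with s(2,3) show ?case by (intro exI[of _ "(- snd s, fst s)"]) simp
qed

lemma length_le_14:
  assumes act: "\<And>a b. act w (a, b) = (b, b - a)" and np: "\<not> pos3 w"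
  shows "length w \<le> 14"
proof -
  obtain m u where mu: "braid w (concat (replicate m half_twist) @ u)" "twist_free u"
    using braid_normal_form by blast
  have "length u \<le> 2"
  proof (rule ccontr)
    assume "\<not> ?thesis"
    then have "large (act u (if hd u then (1, - 1) else (1, 1)))"
      using act_twist_free_large mu(2) by simp
    moreover have "\<exists>s. act (concat (replicate m half_twist)) s = (if hd u then (1, - 1) else (1, 1)) \<and>
        \<bar>fst s\<bar> = 1 \<and> \<bar>snd s\<bar> = 1"
      by (rule act_half_twists_surj) auto
    then obtain s where s: "act (concat (replicate m half_twist)) s = (if hd u then (1, - 1) else (1, 1))"
      "\<bar>fst s\<bar> = 1" "\<bar>snd s\<bar> = 1" by blast
    moreover have "act u (act (concat (replicate m half_twist)) s) = (snd s, snd s - fst s)"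
      using act_braid[OF mu(1)] act[of "fst s" "snd s"] by (simp add: act_append)
    ultimately show False by (auto simp: large_def)
  qed
  moreover have "m \<le> 4"
  proof (rule ccontr)
    assume "\<not> ?thesis"
    then have "5 \<le> m" by simp
    then obtain k where "m = 5 + k" using le_Suc_ex by blast
    then have "concat (replicate m half_twist) @ u = [True, False, True, True, False, True, True, False,
      True, True, False, True, True, False, True] @ (concat (replicate k half_twist) @ u)"
      by (simp add: replicate_add eval_nat_numeral)
    then have "pos3 (concat (replicate m half_twist) @ u)"
      using pos3_append[OF pos3_half_twist5] by metis
    then show False using pos3_braid[OF mu(1)] np by blast
  qed
  moreover have "length (concat (replicate m half_twist)) = 3 * m" by (induction m) auto
  ultimately show ?thesis using braid_length[OF mu(1)] by simp
qed

section \<open>Chain graphs\<close>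

text \<open>Along \<open>vs\<close> the values of \<open>P\<close> spell the word that encodes
  \<open>G\<close>; \<open>sorted_wrt\<close> compares each vertex with all later ones, not only
  with the next.\<close>

definition chain_list :: "'a pair_pre_digraph \<Rightarrow> ('a \<Rightarrow> bool) \<Rightarrow> 'a list \<Rightarrow> bool" where
  "chain_list G P vs \<longleftrightarrow> distinct vs \<and> set vs = pverts G \<and>
    sorted_wrt (\<lambda>u v. (u, v) \<in> parcs G \<longleftrightarrow> \<not> (P u \<and> \<not> P v)) vs"

abbreviation labelled :: "('a \<Rightarrow> bool) \<Rightarrow> ('a \<Rightarrow> real) \<Rightarrow> 'a list \<Rightarrow> (bool \<times> real) list" where
  "labelled P x vs \<equiv> map (\<lambda>v. (P v, x v)) vs"

lemma tot_labelled:
  "distinct vs \<Longrightarrow> tot b (labelled P x vs) = (\<Sum>v\<in>set vs. if P v = b then x v else 0)"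
  by (induction vs) auto

lemma tot_labelled_sum:
  "tot b (labelled P (\<lambda>v. \<Sum>i\<in>I. c i * g i v) vs) = (\<Sum>i\<in>I. c i * tot b (labelled P (g i) vs))"
  by (induction vs) (simp_all add: sum.distrib algebra_simps)

lemma row_after:
  assumes "distinct r" "\<And>u. u \<in> set r \<Longrightarrow> (v, u) \<in> parcs G \<longleftrightarrow> \<not> (P v \<and> \<not> P u)"
  shows "(\<Sum>u\<in>set r. adj G v u * x u) = tot True (labelled P x r) + (if P v then 0 else tot False (labelled P x r))"
  unfolding tot_labelled[OF assms(1)] using assms(2)
  by (cases "P v") (auto simp: adj_def sum.distrib[symmetric] intro!: sum.cong)

lemma row_before:
  assumes G: "pair_graph G" and "distinct r"
    and "\<And>u. u \<in> set r \<Longrightarrow> (u, v) \<in> parcs G \<longleftrightarrow> \<not> (P u \<and> \<not> P v)"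
  shows "(\<Sum>u\<in>set r. adj G v u * x u) = tot False (labelled P x r) + (if P v then tot True (labelled P x r) else 0)"
proof -
  have "(\<Sum>u\<in>set r. adj G v u * x u) = (\<Sum>u\<in>set r. adj G u v * x u)"
    using adj_sym[OF G] by (intro sum.cong) auto
  then show ?thesis
    unfolding tot_labelled[OF assms(2)] using assms(3)
    by (cases "P v") (auto simp: adj_def sum.distrib[symmetric] intro!: sum.cong)
qed

lemma qform_chain:
  assumes G: "pair_graph G" and ch: "chain_list G P vs"
  shows "qform G x = wform (labelled P x vs)"
proof -
  have main: "(\<Sum>u\<in>set r. \<Sum>v\<in>set r. adj G u v * x u * x v) = wform (labelled P x r)"
    if "distinct r" "sorted_wrt (\<lambda>u v. (u, v) \<in> parcs G \<longleftrightarrow> \<not> (P u \<and> \<not> P v)) r" for r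
    using that
  proof (induction r)
    case (Cons v r)
    have row: "(\<Sum>u\<in>set r. adj G v u * x u) = tot True (labelled P x r) + (if P v then 0 else tot False (labelled P x r))"
      by (rule row_after) (use Cons.prems in auto)
    have "(\<Sum>a\<in>set (v # r). \<Sum>b\<in>set (v # r). adj G a b * x a * x b)
        = (\<Sum>b\<in>set r. adj G v b * x v * x b) + (\<Sum>a\<in>set r. adj G a v * x a * x v)
          + (\<Sum>a\<in>set r. \<Sum>b\<in>set r. adj G a b * x a * x b)"
      using Cons.prems by (simp add: sum.distrib adj_def pair_graph_irrefl[OF G])
    moreover have "(\<Sum>b\<in>set r. adj G v b * x v * x b) = x v * (\<Sum>u\<in>set r. adj G v u * x u)"
      by (simp add: sum_distrib_left algebra_simps)
    moreover have "(\<Sum>a\<in>set r. adj G a v * x a * x v) = x v * (\<Sum>u\<in>set r. adj G v u * x u)"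
      unfolding sum_distrib_left by (intro sum.cong) (simp_all add: adj_sym[OF G, of v])
    ultimately show ?case using Cons unfolding row by simp
  qed simp
  have "qform G x = (\<Sum>u\<in>set vs. \<Sum>v\<in>set vs. adj G u v * x u * x v)"
    by (rule qform_support) (use ch pair_graph_finite[OF G] in \<open>auto simp: chain_list_def\<close>)
  also have "\<dots> = wform (labelled P x vs)"
    by (rule main) (use ch in \<open>unfold chain_list_def, blast+\<close>)
  finally show ?thesis .
qed

lemma pos3_chain:
  assumes G: "pair_graph G" and ch: "chain_list G P vs" and p: "pos3 (map P vs)"
  shows "sgn_index 1 G \<ge> 3"
proof -
  obtain ls where ls: "length ls = length vs"
    "\<And>c. \<exists>i<3. c i \<noteq> 0 \<Longrightarrow> wform (zip (map P vs) (map (lin3 c) ls)) > 0"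
    using p by (auto simp: pos3_def)
  have dist: "distinct vs" using ch by (simp add: chain_list_def)
  define L where "L v = the (map_of (zip vs ls) v)" for v
  have L: "L (vs ! k) = ls ! k" if "k < length vs" for k
    using map_of_zip_nth[OF ls(1)[symmetric] dist] that ls(1) by (simp add: L_def)
  have "labelled P (\<lambda>v. \<Sum>i<3. c i * L v i) vs = zip (map P vs) (map (lin3 c) ls)" for c
    by (rule nth_equalityI) (use ls(1) L in \<open>auto simp: lin3_def eval_nat_numeral\<close>)
  then have "definite_family 1 G 3 (\<lambda>i v. L v i)"
    unfolding definite_family_def qform_chain[OF G ch] using ls(2) by simp
  then show ?thesis by (intro definite_family_le[OF G]) auto
qed

text \<open>A null vector solves a recurrence along the chain whose state is transformed by the letters.\<close>

lemma chain_row: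
  assumes G: "pair_graph G" and ch: "chain_list G P vs" and vs: "vs = pre @ v # suf"
    and z: "adj_op G z v = 0"
    and XY: "X = tot True (labelled P z vs)" "Y = tot False (labelled P z vs)"
  shows "z v = (if P v then X + tot False (labelled P z pre) else X + Y - tot True (labelled P z pre))"
proof -
  have d: "distinct (pre @ v # suf)" "pverts G = set pre \<union> insert v (set suf)"
    "sorted_wrt (\<lambda>u v. (u, v) \<in> parcs G \<longleftrightarrow> \<not> (P u \<and> \<not> P v)) (pre @ v # suf)"
    using ch unfolding chain_list_def vs by auto
  have "adj_op G z v = (\<Sum>u\<in>set pre. adj G v u * z u) + (\<Sum>u\<in>set suf. adj G v u * z u)"
    unfolding mat_op_def d(2) using d(1)
    by (subst sum.union_disjoint) (auto simp: adj_def pair_graph_irrefl[OF G])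
  moreover have "(\<Sum>u\<in>set pre. adj G v u * z u) =
      tot False (labelled P z pre) + (if P v then tot True (labelled P z pre) else 0)"
    by (rule row_before[OF G]) (use d in \<open>auto simp: sorted_wrt_append\<close>)
  moreover have "(\<Sum>u\<in>set suf. adj G v u * z u) =
      tot True (labelled P z suf) + (if P v then 0 else tot False (labelled P z suf))"
    by (rule row_after) (use d in \<open>auto simp: sorted_wrt_append\<close>)
  ultimately show ?thesis using z unfolding XY vs by (cases "P v") auto
qed

text \<open>The state after a prefix is \<open>X\<close> plus its False sum, and
  \<open>X + Y\<close> minus its True sum. The null equation makes the next value of
  \<open>z\<close> one of these two entries, selected by the letter, and adding that value to the
  sums is one step of \<open>act\<close>. The state runs from \<open>(X, X + Y)\<close> to
  \<open>(X + Y, Y)\<close>.\<close>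

lemma chain_kernel_act:
  assumes G: "pair_graph G" and ch: "chain_list G P vs"
    and z: "\<And>v. v \<in> pverts G \<Longrightarrow> adj_op G z v = 0"
    and XY: "X = tot True (labelled P z vs)" "Y = tot False (labelled P z vs)"
  shows "act (map P vs) (X, X + Y) = (X + Y, Y)"
proof -
  have "act (map P suf) (X + tot False (labelled P z pre), X + Y - tot True (labelled P z pre)) = (X + Y, Y)"
    if "vs = pre @ suf" for pre suf
    using that
  proof (induction suf arbitrary: pre)
    case Nil
    then show ?case using XY by simp
  next
    case (Cons v suf)
    have "v \<in> pverts G" using ch Cons.prems unfolding chain_list_def by auto
    note zv = chain_row[OF G ch Cons.prems z[OF this] XY]
    have "vs = (pre @ [v]) @ suf" using Cons.prems by simp
    from Cons.IH[OF this] show ?case using zv by (cases "P v") (simp_all add: algebra_simps)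
  qed
  from this[of "[]" vs] show ?thesis by simp
qed

text \<open>With both letter sums 0 the recurrence starts at the origin and never leaves it. Thus a
  null vector is determined by its two letter sums.\<close>

lemma chain_kernel_zero:
  assumes G: "pair_graph G" and ch: "chain_list G P vs"
    and z: "\<And>v. v \<in> pverts G \<Longrightarrow> adj_op G z v = 0"
    and XY: "tot True (labelled P z vs) = 0" "tot False (labelled P z vs) = 0" and v: "v \<in> pverts G"
  shows "z v = 0"
proof -
  have "\<forall>u\<in>set pre. z u = 0" if "vs = pre @ suf" for pre suf
    using that
  proof (induction pre arbitrary: suf rule: rev_induct)
    case (snoc u pre)
    then have zero: "\<forall>w\<in>set pre. z w = 0" by simp
    have "u \<in> pverts G" using ch snoc.prems unfolding chain_list_def by auto
    moreover have "vs = pre @ u # suf" using snoc.prems by simp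
    moreover have "tot b (labelled P z pre) = 0" for b by (rule tot_zero) (use zero in auto)
    ultimately have "z u = 0" using chain_row[OF G ch _ z XY[symmetric]] by simp
    with zero show ?case by simp
  qed simp
  from this[of vs "[]"] show ?thesis using ch v by (simp add: chain_list_def)
qed

lemma chain_nullity_le_2:
  assumes G: "pair_graph G" and ch: "chain_list G P vs"
  shows "nullity G \<le> 2"
proof (rule ccontr)
  assume "\<not> ?thesis"
  then have "3 \<le> nullity G" by simp
  then obtain g :: "nat \<Rightarrow> _" where g: "\<And>i v. i < 3 \<Longrightarrow> v \<in> pverts G \<Longrightarrow> adj_op G (g i) v = 0"
    "\<And>c. \<exists>i<3. c i \<noteq> 0 \<Longrightarrow> \<exists>v\<in>pverts G. (\<Sum>i<3. c i * g i v) \<noteq> 0"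
    using nullity_kernel[OF G] by blast
  have "\<exists>c. (\<exists>i\<in>{..<3::nat}. c i \<noteq> 0) \<and>
      (\<forall>b\<in>UNIV::bool set. (\<Sum>i<3. tot b (labelled P (g i) vs) * c i) = 0)"
    by (rule underdetermined_system) (auto simp: card_UNIV_bool)
  then obtain c where c: "\<exists>i\<in>{..<3::nat}. c i \<noteq> 0"
    "\<And>b. (\<Sum>i<3. tot b (labelled P (g i) vs) * c i) = 0" by auto
  have "tot b (labelled P (\<lambda>v. \<Sum>i<3. c i * g i v) vs) = 0" for b
    unfolding tot_labelled_sum using c(2)[of b] by (simp add: mult.commute)
  moreover have "adj_op G (\<lambda>v. \<Sum>i<3. c i * g i v) v = 0" if "v \<in> pverts G" for v
    unfolding mat_op_sum using g(1)[OF _ that] by simp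
  ultimately have "\<forall>v\<in>pverts G. (\<Sum>i<3. c i * g i v) = 0"
    using chain_kernel_zero[OF G ch, of "\<lambda>v. \<Sum>i<3. c i * g i v"] by blast
  then show False using g(2)[of c] c(1) by blast
qed

text \<open>A two-dimensional kernel is mapped injectively, hence onto, the plane of letter sums. So
  the relation satisfied by single null vectors holds for all \<open>(a, b)\<close>, with
  \<open>a = X\<close> and \<open>b = X + Y\<close>.\<close>

lemma chain_nullity_2_act:
  assumes G: "pair_graph G" and ch: "chain_list G P vs" and nul: "2 \<le> nullity G"
  shows "act (map P vs) (a, b) = (b, b - a)"
proof -
  obtain g :: "nat \<Rightarrow> _" where g: "\<And>i v. i < 2 \<Longrightarrow> v \<in> pverts G \<Longrightarrow> adj_op G (g i) v = 0"
    "\<And>c. \<exists>i<2. c i \<noteq> 0 \<Longrightarrow> \<exists>v\<in>pverts G. (\<Sum>i<2. c i * g i v) \<noteq> 0"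
    using nullity_kernel[OF G nul] by blast
  define X where "X i = tot True (labelled P (g i) vs)" for i
  define Y where "Y i = tot False (labelled P (g i) vs)" for i
  have tots: "tot True (labelled P (\<lambda>v. \<Sum>i<2. c i * g i v) vs) = c 0 * X 0 + c 1 * X 1"
    "tot False (labelled P (\<lambda>v. \<Sum>i<2. c i * g i v) vs) = c 0 * Y 0 + c 1 * Y 1" for c
    unfolding tot_labelled_sum X_def Y_def by (simp_all add: numeral_2_eq_2)
  have null: "adj_op G (\<lambda>v. \<Sum>i<2. c i * g i v) v = 0" if "v \<in> pverts G" for v c
    unfolding mat_op_sum using g(1)[OF _ that] by simp
  have inj: "c 0 = 0 \<and> c 1 = 0" if "c 0 * X 0 + c 1 * X 1 = 0" "c 0 * Y 0 + c 1 * Y 1 = 0" for c :: "nat \<Rightarrow> real"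
  proof -
    have "\<forall>v\<in>pverts G. (\<Sum>i<2. c i * g i v) = 0"
      using chain_kernel_zero[OF G ch null] that unfolding tots by blast
    then have "\<not> (\<exists>i<2. c i \<noteq> 0)" using g(2)[of c] by blast
    then show ?thesis by auto
  qed
  \<comment> \<open>The determinant of the map from coefficients to letter sums; the witnesses below
    are its would-be kernel vectors.\<close>
  define D where "D = X 0 * Y 1 - X 1 * Y 0"
  have "D \<noteq> 0"
  proof
    assume D: "D = 0"
    have "X 0 = 0 \<and> X 1 = 0"
      using inj[of "\<lambda>i. if i = 0 then X 1 else - X 0"] D by (simp add: D_def algebra_simps)
    moreover have "Y 0 = 0 \<and> Y 1 = 0"
      using inj[of "\<lambda>i. if i = 0 then Y 1 else - Y 0"] D by (simp add: D_def algebra_simps)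
    ultimately show False using inj[of "\<lambda>_. 1"] by simp
  qed
  \<comment> \<open>Cramer's rule for letter sums \<open>a\<close> and \<open>b - a\<close>.\<close>
  define c where "c = (\<lambda>i::nat. if i = 0 then (a * Y 1 - (b - a) * X 1) / D else ((b - a) * X 0 - a * Y 0) / D)"
  have "c 0 * X 0 + c 1 * X 1 = ((a * Y 1 - (b - a) * X 1) * X 0 + ((b - a) * X 0 - a * Y 0) * X 1) / D"
    "c 0 * Y 0 + c 1 * Y 1 = ((a * Y 1 - (b - a) * X 1) * Y 0 + ((b - a) * X 0 - a * Y 0) * Y 1) / D"
    by (simp_all add: c_def add_divide_distrib)
  moreover have "(a * Y 1 - (b - a) * X 1) * X 0 + ((b - a) * X 0 - a * Y 0) * X 1 = a * D"
    "(a * Y 1 - (b - a) * X 1) * Y 0 + ((b - a) * X 0 - a * Y 0) * Y 1 = (b - a) * D"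
    by (simp_all add: D_def algebra_simps)
  ultimately have "c 0 * X 0 + c 1 * X 1 = a" "c 0 * Y 0 + c 1 * Y 1 = b - a"
    using \<open>D \<noteq> 0\<close> by simp_all
  then have "a = tot True (labelled P (\<lambda>v. \<Sum>i<2. c i * g i v) vs)"
    "b - a = tot False (labelled P (\<lambda>v. \<Sum>i<2. c i * g i v) vs)"
    unfolding tots by simp_all
  from chain_kernel_act[OF G ch null this] show ?thesis by simp
qed

lemma chain_card_le_14:
  assumes G: "pair_graph G" and ch: "chain_list G P vs"
    and p: "sgn_index 1 G = 2" and nul: "nullity G = 2"
  shows "card (pverts G) \<le> 14"
proof -
  have "length (map P vs) \<le> 14"
    by (rule length_le_14) (use chain_nullity_2_act[OF G ch] pos3_chain[OF G ch] p nul in auto)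
  then show ?thesis using ch distinct_card by (fastforce simp: chain_list_def)
qed

text \<open>\<open>f\<close> numbers the blocks of equal letters in the word. Parity is the letter,
  with even for True, and vertices with equal values are adjacent, so a block is a clique. If the
  values fill \<open>{..<k}\<close>, the blocks are the vertices of
  \<open>G_graph k\<close>.\<close>

definition chain_map :: "'a pair_pre_digraph \<Rightarrow> ('a \<Rightarrow> nat) \<Rightarrow> bool" where
  "chain_map G f \<longleftrightarrow> (\<forall>u\<in>pverts G. \<forall>v\<in>pverts G. u \<noteq> v \<longrightarrow> f u \<le> f v \<longrightarrow>
    ((u, v) \<in> parcs G \<longleftrightarrow> \<not> (even (f u) \<and> odd (f v))))"

lemma chain_map_list:
  assumes G: "pair_graph G" and f: "chain_map G f"
  obtains vs where "chain_list G (\<lambda>v. even (f v)) vs" "sorted (map f vs)"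
proof -
  obtain us where us: "distinct us" "set us = pverts G"
    using finite_distinct_list[OF pair_graph_finite[OF G]] by blast
  let ?vs = "sort_key f us"
  have s: "sorted_wrt (\<lambda>u v. f u \<le> f v) ?vs" using sorted_sort_key[of f us] by (simp add: sorted_map)
  have d: "distinct ?vs" "set ?vs = pverts G" using us by auto
  have "sorted_wrt (\<lambda>u v. (u, v) \<in> parcs G \<longleftrightarrow> \<not> (even (f u) \<and> \<not> even (f v))) ?vs"
    unfolding sorted_wrt_iff_nth_less
  proof (intro allI impI)
    fix i j assume ij: "i < j" "j < length ?vs"
    then have "f (?vs ! i) \<le> f (?vs ! j)" "?vs ! i \<noteq> ?vs ! j" "?vs ! i \<in> pverts G" "?vs ! j \<in> pverts G"
      using s d unfolding sorted_wrt_iff_nth_less d(2)[symmetric]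
      by (auto simp: nth_eq_iff_index_eq simp del: set_sort)
    then show "((?vs ! i, ?vs ! j) \<in> parcs G) = (\<not> (even (f (?vs ! i)) \<and> \<not> even (f (?vs ! j))))"
      using f unfolding chain_map_def by blast
  qed
  with d have "chain_list G (\<lambda>v. even (f v)) ?vs" by (simp add: chain_list_def)
  then show thesis using that sorted_sort_key by blast
qed

lemma sorted_le_2:
  "sorted ns \<Longrightarrow> \<forall>n\<in>set ns. n \<le> 2 \<Longrightarrow>
    \<exists>a b c. ns = replicate a 0 @ replicate b 1 @ replicate c (2::nat)"
proof (induction ns)
  case Nil
  then show ?case by (intro exI[of _ 0]) simp
next
  case (Cons n ns)
  then obtain a b c where ns: "ns = replicate a 0 @ replicate b 1 @ replicate c (2::nat)" by auto
  consider "n = 0" | "n = 1" | "n = 2" using Cons.prems(2) by fastforce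
  then show ?case
  proof cases
    case 1
    then show ?thesis using ns by (intro exI[of _ "Suc a"] exI[of _ b] exI[of _ c]) simp
  next
    case 2
    then have "a = 0" using Cons.prems(1) ns by (cases a) auto
    then show ?thesis using ns 2 by (intro exI[of _ 0] exI[of _ "Suc b"] exI[of _ c]) simp
  next
    case 3
    then have "a = 0" "b = 0" using Cons.prems(1) ns by (cases a; cases b; auto)+
    then show ?thesis using ns 3 by (intro exI[of _ 0] exI[of _ 0] exI[of _ "Suc c"]) simp
  qed
qed

lemma act_replicate:
  "act (replicate a True) (x, y) = (x, y - a * x)" "act (replicate a False) (x, y) = (x + a * y, y)"
  by (induction a arbitrary: x y) (simp_all add: algebra_simps)

text \<open>With at most three blocks the word is a run of True, a run of False and a run of True.
  Comparing the action on the two unit vectors leaves only the word True, False, which has two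
  letters.\<close>

lemma chain_blocks_ge_4:
  assumes G: "pair_graph G" and f: "chain_map G f" and nul: "2 \<le> nullity G"
    and n: "card (pverts G) \<ge> 3" and img: "f ` pverts G = {..<k}"
  shows "k \<ge> 4"
proof (rule ccontr)
  assume k: "\<not> ?thesis"
  obtain vs where vs: "chain_list G (\<lambda>v. even (f v)) vs" "sorted (map f vs)"
    using chain_map_list[OF G f] by blast
  have "\<forall>m\<in>set (map f vs). m \<le> 2" using img k vs(1) by (auto simp: chain_list_def)
  from sorted_le_2[OF vs(2) this] obtain a b c where
    abc: "map f vs = replicate a 0 @ replicate b 1 @ replicate c 2" by blast
  have "map (\<lambda>v. even (f v)) vs = map even (map f vs)" by simp
  then have w: "map (\<lambda>v. even (f v)) vs = replicate a True @ replicate b False @ replicate c True"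
    unfolding abc by simp
  have R: "act (replicate a True @ replicate b False @ replicate c True) (x, y) = (y, y - x)" for x y
    using chain_nullity_2_act[OF G vs(1) nul] unfolding w by simp
  have "real b = 1" "real c = 0" "real a = 1"
    using R[of 0 1] R[of 1 0] by (auto simp: act_append act_replicate)
  then have "a + b + c = 2" by simp
  moreover have "length vs = a + b + c" using arg_cong[OF abc, of length] by simp
  moreover have "length vs = card (pverts G)" using vs(1) distinct_card by (fastforce simp: chain_list_def)
  ultimately show False using n by simp
qed

section \<open>The graphs \<open>G_graph k\<close> with vertices replaced by cliques\<close>

text \<open>The interleaved order \<open>v_1\<close>, \<open>w_K\<close>, \<open>v_2\<close>,
  \<open>w_(K-1)\<close>, ... with \<open>K = k div 2\<close>, numbered from 0. In this order
  \<open>v_i\<close> and \<open>w_j\<close> are adjacent exactly when \<open>w_j\<close> comes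
  first, so \<open>G_graph k\<close> is the chain graph of the alternating word of length
  \<open>k\<close>.\<close>

definition block_of :: "nat \<Rightarrow> nat + nat \<Rightarrow> nat" where
  "block_of k u = (case u of Inl i \<Rightarrow> 2 * (i - 1) | Inr j \<Rightarrow> 2 * (k div 2 - j) + 1)"

definition vertex_of :: "nat \<Rightarrow> nat \<Rightarrow> nat + nat" where
  "vertex_of k m = (if even m then Inl (m div 2 + 1) else Inr (k div 2 - m div 2))"

lemma vertex_of_in: "m < k \<Longrightarrow> vertex_of k m \<in> pverts (G_graph k)"
  by (cases "even m") (auto simp: vertex_of_def G_graph_def Let_def elim!: evenE oddE)

lemma block_of_vertex_of: "m < k \<Longrightarrow> block_of k (vertex_of k m) = m"
  by (cases "even m") (auto simp: vertex_of_def block_of_def elim!: evenE oddE)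

lemma vertex_of_block_of: "u \<in> pverts (G_graph k) \<Longrightarrow> vertex_of k (block_of k u) = u"
  by (cases u) (auto simp: vertex_of_def block_of_def G_graph_def Let_def)

lemma block_of_less: "u \<in> pverts (G_graph k) \<Longrightarrow> block_of k u < k"
  by (cases u) (auto simp: block_of_def G_graph_def Let_def)

lemma pverts_lex_cliques: "pverts (lex_cliques F c) = Sigma (pverts F) (\<lambda>u. {..<c u})"
  by (auto simp: lex_cliques_def Let_def)

lemma finite_G_graph: "finite (pverts (G_graph k))"
  by (simp add: G_graph_def Let_def)

lemma card_lex_cliques: "card (pverts (lex_cliques (G_graph k) c)) = (\<Sum>u\<in>pverts (G_graph k). c u)"
  unfolding pverts_lex_cliques by (subst card_SigmaI) (auto simp: finite_G_graph)

lemma G_graph_arcs: "(u, v) \<in> parcs (G_graph k) \<Longrightarrow> (v, u) \<in> parcs (G_graph k)" "(u, u) \<notin> parcs (G_graph k)"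
  by (auto simp: G_graph_def Let_def)

lemma pair_graph_lex_cliques: "pair_graph (lex_cliques (G_graph k) c)"
proof (rule pair_graphI)
  show "finite (pverts (lex_cliques (G_graph k) c))"
    unfolding pverts_lex_cliques by (simp add: finite_G_graph)
qed (auto simp: lex_cliques_def Let_def G_graph_arcs)

lemma chain_map_lex_cliques: "chain_map (lex_cliques (G_graph k) c) (\<lambda>x. block_of k (fst x))"
  unfolding chain_map_def
proof (intro ballI impI)
  fix x y assume xy: "x \<in> pverts (lex_cliques (G_graph k) c)" "y \<in> pverts (lex_cliques (G_graph k) c)"
    "x \<noteq> y" "block_of k (fst x) \<le> block_of k (fst y)"
  obtain u a v b where uv: "x = (u, a)" "y = (v, b)" by (cases x; cases y)
  have in_V: "u \<in> pverts (G_graph k)" "v \<in> pverts (G_graph k)" "a < c u" "b < c v"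
    using xy(1,2) unfolding uv pverts_lex_cliques by auto
  have "(x, y) \<in> parcs (lex_cliques (G_graph k) c) \<longleftrightarrow> (u, v) \<in> parcs (G_graph k) \<or> u = v"
    using xy(3) in_V unfolding uv by (auto simp: lex_cliques_def Let_def)
  also have "\<dots> \<longleftrightarrow> \<not> (even (block_of k u) \<and> odd (block_of k v))"
    using in_V xy(4) unfolding uv
    by (cases u; cases v) (auto simp: G_graph_def Let_def block_of_def cross_adjacent_def)
  finally show "(x, y) \<in> parcs (lex_cliques (G_graph k) c) \<longleftrightarrow>
      \<not> (even (block_of k (fst x)) \<and> odd (block_of k (fst y)))" by (simp add: uv)
qed

lemma chain_map_iso_lex_cliques:
  assumes G: "pair_graph G" and f: "chain_map G f" and img: "f ` pverts G = {..<k}"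
  obtains c h where "\<forall>u\<in>pverts (G_graph k). c u \<ge> 1"
    "graph_iso h G (lex_cliques (G_graph k) c)"
proof -
  define F where "F u = {v \<in> pverts G. vertex_of k (f v) = u}" for u
  define c where "c u = card (F u)" for u
  have fin: "finite (F u)" for u using pair_graph_finite[OF G] by (simp add: F_def)
  have "\<forall>u. \<exists>g. bij_betw g (F u) {..<c u}"
    using finite_same_card_bij[OF fin finite_lessThan] by (simp add: c_def)
  then obtain g where g: "\<And>u. bij_betw (g u) (F u) {..<c u}" by metis
  define h where "h v = (vertex_of k (f v), g (vertex_of k (f v)) v)" for v
  let ?L = "lex_cliques (G_graph k) c"
  have fk: "f v < k" if "v \<in> pverts G" for v using img that by blast
  have blk: "block_of k (fst (h v)) = f v" if "v \<in> pverts G" for v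
    using block_of_vertex_of fk[OF that] by (simp add: h_def)
  have inj: "inj_on h (pverts G)"
  proof (rule inj_onI)
    fix u v assume uv: "u \<in> pverts G" "v \<in> pverts G" "h u = h v"
    then have "u \<in> F (vertex_of k (f u))" "v \<in> F (vertex_of k (f u))" "g (vertex_of k (f u)) u = g (vertex_of k (f u)) v"
      by (auto simp: h_def F_def)
    then show "u = v" using g[of "vertex_of k (f u)"] unfolding bij_betw_def by (meson inj_onD)
  qed
  have "h ` pverts G = pverts ?L"
  proof (intro equalityI subsetI)
    fix x assume "x \<in> h ` pverts G"
    then obtain v where v: "v \<in> pverts G" "x = h v" by blast
    then have "v \<in> F (vertex_of k (f v))" by (simp add: F_def)
    then have "g (vertex_of k (f v)) v < c (vertex_of k (f v))" using g bij_betwE by blast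
    then show "x \<in> pverts ?L" using v vertex_of_in[OF fk] by (simp add: h_def pverts_lex_cliques)
  next
    fix x assume "x \<in> pverts ?L"
    then obtain u a where x: "x = (u, a)" "u \<in> pverts (G_graph k)" "a < c u"
      by (auto simp: pverts_lex_cliques)
    then have "a \<in> g u ` F u" using bij_betw_imp_surj_on[OF g[of u]] by simp
    then obtain v where "v \<in> F u" "g u v = a" by blast
    then show "x \<in> h ` pverts G" using x by (auto simp: F_def h_def)
  qed
  with inj have bij: "bij_betw h (pverts G) (pverts ?L)" by (simp add: bij_betw_def)
  have arcs: "(u, v) \<in> parcs G \<longleftrightarrow> (h u, h v) \<in> parcs ?L"
    if uv: "u \<in> pverts G" "v \<in> pverts G" "f u \<le> f v" "u \<noteq> v" for u v
  proof -
    have "h u \<noteq> h v" "h u \<in> pverts ?L" "h v \<in> pverts ?L"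
      using uv inj bij_betwE[OF bij] by (auto dest: inj_onD)
    then show ?thesis
      using uv blk f chain_map_lex_cliques[of k c] unfolding chain_map_def by metis
  qed
  have "(u, v) \<in> parcs G \<longleftrightarrow> (h u, h v) \<in> parcs ?L" if uv: "u \<in> pverts G" "v \<in> pverts G" for u v
  proof (cases "u = v")
    case True
    then show ?thesis using pair_graph_irrefl[OF G] pair_graph_irrefl[OF pair_graph_lex_cliques] by metis
  next
    case False
    then show ?thesis
      using arcs[of u v] arcs[of v u] uv pair_graph_sym[OF G] pair_graph_sym[OF pair_graph_lex_cliques]
      by (metis linorder_le_cases)
  qed
  with bij have "graph_iso h G ?L" by (simp add: graph_iso_def)
  moreover have "c u \<ge> 1" if "u \<in> pverts (G_graph k)" for u
  proof -
    have "block_of k u \<in> f ` pverts G" using block_of_less[OF that] img by simp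
    then obtain v where "v \<in> pverts G" "f v = block_of k u" by force
    then have "v \<in> F u" using vertex_of_block_of[OF that] by (simp add: F_def)
    then have "card (F u) \<noteq> 0" using fin[of u] by auto
    then show ?thesis by (simp add: c_def)
  qed
  ultimately show thesis using that by blast
qed

text \<open>One vertex from each of the cliques for \<open>v_1\<close>, \<open>v_2\<close>,
  \<open>w_b\<close> and \<open>w_1\<close> gives an induced path on four vertices;
  \<open>k \<ge> 4\<close> makes \<open>w_1\<close> and \<open>w_b\<close> distinct. The indicators
  of its two end edges span a positive plane.\<close>

lemma lex_cliques_index_ge_2:
  assumes k: "k \<ge> 4" and c: "\<And>u. u \<in> pverts (G_graph k) \<Longrightarrow> c u \<ge> 1"
  shows "sgn_index 1 (lex_cliques (G_graph k) c) \<ge> 2"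
proof -
  let ?L = "lex_cliques (G_graph k) c"
  define b where "b = k div 2"
  have b: "b \<ge> 2" "b \<le> (k + 1) div 2" using k by (auto simp: b_def)
  define p q r s where "p = (Inl 1 :: nat + nat, 0 :: nat)" and "q = (Inl 2 :: nat + nat, 0 :: nat)"
    and "r = (Inr 1 :: nat + nat, 0 :: nat)" and "s = (Inr b :: nat + nat, 0 :: nat)"
  note defs = p_def q_def r_def s_def
  have V: "{p, q, r, s} \<subseteq> pverts ?L"
  proof -
    have "{fst p, fst q, fst r, fst s} \<subseteq> pverts (G_graph k)"
      using b by (auto simp: defs G_graph_def Let_def b_def)
    then show ?thesis using c unfolding pverts_lex_cliques by (auto simp: defs dest!: c)
  qed
  have dist: "p \<noteq> q" "p \<noteq> r" "p \<noteq> s" "q \<noteq> r" "q \<noteq> s" "r \<noteq> s" "q \<noteq> p" "r \<noteq> p" "s \<noteq> p" "r \<noteq> q" "s \<noteq> q" "s \<noteq> r"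
    using b by (auto simp: defs)
  have arc: "(x, y) \<in> parcs ?L \<longleftrightarrow> (fst x, fst y) \<in> parcs (G_graph k) \<or> fst x = fst y \<and> snd x \<noteq> snd y"
    if "x \<in> {p, q, r, s}" "y \<in> {p, q, r, s}" for x y
  proof -
    have "x \<in> pverts ?L" "y \<in> pverts ?L" using V that by auto
    then show ?thesis by (auto simp: lex_cliques_def Let_def)
  qed
  have E: "(p, q) \<in> parcs ?L" "(r, s) \<in> parcs ?L" "(q, s) \<in> parcs ?L" "(p, r) \<notin> parcs ?L" "(p, s) \<notin> parcs ?L"
    "(q, r) \<notin> parcs ?L"
    using b by (simp_all add: arc) (auto simp: defs G_graph_def Let_def b_def cross_adjacent_def)
  then have E': "(q, p) \<in> parcs ?L" "(s, r) \<in> parcs ?L" "(s, q) \<in> parcs ?L" "(r, p) \<notin> parcs ?L" "(s, p) \<notin> parcs ?L"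
    "(r, q) \<notin> parcs ?L"
    using pair_graph_sym[OF pair_graph_lex_cliques] by blast+
  define g where "g = (\<lambda>i::nat. \<lambda>x. if i = 0 then (if x = p \<or> x = q then 1 else 0 :: real)
    else (if x = r \<or> x = s then 1 else 0))"
  have "definite_family 1 ?L 2 g"
    unfolding definite_family_def
  proof (intro allI impI)
    fix d :: "nat \<Rightarrow> real" assume "\<exists>i<2. d i \<noteq> 0"
    then have nz: "d 0 \<noteq> 0 \<or> d 1 \<noteq> 0" by (metis less_2_cases One_nat_def)
    define z where "z = (\<lambda>v. \<Sum>i<2. d i * g i v)"
    have z_eq: "z v = d 0 * g 0 v + d 1 * g 1 v" for v by (simp add: z_def numeral_2_eq_2)
    have z: "z p = d 0" "z q = d 0" "z r = d 1" "z s = d 1" "\<And>w. w \<notin> {p, q, r, s} \<Longrightarrow> z w = 0"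
      using dist unfolding z_eq by (simp_all add: g_def)
    have "qform ?L z = (\<Sum>u\<in>{p, q, r, s}. \<Sum>v\<in>{p, q, r, s}. adj ?L u v * z u * z v)"
      by (rule qform_support) (use V z pair_graph_finite[OF pair_graph_lex_cliques] in auto)
    also have "\<dots> = (d 0)\<^sup>2 + (d 1)\<^sup>2 + (d 0 + d 1)\<^sup>2"
      using dist E E' by (simp add: adj_def z pair_graph_irrefl[OF pair_graph_lex_cliques] algebra_simps power2_eq_square)
    finally have qq: "qform ?L z = (d 0)\<^sup>2 + (d 1)\<^sup>2 + (d 0 + d 1)\<^sup>2" .
    have "(d 0)\<^sup>2 + (d 1)\<^sup>2 > 0" unfolding sum_power2_gt_zero_iff by (rule nz)
    then have "qform ?L z > 0" unfolding qq using zero_le_power2[of "d 0 + d 1"] by linarith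
    then show "0 < 1 * qform ?L (\<lambda>v. \<Sum>i<2. d i * g i v)" by (simp add: z_def)
  qed
  then show ?thesis by (intro definite_family_le[OF pair_graph_lex_cliques]) auto
qed

text \<open>Induction by removing a vertex that may stand last: one of \<open>B\<close> seen by no
  vertex of \<open>A\<close>, or one of \<open>A\<close> seeing all of \<open>B\<close>. The vertex
  \<open>v0\<close> sees nothing in \<open>B\<close> and is never removed, so the numbering can
  start with an even block.\<close>

lemma nested_cliques_chain:
  assumes "finite (A \<union> B)" "A \<inter> B = {}" "v0 \<in> A" "\<And>b. b \<in> B \<Longrightarrow> \<not> E v0 b"
    and nested: "\<And>a a' b b'. a \<in> A \<Longrightarrow> a' \<in> A \<Longrightarrow> b \<in> B \<Longrightarrow> b' \<in> B \<Longrightarrow>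
      E a b \<Longrightarrow> \<not> E a' b \<Longrightarrow> E a' b' \<Longrightarrow> E a b'"
  shows "\<exists>f k. f ` (A \<union> B) = {..<k::nat} \<and> (\<forall>a\<in>A. even (f a)) \<and> (\<forall>b\<in>B. odd (f b)) \<and>
    (\<forall>a\<in>A. \<forall>b\<in>B. E a b \<longleftrightarrow> f b < f a)"
  using assms
proof (induction "card (A \<union> B)" arbitrary: A B rule: less_induct)
  case less
  note fin = less.prems(1) and disj = less.prems(2) and v0 = less.prems(3,4) and nested = less.prems(5)
  have finA: "finite A" "finite B" using fin by auto
  show ?case
  proof (cases "A = {v0} \<and> B = {}")
    case True
    then show ?thesis by (intro exI[of _ "\<lambda>_. 0"] exI[of _ 1]) auto
  next
    case False
    have "\<exists>t. t \<in> B \<and> (\<forall>a\<in>A. \<not> E a t) \<or> t \<in> A \<and> t \<noteq> v0 \<and> (\<forall>b\<in>B. E t b)"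
    proof (cases "A = {v0}")
      case True
      with False obtain t where "t \<in> B" by auto
      then show ?thesis using True v0 by auto
    next
      case False
      \<comment> \<open>Take \<open>a\<close> with the most neighbours in \<open>B\<close>. If it
        misses some \<open>t\<close>, a vertex \<open>a'\<close> that sees \<open>t\<close> would by
        nestedness see strictly more than \<open>a\<close>; so nobody sees \<open>t\<close>.\<close>
      define N where "N a = card {b \<in> B. E a b}" for a
      have "finite (N ` (A - {v0}))" "N ` (A - {v0}) \<noteq> {}" using False v0 finA by auto
      note Max_in[OF this] and Max_ge[OF this(1)]
      then obtain a where "a \<in> A - {v0}" "Max (N ` (A - {v0})) = N a"
        and max: "\<And>m. m \<in> N ` (A - {v0}) \<Longrightarrow> m \<le> Max (N ` (A - {v0}))" by blast
      then have a: "a \<in> A - {v0}" "\<And>a'. a' \<in> A - {v0} \<Longrightarrow> N a' \<le> N a" by force+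
      show ?thesis
      proof (cases "\<forall>b\<in>B. E a b")
        case True
        then show ?thesis using a by blast
      next
        case False
        then obtain t where t: "t \<in> B" "\<not> E a t" by blast
        have "\<not> E a' t" if a': "a' \<in> A" for a'
        proof
          assume E: "E a' t"
          then have "a' \<noteq> v0" using v0(2) t by auto
          moreover have "{b \<in> B. E a b} \<subset> {b \<in> B. E a' b}"
            using nested[OF a' _ t(1) _ E t(2)] a(1) t E by blast
          then have "N a < N a'" unfolding N_def using finA by (intro psubset_card_mono) auto
          ultimately show False using a(2)[of a'] a' by auto
        qed
        then show ?thesis using t by blast
      qed
    qed
    then obtain t where t: "t \<in> B \<and> (\<forall>a\<in>A. \<not> E a t) \<or> t \<in> A \<and> t \<noteq> v0 \<and> (\<forall>b\<in>B. E t b)" by blast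
    let ?A = "A - {t}" and ?B = "B - {t}"
    have tS: "t \<in> A \<union> B" "t \<noteq> v0" using t disj v0 by auto
    have S: "A \<union> B = insert t (?A \<union> ?B)" using tS by auto
    have "card (?A \<union> ?B) < card (A \<union> B)" using tS fin by (intro psubset_card_mono) auto
    moreover have "\<And>b. b \<in> ?B \<Longrightarrow> \<not> E v0 b" using v0 by blast
    moreover have "\<And>a a' b b'. a \<in> ?A \<Longrightarrow> a' \<in> ?A \<Longrightarrow> b \<in> ?B \<Longrightarrow> b' \<in> ?B \<Longrightarrow>
      E a b \<Longrightarrow> \<not> E a' b \<Longrightarrow> E a' b' \<Longrightarrow> E a b'" using nested by blast
    ultimately obtain f k where f: "f ` (?A \<union> ?B) = {..<k::nat}" "\<forall>a\<in>?A. even (f a)" "\<forall>b\<in>?B. odd (f b)"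
      "\<forall>a\<in>?A. \<forall>b\<in>?B. E a b \<longleftrightarrow> f b < f a"
      using less.hyps[of ?A ?B] fin disj v0(1) tS(2) by blast
    have lt: "f x < k" if "x \<in> ?A \<union> ?B" for x using f(1) that by blast
    have "v0 \<in> ?A \<union> ?B" using v0 tS by auto
    with lt have k: "k > 0" by fastforce
    \<comment> \<open>\<open>t\<close> joins the last block if the parity fits and opens a new block
      otherwise, so the values still form an initial segment.\<close>
    define m where "m = (if even (k - 1) \<longleftrightarrow> t \<in> A then k - 1 else k)"
    have m: "even m \<longleftrightarrow> t \<in> A" "m = k - 1 \<or> m = k" using k by (auto simp: m_def)
    define g where "g = f(t := m)"
    have g: "g t = m" "\<And>x. x \<noteq> t \<Longrightarrow> g x = f x" by (auto simp: g_def)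
    have "g ` (?A \<union> ?B) = f ` (?A \<union> ?B)" by (intro image_cong) (auto simp: g)
    then have "g ` (A \<union> B) = insert m {..<k}" unfolding S by (simp add: g f(1))
    also have "\<dots> = {..<max k (m + 1)}" using m(2) k by auto
    finally have img: "g ` (A \<union> B) = {..<max k (m + 1)}" .
    have evA: "even (g a)" if "a \<in> A" for a using f(2) m(1) g that by (cases "a = t") auto
    have oddB: "odd (g b)" if "b \<in> B" for b using f(3) m(1) g that disj by (cases "b = t") auto
    have "E a b \<longleftrightarrow> g b < g a" if ab: "a \<in> A" "b \<in> B" for a b
    proof -
      consider "a = t" "b \<noteq> t" | "a \<noteq> t" "b = t" | "a \<noteq> t" "b \<noteq> t" using ab disj by blast
      then show ?thesis
      proof cases
        case 1
        then have "E a b" using t ab disj by blast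
        moreover have "g b < k" using lt[of b] ab 1 g by auto
        moreover have "g b \<noteq> g a" using evA[OF ab(1)] oddB[OF ab(2)] by auto
        moreover have "g a = k - 1 \<or> g a = k" using m(2) 1 g by simp
        ultimately show ?thesis by linarith
      next
        case 2
        then have "\<not> E a b" using t ab disj by blast
        moreover have "g a < k" using lt[of a] ab 2 g by auto
        ultimately show ?thesis using m(2) 2 g by auto
      next
        case 3
        then show ?thesis using f(4) ab g by auto
      qed
    qed
    with img evA oddB show ?thesis by blast
  qed
qed

text \<open>A vertex of minimum degree and its neighbours form a clique, and so do the remaining vertices.\<close>

lemma chain_map_exists:
  assumes G: "pair_graph G" and V: "pverts G \<noteq> {}" and p: "sgn_index 1 G \<le> 2"
    and no3: "\<And>a b c. \<not> indep3 G a b c" and no4: "\<And>u v x y. \<not> induced_C4 G u v x y"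
  shows "\<exists>f k. chain_map G f \<and> f ` pverts G = {..<k}"
proof -
  let ?V = "pverts G"
  note sym = pair_graph_sym[OF G] and irr = pair_graph_irrefl[OF G] and inV = pair_graph_verts[OF G]
  have fin: "finite ?V" by (rule pair_graph_finite[OF G])
  define deg where "deg v = card (nbhd G v)" for v
  have fin_nb: "finite (nbhd G v)" for v
    by (rule finite_subset[OF _ fin]) (auto simp: nbhd_def dest: inV)
  obtain v0 where v0: "v0 \<in> ?V" "\<And>v. v \<in> ?V \<Longrightarrow> deg v0 \<le> deg v"
    using arg_min_if_finite[OF fin V, of deg] linorder_not_less by blast
  define X where "X = nbhd G v0"
  define B where "B = ?V - insert v0 X"
  have X: "X \<subseteq> ?V" "v0 \<notin> X" using inV irr by (auto simp: X_def nbhd_def)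
  have v0x: "(v0, x) \<in> parcs G" "(x, v0) \<in> parcs G" if "x \<in> X" for x
    using that sym[of v0 x] by (auto simp: X_def nbhd_def)
  have v0b: "(v0, b) \<notin> parcs G" "(b, v0) \<notin> parcs G" if "b \<in> B" for b
    using that sym[of v0 b] by (auto simp: B_def X_def nbhd_def)
  have cliqueB: "(b, b') \<in> parcs G" if "b \<in> B" "b' \<in> B" "b \<noteq> b'" for b b'
    using no3[of v0 b b'] that v0 v0b unfolding indep3_def B_def by auto
  have cliqueX: "(x, x') \<in> parcs G" if x: "x \<in> X" "x' \<in> X" "x \<noteq> x'" for x x'
  proof (rule ccontr)
    assume n: "(x, x') \<notin> parcs G"
    then have n': "(x', x) \<notin> parcs G" using sym by blast
    have one: "(b, x) \<in> parcs G \<longleftrightarrow> (b, x') \<notin> parcs G" if b: "b \<in> B" for b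
    proof -
      have "b \<in> ?V" "b \<noteq> v0" "b \<noteq> x" "b \<noteq> x'" using b x by (auto simp: B_def)
      then have "\<not> ((b, x) \<notin> parcs G \<and> (b, x') \<notin> parcs G)"
        using no3[of b x x'] n x X unfolding indep3_def by auto
      moreover have "\<not> ((b, x) \<in> parcs G \<and> (b, x') \<in> parcs G)"
        using no4[of v0 x b x'] x X v0 v0x v0b[OF b] n sym[of b x] \<open>b \<in> ?V\<close> \<open>b \<noteq> v0\<close> \<open>b \<noteq> x\<close> \<open>b \<noteq> x'\<close>
        unfolding induced_C4_def by auto
      ultimately show ?thesis by blast
    qed
    \<comment> \<open>Here minimality of the degree enters: if \<open>y\<close> sees nothing in
      \<open>B\<close>, its neighbours are \<open>v0\<close> and vertices of \<open>X\<close> other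
      than \<open>y\<close> and \<open>y'\<close>, which are fewer than \<open>card X\<close>, the
      degree of \<open>v0\<close>.\<close>
    have small: False if y: "y \<in> X" "y' \<in> X" "y \<noteq> y'" "(y, y') \<notin> parcs G" "\<And>b. b \<in> B \<Longrightarrow> (b, y) \<notin> parcs G" for y y'
    proof -
      have "nbhd G y \<subseteq> insert v0 (X - {y, y'})"
        using y inV irr sym unfolding B_def nbhd_def by blast
      then have "card (nbhd G y) \<le> card (insert v0 (X - {y, y'}))"
        using fin_nb[of v0] by (intro card_mono) (auto simp: X_def)
      also have "\<dots> \<le> Suc (card (X - {y, y'}))" by (rule card_insert_le_m1) auto
      also have "\<dots> < card X"
      proof -
        have "card (X - {y, y'}) = card X - 2" using y fin_nb[of v0] by (subst card_Diff_subset) (auto simp: X_def)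
        moreover have "card {y, y'} \<le> card X" using y fin_nb[of v0] by (intro card_mono) (auto simp: X_def)
        ultimately show ?thesis using y by simp
      qed
      finally show False using v0(2)[of y] y X by (auto simp: deg_def X_def)
    qed
    obtain b where b: "b \<in> B" "(b, x) \<in> parcs G" using small[of x x'] x n by blast
    obtain b' where b': "b' \<in> B" "(b', x') \<in> parcs G" using small[of x' x] x n' by blast
    have nb: "(b, x') \<notin> parcs G" "(b', x) \<notin> parcs G" using one b b' by auto
    \<comment> \<open>Both \<open>x\<close> and \<open>x'\<close> have neighbours in
      \<open>B\<close>, but no common ones, so these five vertices form an induced 5-cycle, which
      has too many positive eigenvalues.\<close>
    have "distinct [v0, x, b, b', x']" "{v0, x, b, b', x'} \<subseteq> ?V"
      using b b' nb x X v0 by (auto simp: B_def)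
    moreover have "(b, b') \<in> parcs G" using b b' nb cliqueB by metis
    ultimately show False
      using no_induced_C5[OF G p, of v0 x b b' x'] b b' nb v0x x v0b sym n by metis
  qed
  let ?A = "insert v0 X"
  have part: "?A \<union> B = ?V" "?A \<inter> B = {}" using X v0 by (auto simp: B_def)
  have cliqueA: "(a, a') \<in> parcs G" if "a \<in> ?A" "a' \<in> ?A" "a \<noteq> a'" for a a'
    using that cliqueX v0x by blast
  have "\<exists>f k. f ` (?A \<union> B) = {..<k::nat} \<and> (\<forall>a\<in>?A. even (f a)) \<and> (\<forall>b\<in>B. odd (f b)) \<and>
    (\<forall>a\<in>?A. \<forall>b\<in>B. (a, b) \<in> parcs G \<longleftrightarrow> f b < f a)"
  proof (rule nested_cliques_chain)
    show "finite (?A \<union> B)" unfolding part by (rule fin)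
    fix a a' b b' assume *: "a \<in> ?A" "a' \<in> ?A" "b \<in> B" "b' \<in> B" "(a, b) \<in> parcs G" "(a', b) \<notin> parcs G" "(a', b') \<in> parcs G"
    show "(a, b') \<in> parcs G"
    \<comment> \<open>A failure of nestedness closes up to an induced 4-cycle, since both sides are
      cliques.\<close>
    proof (rule ccontr)
      assume n: "(a, b') \<notin> parcs G"
      then have ne: "a \<noteq> a'" "b \<noteq> b'" using * by auto
      have "(a', b) \<notin> parcs G" "(b, a') \<notin> parcs G" "(b', a') \<in> parcs G" using * sym by blast+
      moreover have "{a, a', b, b'} \<subseteq> ?V" "distinct [a, b, b', a']" using * ne part by auto
      ultimately have "induced_C4 G a b b' a'"
        unfolding induced_C4_def using * ne n cliqueA[of a' a] cliqueB[of b b'] by auto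
      then show False using no4 by blast
    qed
  qed (use part(2) v0b in auto)
  then obtain f k where f: "f ` (?A \<union> B) = {..<k::nat}" "\<forall>a\<in>?A. even (f a)" "\<forall>b\<in>B. odd (f b)"
    "\<forall>a\<in>?A. \<forall>b\<in>B. (a, b) \<in> parcs G \<longleftrightarrow> f b < f a" by (elim exE conjE)
  have "chain_map G f"
    unfolding chain_map_def
  proof (intro ballI impI)
    fix u v assume uv: "u \<in> ?V" "v \<in> ?V" "u \<noteq> v" "f u \<le> f v"
    have AB: "f a \<noteq> f b" if "a \<in> ?A" "b \<in> B" for a b using f(2,3) that by metis
    consider "u \<in> ?A" "v \<in> ?A" | "u \<in> ?A" "v \<in> B" | "u \<in> B" "v \<in> ?A" | "u \<in> B" "v \<in> B"
      using uv part by blast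
    then show "(u, v) \<in> parcs G \<longleftrightarrow> \<not> (even (f u) \<and> odd (f v))"
    proof cases
      case 1
      then have "even (f v)" using f(2) by blast
      then show ?thesis using cliqueA[OF 1 uv(3)] by blast
    next
      case 2
      then have "even (f u)" "odd (f v)" "(u, v) \<notin> parcs G" using f(2-4) uv(4) by (auto simp: not_less)
      then show ?thesis by blast
    next
      case 3
      then have "odd (f u)" "f u < f v" using f(3) uv(4) AB[OF 3(2,1)] by auto
      moreover from this have "(v, u) \<in> parcs G" using f(4) 3 by blast
      ultimately show ?thesis using sym[of u v] by blast
    next
      case 4
      then have "odd (f u)" using f(3) by blast
      then show ?thesis using cliqueB[OF 4 uv(3)] by blast
    qed
  qed
  with f(1) show ?thesis unfolding part(1) by blast
qed

lemma no_congruent_chain_map: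
  assumes G: "pair_graph G" and V: "pverts G \<noteq> {}" and p: "sgn_index 1 G = 2"
    and iso: "\<And>v. v \<in> pverts G \<Longrightarrow> nbhd G v \<noteq> {}" and nc: "\<And>u. \<not> congruent G u"
  shows "\<exists>f k. chain_map G f \<and> f ` pverts G = {..<k}"
proof -
  have no3: "\<not> indep3 G a b c" for a b c
    using indep3_congruent[OF G p _ iso] nc by blast
  have "\<not> induced_C4 G u v x y" for u v x y
    using induced_C4_congruent[OF G p _ no3] nc by blast
  then show ?thesis using chain_map_exists[OF G V] p no3 by simp
qed

section \<open>Connectedness\<close>

lemma connected_iff_rtrancl:
  assumes G: "pair_graph G"
  shows "Digraph_Component.connected (with_proj G) \<longleftrightarrow>
    pverts G \<noteq> {} \<and> (\<forall>u\<in>pverts G. \<forall>v\<in>pverts G. (u, v) \<in> (parcs G)\<^sup>*)"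
proof -
  have mk: "mk_symmetric (with_proj G) = G"
  proof -
    have "(\<Union>e\<in>parcs G. {(fst e, snd e), (snd e, fst e)}) = parcs G"
      using pair_graph_sym[OF G] by auto
    then show ?thesis by (simp add: mk_symmetric_def)
  qed
  have "reachable (with_proj G) u v \<longleftrightarrow> (u, v) \<in> (parcs G)\<^sup>*" if "u \<in> pverts G" for u v
  proof -
    have "(u, v) \<in> rtrancl_on (pverts G) (parcs G) \<longleftrightarrow> (u, v) \<in> (parcs G)\<^sup>*"
    proof
      assume "(u, v) \<in> (parcs G)\<^sup>*"
      then show "(u, v) \<in> rtrancl_on (pverts G) (parcs G)"
      proof (induction rule: rtrancl_induct)
        case base
        show ?case using that by (rule rtrancl_on_refl)
      next
        case (step y z)
        then show ?case using pair_graph_verts[OF G step(2)] by (meson rtrancl_on_into_rtrancl_on)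
      qed
    qed (rule rtrancl_on_rtranclI)
    then show ?thesis by (simp add: reachable_def)
  qed
  then show ?thesis unfolding connected_def mk strongly_connected_def by auto
qed

lemma connected_nbhd:
  assumes G: "pair_graph G" and conn: "Digraph_Component.connected (with_proj G)"
    and n: "card (pverts G) \<ge> 2" and v: "v \<in> pverts G"
  shows "nbhd G v \<noteq> {}"
proof -
  have "\<exists>u\<in>pverts G. u \<noteq> v"
  proof (rule ccontr)
    assume "\<not> ?thesis"
    then have "pverts G \<subseteq> {v}" by blast
    then show False using card_mono[of "{v}" "pverts G"] n by simp
  qed
  then obtain u where "u \<in> pverts G" "u \<noteq> v" by blast
  then have "(v, u) \<in> (parcs G)\<^sup>*" "v \<noteq> u" using conn v connected_iff_rtrancl[OF G] by auto
  then obtain w where "(v, w) \<in> parcs G" by (meson converse_rtranclE)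
  then show ?thesis by (auto simp: nbhd_def)
qed

lemma disconnected_parts:
  assumes G: "pair_graph G" and V: "pverts G \<noteq> {}" and dis: "\<not> Digraph_Component.connected (with_proj G)"
  obtains A B where "A \<union> B = pverts G" "A \<inter> B = {}" "A \<noteq> {}" "B \<noteq> {}"
    "\<And>u v. (u, v) \<in> parcs G \<Longrightarrow> u \<in> A \<longleftrightarrow> v \<in> A"
proof -
  obtain u0 v0 where uv: "u0 \<in> pverts G" "v0 \<in> pverts G" "(u0, v0) \<notin> (parcs G)\<^sup>*"
    using dis V connected_iff_rtrancl[OF G] by blast
  define A where "A = {v \<in> pverts G. (u0, v) \<in> (parcs G)\<^sup>*}"
  have "u \<in> A \<longleftrightarrow> v \<in> A" if "(u, v) \<in> parcs G" for u v
  proof -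
    have "(v, u) \<in> parcs G" "u \<in> pverts G" "v \<in> pverts G"
      using that pair_graph_sym[OF G] pair_graph_verts[OF G that] by auto
    then show ?thesis using that by (auto simp: A_def intro: rtrancl_into_rtrancl)
  qed
  then show thesis using that[of A "pverts G - A"] uv by (auto simp: A_def)
qed

section \<open>Disconnected graphs\<close>

text \<open>\<open>f\<close> names the part of a vertex. The operator at \<open>u\<close> is the sum
  over the side of \<open>u\<close> minus the sum over its part, so the rank is at most the number
  of parts. One edge on each side gives two positive directions, and differences of representatives
  give as many negative ones as there are parts minus two. These bounds add up to the order, so all
  are attained.\<close>

lemma two_multipartite_index:
  fixes f :: "'a \<Rightarrow> 'c"
  assumes G: "pair_graph G" and V: "A \<union> B = pverts G" "A \<inter> B = {}"
    and arcs: "\<And>u v. u \<in> pverts G \<Longrightarrow> v \<in> pverts G \<Longrightarrow>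
      (u, v) \<in> parcs G \<longleftrightarrow> f u \<noteq> f v \<and> (u \<in> A \<longleftrightarrow> v \<in> A)"
    and disj: "f ` A \<inter> f ` B = {}" and cA: "card (f ` A) \<ge> 2" and cB: "card (f ` B) \<ge> 2"
  shows "sgn_index 1 G = 2" "nullity G + (card (f ` A) + card (f ` B)) = card (pverts G)"
proof -
  let ?V = "pverts G"
  have fin: "finite ?V" "finite A" "finite B" using pair_graph_finite[OF G] V(1) by (auto intro: finite_subset)
  define iA where "iA = (\<lambda>v. if v \<in> A then 1 else 0 :: real)"
  define iB where "iB = (\<lambda>v. if v \<in> B then 1 else 0 :: real)"
  define ic where "ic c = (\<lambda>v. if f v = c then 1 else 0 :: real)" for c
  have side: "v \<in> A \<longleftrightarrow> f v \<in> f ` A" "v \<in> B \<longleftrightarrow> f v \<in> f ` B" "v \<in> B \<longleftrightarrow> v \<notin> A" if "v \<in> ?V" for v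
    using that V disj by blast+
  have op: "adj_op G x u = (if u \<in> A then ip ?V iA x else ip ?V iB x) - ip ?V (ic (f u)) x" if u: "u \<in> ?V" for x u
  proof -
    have *: "adj G u v * x v = (if u \<in> A then iA v else iB v) * x v - ic (f u) v * x v" if v: "v \<in> ?V" for v
      using arcs[OF u v] side[OF u] side[OF v] by (auto simp: adj_def iA_def iB_def ic_def)
    have "adj_op G x u = (\<Sum>v\<in>?V. (if u \<in> A then iA v else iB v) * x v - ic (f u) v * x v)"
      unfolding mat_op_def by (rule sum.cong) (auto simp: *)
    then show ?thesis by (simp add: sum_subtractf ip_def)
  qed
  have class_sum: "ip ?V iA x = (\<Sum>c\<in>f ` A. ip ?V (ic c) x)" "ip ?V iB x = (\<Sum>c\<in>f ` B. ip ?V (ic c) x)" for x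
  proof -
    have cls: "(\<Sum>c\<in>f ` D. ip ?V (ic c) x) = (\<Sum>v\<in>?V. if f v \<in> f ` D then x v else 0)" if "finite D" for D
      unfolding ip_def ic_def by (subst sum.swap) (simp add: if_distrib[of "\<lambda>t. t * _"] that cong: if_cong)
    have "ip ?V iA x = (\<Sum>v\<in>?V. if f v \<in> f ` A then x v else 0)"
      unfolding ip_def iA_def
    proof (rule sum.cong[OF refl])
      fix v assume "v \<in> ?V"
      from side(1)[OF this] show "(if v \<in> A then 1 else 0) * x v = (if f v \<in> f ` A then x v else 0)"
        by (cases "v \<in> A") simp_all
    qed
    then show "ip ?V iA x = (\<Sum>c\<in>f ` A. ip ?V (ic c) x)" unfolding cls[OF fin(2)] .
    have "ip ?V iB x = (\<Sum>v\<in>?V. if f v \<in> f ` B then x v else 0)"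
      unfolding ip_def iB_def
    proof (rule sum.cong[OF refl])
      fix v assume "v \<in> ?V"
      from side(2)[OF this] show "(if v \<in> B then 1 else 0) * x v = (if f v \<in> f ` B then x v else 0)"
        by (cases "v \<in> B") simp_all
    qed
    then show "ip ?V iB x = (\<Sum>c\<in>f ` B. ip ?V (ic c) x)" unfolding cls[OF fin(3)] .
  qed
  have card_un: "card (f ` A \<union> f ` B) = card (f ` A) + card (f ` B)"
    using fin disj by (intro card_Un_disjoint) auto
  have "card ?V \<le> nullity G + card (f ` A \<union> f ` B)"
  proof (rule card_le_nullity_plus[OF G, where l = ic])
    fix x v assume 0: "\<And>j. j \<in> f ` A \<union> f ` B \<Longrightarrow> ip ?V (ic j) x = 0" and v: "v \<in> ?V"
    have "ip ?V iA x = 0" "ip ?V iB x = 0" unfolding class_sum using 0 by simp_all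
    moreover have "ip ?V (ic (f v)) x = 0" using 0 v V(1) by blast
    ultimately show "adj_op G x v = 0" unfolding op[OF v] by simp
  qed (use fin in auto)
  then have rank: "card ?V \<le> nullity G + (card (f ` A) + card (f ` B))" unfolding card_un .
  have "\<forall>c\<in>f ` A \<union> f ` B. \<exists>v. v \<in> ?V \<and> f v = c" using V(1) by blast
  then obtain r where r: "\<And>c. c \<in> f ` A \<union> f ` B \<Longrightarrow> r c \<in> ?V \<and> f (r c) = c" by metis
  obtain a0 a1 where a: "a0 \<in> f ` A" "a1 \<in> f ` A" "a0 \<noteq> a1"
    using cA by (metis One_nat_def Suc_1 card_le_Suc_iff insertI1 insertI2)
  obtain b0 b1 where b: "b0 \<in> f ` B" "b1 \<in> f ` B" "b0 \<noteq> b1"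
    using cB by (metis One_nat_def Suc_1 card_le_Suc_iff insertI1 insertI2)
  have p: "sgn_index 1 G \<ge> 2"
  proof -
    let ?p = "r a0" and ?q = "r a1" and ?s = "r b0" and ?t = "r b1"
    have V4: "?p \<in> ?V" "?q \<in> ?V" "?s \<in> ?V" "?t \<in> ?V" using a b r by auto
    have f4: "f ?p = a0" "f ?q = a1" "f ?s = b0" "f ?t = b1" using a b r by auto
    have A4: "?p \<in> A" "?q \<in> A" "?s \<notin> A" "?t \<notin> A" using side V4 f4 a b by metis+
    have ab: "a0 \<noteq> b0" "a0 \<noteq> b1" "a1 \<noteq> b0" "a1 \<noteq> b1" using a b disj by auto
    have ne: "?p \<noteq> ?q" "?p \<noteq> ?s" "?p \<noteq> ?t" "?q \<noteq> ?s" "?q \<noteq> ?t" "?s \<noteq> ?t"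
      "?q \<noteq> ?p" "?s \<noteq> ?p" "?t \<noteq> ?p" "?s \<noteq> ?q" "?t \<noteq> ?q" "?t \<noteq> ?s"
      using f4 ab a b by metis+
    define g where "g = (\<lambda>i::nat. \<lambda>x. if i = 0 then (if x = ?p \<or> x = ?q then 1 else 0 :: real)
      else (if x = ?s \<or> x = ?t then 1 else 0))"
    have "definite_family 1 G 2 g"
      unfolding definite_family_def
    proof (intro allI impI)
      fix d :: "nat \<Rightarrow> real" assume "\<exists>i<2. d i \<noteq> 0"
      then have nz: "d 0 \<noteq> 0 \<or> d 1 \<noteq> 0" by (metis less_2_cases One_nat_def)
      define z where "z = (\<lambda>v. \<Sum>i<2. d i * g i v)"
      have z_eq: "z v = d 0 * g 0 v + d 1 * g 1 v" for v by (simp add: z_def numeral_2_eq_2)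
      have z: "z ?p = d 0" "z ?q = d 0" "z ?s = d 1" "z ?t = d 1" "\<And>w. w \<notin> {?p, ?q, ?s, ?t} \<Longrightarrow> z w = 0"
        using ne unfolding z_eq by (simp_all add: g_def)
      have "qform G z = (\<Sum>u\<in>{?p, ?q, ?s, ?t}. \<Sum>v\<in>{?p, ?q, ?s, ?t}. adj G u v * z u * z v)"
        by (rule qform_support) (use V4 z fin in auto)
      also have "\<dots> = 2 * ((d 0)\<^sup>2 + (d 1)\<^sup>2)"
        using ne a(3) b(3) by (simp add: adj_def arcs V4 A4 f4 z power2_eq_square)
      finally have "qform G z = 2 * ((d 0)\<^sup>2 + (d 1)\<^sup>2)" .
      moreover have "(d 0)\<^sup>2 + (d 1)\<^sup>2 > 0" unfolding sum_power2_gt_zero_iff by (rule nz)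
      ultimately show "0 < 1 * qform G (\<lambda>v. \<Sum>i<2. d i * g i v)" unfolding z_def by simp
    qed
    then show ?thesis by (intro definite_family_le[OF G]) auto
  qed
  define I where "I = (f ` A - {a0}) \<union> (f ` B - {b0})"
  have I: "finite I" "I \<subseteq> f ` A \<union> f ` B" "a0 \<notin> I" "b0 \<notin> I" using fin a b disj by (auto simp: I_def)
  have "card I = card (f ` A - {a0}) + card (f ` B - {b0})"
    unfolding I_def using fin disj by (intro card_Un_disjoint) auto
  then have cI: "card I + 2 = card (f ` A) + card (f ` B)"
    using a(1) b(1) cA cB fin by (simp add: card_Diff_singleton)
  have neg: "card I \<le> sgn_index (-1) G"
  proof (rule ccontr)
    assume "\<not> ?thesis"
    then have less: "sgn_index (-1) G < card I" by simp
    \<comment> \<open>A fixed part on the same side as \<open>i\<close>. Differences of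
      representatives within one side have vanishing side sums, so only the negative part sums
      remain in the operator.\<close>
    define base where "base i = (if i \<in> f ` A then a0 else b0)" for i
    define g where "g i = (\<lambda>v. (if v = r i then 1 else 0) + (- 1) * (if v = r (base i) then 1 else 0 :: real))" for i
    from semidefinite_combination[OF G I(1) less, where g = g] obtain k where
      k: "\<exists>i\<in>I. k i \<noteq> 0" "(-1) * qform G (\<lambda>v. \<Sum>i\<in>I. k i * g i v) \<le> 0" by auto
    define z where "z = (\<lambda>v. \<Sum>i\<in>I. k i * g i v)"
    have base: "base i \<in> f ` A \<union> f ` B" "base i \<notin> I" "i \<in> f ` A \<longleftrightarrow> base i \<in> f ` A" for i
      using a b I disj by (auto simp: base_def)
    have ind: "ip ?V (\<lambda>v. if v = w then 1 else 0) y = y w" if "w \<in> ?V" for y w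
    proof -
      have "ip ?V (\<lambda>v. if v = w then 1 else 0) y = (\<Sum>v\<in>?V. if v = w then y v else 0)"
        unfolding ip_def by (rule sum.cong) auto
      then show ?thesis using that fin(1) by simp
    qed
    have ri: "r i \<in> ?V" "f (r i) = i" if "i \<in> I" for i
      using r[OF subsetD[OF I(2) that]] by simp_all
    have rb: "r (base i) \<in> ?V" "f (r (base i)) = base i" for i
      using r[OF base(1)] by simp_all
    have ipg: "ip ?V (g i) y = y (r i) - y (r (base i))" if "i \<in> I" for i y
      unfolding g_def ip_add ip_scale using ri[OF that] rb by (simp add: ind)
    have iz: "ip ?V y z = (\<Sum>i\<in>I. k i * (y (r i) - y (r (base i))))" for y
      unfolding z_def by (subst ip_commute, subst ip_sum) (simp add: ipg)
    have sides: "r i \<in> A \<longleftrightarrow> r (base i) \<in> A" "r i \<in> B \<longleftrightarrow> r (base i) \<in> B" if "i \<in> I" for i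
      using side(1)[OF ri(1)[OF that]] side(1)[OF rb(1)[of i]] side(3)[OF ri(1)[OF that]]
        side(3)[OF rb(1)[of i]] base(3)[of i] ri(2)[OF that] rb(2)[of i] by auto
    have "ip ?V iA z = 0" "ip ?V iB z = 0"
      unfolding iz using sides by (auto simp: iA_def iB_def intro!: sum.neutral)
    then have opz: "adj_op G z u = - ip ?V (ic (f u)) z" if "u \<in> ?V" for u
      unfolding op[OF that] by simp
    have z_rep: "z v = 0" if v: "v \<noteq> r (f v)" for v
    proof -
      have "r i \<noteq> v" "r (base i) \<noteq> v" if "i \<in> I" for i
        using v ri(2)[OF that] rb(2)[of i] by auto
      then show ?thesis unfolding z_def g_def by (intro sum.neutral) force
    qed
    \<comment> \<open>Since \<open>z\<close> lives on one representative per part, its sum over the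
      part of \<open>u\<close> is \<open>z u\<close> whenever \<open>z u\<close> is nonzero; so the
      form is minus the squared norm.\<close>
    have zz: "z u * ip ?V (ic (f u)) z = z u * z u" if u: "u \<in> ?V" for u
    proof (cases "u = r (f u)")
      case True
      have "ip ?V (ic (f u)) z = (\<Sum>v\<in>?V. if v = u then z v else 0)"
        unfolding ip_def ic_def using z_rep True by (intro sum.cong) auto
      then show ?thesis using u fin by simp
    qed (simp add: z_rep)
    have "qform G z = - ip ?V z z"
    proof -
      have "qform G z = (\<Sum>u\<in>?V. - (z u * z u))"
        unfolding qform_def ip_def[of ?V z] by (rule sum.cong) (simp_all add: opz zz)
      then show ?thesis by (simp add: ip_def sum_negf)
    qed
    then have "ip ?V z z \<le> 0" using k(2) ip_self_nonneg[of ?V z] unfolding z_def[symmetric] by simp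
    then have z0: "z v = 0" if "v \<in> ?V" for v using ip_self_zero[OF fin(1)] that by blast
    obtain i where i: "i \<in> I" "k i \<noteq> 0" using k(1) by blast
    have rr: "r i = r j \<longleftrightarrow> j = i" if "j \<in> I" for j using ri(2)[OF that] ri(2)[OF i(1)] by metis
    have rr': "r i \<noteq> r (base j)" for j using rb(2)[of j] ri(2)[OF i(1)] base(2)[of j] i(1) by metis
    have "z (r i) = (\<Sum>j\<in>I. if j = i then k j else 0)"
      unfolding z_def g_def by (rule sum.cong) (simp_all add: rr rr')
    also have "\<dots> = k i" using i I by simp
    finally have "z (r i) = k i" .
    moreover have "r i \<in> ?V" by (rule ri(1)[OF i(1)])
    ultimately show False using z0 i by simp
  qed
  show "sgn_index 1 G = 2" "nullity G + (card (f ` A) + card (f ` B)) = card (pverts G)"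
    using index_sum[OF G] rank p neg cI by linarith+
qed

section \<open>Disjoint sums and complete multipartite graphs\<close>

lemma disjoint_sum_arcs [simp]:
  "(Inl x, Inl y) \<in> parcs (disjoint_sum G H) \<longleftrightarrow> (x, y) \<in> parcs G"
  "(Inr x', Inr y') \<in> parcs (disjoint_sum G H) \<longleftrightarrow> (x', y') \<in> parcs H"
  "(Inl x, Inr y') \<notin> parcs (disjoint_sum G H)" "(Inr x', Inl y) \<notin> parcs (disjoint_sum G H)"
  by (simp_all add: disjoint_sum_def)

lemma pair_graph_disjoint_sum:
  assumes G: "pair_graph G" and H: "pair_graph H"
  shows "pair_graph (disjoint_sum G H)"
proof (rule pair_graphI)
  show "finite (pverts (disjoint_sum G H))"
    using pair_graph_finite[OF G] pair_graph_finite[OF H] by (simp add: disjoint_sum_def)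
  show "parcs (disjoint_sum G H) \<subseteq> pverts (disjoint_sum G H) \<times> pverts (disjoint_sum G H)"
    by (auto simp: disjoint_sum_def dest: pair_graph_verts[OF G] pair_graph_verts[OF H])
  show "(v, u) \<in> parcs (disjoint_sum G H)" if "(u, v) \<in> parcs (disjoint_sum G H)" for u v
    using that pair_graph_sym[OF G] pair_graph_sym[OF H] unfolding disjoint_sum_def by auto
  show "(u, u) \<notin> parcs (disjoint_sum G H)" for u
    using pair_graph_irrefl[OF G] pair_graph_irrefl[OF H] by (auto simp: disjoint_sum_def)
qed

lemma pair_graph_complete_graph: "pair_graph (complete_graph m)"
  by (rule pair_graphI) (auto simp: complete_graph_def)

lemma pverts_complete_multipartite:
  "pverts (complete_multipartite ts) = Sigma {..<length ts} (\<lambda>i. {..<ts ! i})"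
  by (auto simp: complete_multipartite_def Let_def)

lemma pair_graph_complete_multipartite: "pair_graph (complete_multipartite ts)"
proof (rule pair_graphI)
  show "finite (pverts (complete_multipartite ts))" unfolding pverts_complete_multipartite by simp
qed (auto simp: complete_multipartite_def Let_def)

lemma card_complete_multipartite: "card (pverts (complete_multipartite ts)) = sum_list ts"
  unfolding pverts_complete_multipartite
  by (subst card_SigmaI) (auto simp: sum_list_sum_nth atLeast0LessThan)

lemma sum_list_minus_one: "\<forall>t\<in>set ts. t \<ge> 1 \<Longrightarrow> (\<Sum>t\<leftarrow>ts. t - 1) + length ts = sum_list (ts :: nat list)"
  by (induction ts) auto

lemma multipartite_sum_index:
  assumes l: "length ts \<ge> 2" "length rs \<ge> 2" and pos: "\<forall>t\<in>set ts. t \<ge> 1" "\<forall>r\<in>set rs. r \<ge> 1"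
  defines "L \<equiv> disjoint_sum (complete_multipartite ts) (complete_multipartite rs)"
  shows "sgn_index 1 L = 2" "nullity L = (\<Sum>t\<leftarrow>ts. t - 1) + (\<Sum>r\<leftarrow>rs. r - 1)"
proof -
  have G: "pair_graph L"
    unfolding L_def by (intro pair_graph_disjoint_sum pair_graph_complete_multipartite)
  define A :: "(nat \<times> nat + nat \<times> nat) set" where "A = Inl ` pverts (complete_multipartite ts)"
  define B :: "(nat \<times> nat + nat \<times> nat) set" where "B = Inr ` pverts (complete_multipartite rs)"
  define f :: "nat \<times> nat + nat \<times> nat \<Rightarrow> nat + nat" where "f = map_sum fst fst"
  have V: "A \<union> B = pverts L" "A \<inter> B = {}" by (auto simp: A_def B_def L_def disjoint_sum_def)
  have proj: "fst ` pverts (complete_multipartite us) = {..<length us}" if "\<forall>t\<in>set us. t \<ge> 1" for us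
  proof -
    have "(i, 0) \<in> pverts (complete_multipartite us)" if i: "i < length us" for i
    proof -
      have "us ! i \<ge> 1" using nth_mem[OF i] \<open>\<forall>t\<in>set us. t \<ge> 1\<close> by blast
      then show ?thesis using i by (simp add: pverts_complete_multipartite)
    qed
    then show ?thesis by (force simp: pverts_complete_multipartite)
  qed
  have "f ` A = Inl ` {..<length ts}" unfolding A_def proj[OF pos(1), symmetric] by (simp add: f_def image_image)
  moreover have "f ` B = Inr ` {..<length rs}" unfolding B_def proj[OF pos(2), symmetric] by (simp add: f_def image_image)
  ultimately have img: "f ` A \<inter> f ` B = {}" "card (f ` A) = length ts" "card (f ` B) = length rs"
    by (auto simp: card_image)
  have arcs: "(u, v) \<in> parcs L \<longleftrightarrow> f u \<noteq> f v \<and> (u \<in> A \<longleftrightarrow> v \<in> A)" if "u \<in> pverts L" "v \<in> pverts L" for u v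
    using that unfolding L_def disjoint_sum_def complete_multipartite_def Let_def A_def f_def by auto
  note idx = two_multipartite_index[OF G V arcs img(1)]
  show "sgn_index 1 L = 2" using idx(1) l unfolding img by blast
  have "nullity L + (length ts + length rs) = card (pverts L)" using idx(2) l unfolding img by blast
  also have "card (pverts L) = sum_list ts + sum_list rs"
    by (simp add: L_def disjoint_sum_def card_Plus pair_graph_finite[OF pair_graph_complete_multipartite]
        card_complete_multipartite)
  finally show "nullity L = (\<Sum>t\<leftarrow>ts. t - 1) + (\<Sum>r\<leftarrow>rs. r - 1)"
    using sum_list_minus_one[OF pos(1)] sum_list_minus_one[OF pos(2)] by linarith
qed

lemma multipartite_bij:
  assumes "finite A"
  obtains ts h where "bij_betw h A (pverts (complete_multipartite ts))" "\<forall>t\<in>set ts. t \<ge> 1"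
    "length ts = card (f ` A)" "\<forall>u\<in>A. \<forall>v\<in>A. fst (h u) = fst (h v) \<longleftrightarrow> f u = f v"
proof -
  obtain cs where cs: "distinct cs" "set cs = f ` A" using finite_distinct_list[of "f ` A"] assms by blast
  define F where "F c = {v \<in> A. f v = c}" for c
  define ts where "ts = map (\<lambda>c. card (F c)) cs"
  have finF: "finite (F c)" for c using assms by (simp add: F_def)
  have "\<forall>c. \<exists>g. bij_betw g (F c) {..<card (F c)}"
    using finite_same_card_bij[OF finF finite_lessThan] by simp
  then obtain g where g: "\<And>c. bij_betw (g c) (F c) {..<card (F c)}" by metis
  have "\<forall>c\<in>f ` A. \<exists>i<length cs. cs ! i = c" using cs(2) by (metis in_set_conv_nth)
  then obtain i where i: "\<And>c. c \<in> f ` A \<Longrightarrow> i c < length cs \<and> cs ! (i c) = c" by metis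
  have i_nth: "i (cs ! j) = j" if "j < length cs" for j
    using i[of "cs ! j"] that cs by (metis nth_eq_iff_index_eq nth_mem)
  define h where "h v = (i (f v), g (f v) v)" for v
  have inj: "inj_on h A"
  proof (rule inj_onI)
    fix u v assume uv: "u \<in> A" "v \<in> A" "h u = h v"
    then have "f u = f v" using i by (metis Pair_inject h_def imageI)
    then show "u = v"
      using uv g[of "f u"] by (auto simp: h_def F_def bij_betw_def inj_on_def)
  qed
  have "h ` A = pverts (complete_multipartite ts)"
  proof (intro equalityI subsetI)
    fix x assume "x \<in> h ` A"
    then obtain v where v: "v \<in> A" "x = h v" by blast
    then have "v \<in> F (f v)" by (simp add: F_def)
    then have "g (f v) v < card (F (f v))" using bij_betwE[OF g] by blast
    then show "x \<in> pverts (complete_multipartite ts)"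
      using v i[of "f v"] by (simp add: pverts_complete_multipartite h_def ts_def)
  next
    fix x assume "x \<in> pverts (complete_multipartite ts)"
    then obtain j a where x: "x = (j, a)" "j < length cs" "a < card (F (cs ! j))"
      by (auto simp: pverts_complete_multipartite ts_def)
    then have "a \<in> g (cs ! j) ` F (cs ! j)" using bij_betw_imp_surj_on[OF g[of "cs ! j"]] by simp
    then obtain v where "v \<in> F (cs ! j)" "g (cs ! j) v = a" by blast
    then show "x \<in> h ` A" using x i_nth by (force simp: F_def h_def)
  qed
  moreover have "\<forall>t\<in>set ts. t \<ge> 1"
  proof
    fix t assume "t \<in> set ts"
    then obtain v where "v \<in> A" "t = card (F (f v))" using cs(2) by (auto simp: ts_def)
    moreover from this have "v \<in> F (f v)" by (simp add: F_def)
    ultimately show "t \<ge> 1" using finF by (metis One_nat_def Suc_leI card_gt_0_iff empty_iff)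
  qed
  moreover have "length ts = card (f ` A)" using cs distinct_card by (fastforce simp: ts_def)
  moreover have "fst (h u) = fst (h v) \<longleftrightarrow> f u = f v" if "u \<in> A" "v \<in> A" for u v
    using i that by (metis fst_conv h_def imageI)
  ultimately show thesis using that[of h ts] inj by (auto simp: bij_betw_def)
qed

lemma isolated_null:
  assumes G: "pair_graph G" and u: "u \<in> pverts G" "nbhd G u = {}"
  shows "adj_op G (\<lambda>v. if v = u then 1 else 0) w = 0"
proof -
  have "adj_op G (\<lambda>v. if v = u then 1 else 0) w = (\<Sum>v\<in>{u}. adj G w v * (if v = u then 1 else 0))"
    by (rule adj_op_support) (use u pair_graph_finite[OF G] in auto)
  then show ?thesis by (simp add: adj_nbhd[OF G] u)
qed

lemma two_pos_del_isolated:
  assumes G: "pair_graph G" and u: "u \<in> pverts G" "nbhd G u = {}" and s: "s \<ge> 1"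
  shows "G \<in> two_pos s n \<longleftrightarrow> n \<ge> 1 \<and> del_v u G \<in> two_pos (s - 1) (n - 1)"
  by (rule two_pos_del_v[OF G u(1) _ isolated_null[OF G u] s]) simp

lemma two_pos_iso:
  assumes "pair_graph G" "pair_graph H" "graph_iso h G H"
  shows "G \<in> two_pos s n \<longleftrightarrow> H \<in> two_pos s n"
  using graph_iso_index[OF assms] two_pos_iff[OF assms(1)] two_pos_iff[OF assms(2)] by simp

lemma two_pos_plus_K1:
  assumes H: "pair_graph H" and s: "s \<ge> 1" and n: "n \<ge> 1"
  shows "disjoint_sum H (complete_graph 1) \<in> two_pos s n \<longleftrightarrow> H \<in> two_pos (s - 1) (n - 1)"
proof -
  let ?L = "disjoint_sum H (complete_graph 1)"
  have L: "pair_graph ?L" by (intro pair_graph_disjoint_sum H pair_graph_complete_graph)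
  have u: "Inr 0 \<in> pverts ?L" "nbhd ?L (Inr 0) = {}"
    by (auto simp: disjoint_sum_def complete_graph_def nbhd_def)
  have "graph_iso Inl H (del_v (Inr 0) ?L)"
    unfolding graph_iso_def by (auto simp: del_v_def disjoint_sum_def complete_graph_def bij_betw_def)
  then show ?thesis
    using two_pos_del_isolated[OF L u s] two_pos_iso[OF H pair_graph_del_v[OF L]] n by blast
qed

text \<open>An isolated vertex supports a null vector and splits off as \<open>K_1\<close>. Without
  isolated vertices, non-adjacent vertices on the same side turn out to be twins; being twins is an
  equivalence relation, so each side is complete multipartite, with an edge and hence at least two
  parts.\<close>

lemma disconnected_two_pos:
  fixes G :: "'a pair_pre_digraph"
  assumes G: "pair_graph G" and V: "pverts G \<noteq> {}" and dis: "\<not> Digraph_Component.connected (with_proj G)"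
    and mem: "G \<in> two_pos s n" and s: "s \<ge> 1"
  shows "(\<exists>(H :: nat pair_pre_digraph) h. H \<in> two_pos (s - 1) (n - 1) \<and>
      graph_iso h G (disjoint_sum H (complete_graph 1))) \<or>
    (\<exists>ts rs h. length ts \<ge> 2 \<and> length rs \<ge> 2 \<and> (\<forall>t\<in>set ts. t \<ge> 1) \<and> (\<forall>r\<in>set rs. r \<ge> 1) \<and>
      graph_iso h G (disjoint_sum (complete_multipartite ts) (complete_multipartite rs)))"
proof (cases "\<exists>u\<in>pverts G. nbhd G u = {}")
  case True
  then obtain u where u: "u \<in> pverts G" "nbhd G u = {}" by blast
  let ?D = "del_v u G"
  have D: "pair_graph ?D" "?D \<in> two_pos (s - 1) (n - 1)"
    using pair_graph_del_v[OF G] two_pos_del_isolated[OF G u s] mem by blast+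
  obtain k where k: "bij_betw k (pverts ?D) {..<card (pverts ?D)}"
    using finite_same_card_bij[OF pair_graph_finite[OF D(1)] finite_lessThan] by auto
  \<comment> \<open>A copy on natural numbers, the vertex type of the summand in the
    conclusion.\<close>
  define H where "H = \<lparr>pverts = {..<card (pverts ?D)}, parcs = {(k a, k b) | a b. (a, b) \<in> parcs ?D}\<rparr>"
  have inD: "a \<in> pverts ?D" "b \<in> pverts ?D" if "(a, b) \<in> parcs ?D" for a b
    using pair_graph_verts[OF D(1) that] by auto
  have kinj: "k a = k b \<longleftrightarrow> a = b" if "a \<in> pverts ?D" "b \<in> pverts ?D" for a b
    using k that by (auto simp: bij_betw_def inj_on_def)
  have arcsH: "(k a, k b) \<in> parcs H \<longleftrightarrow> (a, b) \<in> parcs ?D" if "a \<in> pverts ?D" "b \<in> pverts ?D" for a b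
  proof
    assume "(k a, k b) \<in> parcs H"
    then obtain a' b' where "(a', b') \<in> parcs ?D" "k a = k a'" "k b = k b'" by (auto simp: H_def)
    then show "(a, b) \<in> parcs ?D" using kinj that inD by metis
  qed (auto simp: H_def)
  have H: "pair_graph H"
  proof (rule pair_graphI)
    show "parcs H \<subseteq> pverts H \<times> pverts H"
      using bij_betwE[OF k] inD unfolding H_def by auto
    show "(y, x) \<in> parcs H" if "(x, y) \<in> parcs H" for x y
      using that pair_graph_sym[OF D(1)] unfolding H_def by auto
    show "(x, x) \<notin> parcs H" for x
    proof
      assume "(x, x) \<in> parcs H"
      then obtain a b where "(a, b) \<in> parcs ?D" "k a = k b" by (auto simp: H_def)
      then show False using kinj inD pair_graph_irrefl[OF D(1)] by metis
    qed
  qed (simp add: H_def)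
  have "graph_iso k ?D H" using k arcsH by (simp add: graph_iso_def H_def)
  then have memH: "H \<in> two_pos (s - 1) (n - 1)" using two_pos_iso[OF D(1) H] D(2) by blast
  define h where "h v = (if v = u then Inr (0 :: nat) else Inl (k v))" for v
  have noarc: "(u, v) \<notin> parcs G" "(v, u) \<notin> parcs G" for v
    using u(2) pair_graph_sym[OF G, of v u] by (auto simp: nbhd_def)
  have "graph_iso h G (disjoint_sum H (complete_graph 1))"
    unfolding graph_iso_def
  proof (intro conjI ballI)
    have VD: "pverts ?D = pverts G - {u}" by (simp add: del_v_def)
    have "h ` pverts G = insert (Inr 0) (Inl ` k ` pverts ?D)"
      using u(1) unfolding VD h_def by auto
    also have "k ` pverts ?D = pverts H" using bij_betw_imp_surj_on[OF k] by (simp add: H_def)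
    also have "insert (Inr 0) (Inl ` pverts H) = pverts (disjoint_sum H (complete_graph 1))"
      by (auto simp: disjoint_sum_def complete_graph_def)
    finally have "h ` pverts G = pverts (disjoint_sum H (complete_graph 1))" .
    moreover have "inj_on h (pverts G)"
      using kinj unfolding inj_on_def VD h_def by auto
    ultimately show "bij_betw h (pverts G) (pverts (disjoint_sum H (complete_graph 1)))"
      by (simp add: bij_betw_def)
    fix a b assume ab: "a \<in> pverts G" "b \<in> pverts G"
    show "(a, b) \<in> parcs G \<longleftrightarrow> (h a, h b) \<in> parcs (disjoint_sum H (complete_graph 1))"
    proof (cases "a = u \<or> b = u")
      case True
      then show ?thesis using noarc by (auto simp: h_def disjoint_sum_def complete_graph_def)
    next
      case False
      then have "(a, b) \<in> parcs G \<longleftrightarrow> (a, b) \<in> parcs ?D" by (simp add: del_v_def)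
      also have "\<dots> \<longleftrightarrow> (k a, k b) \<in> parcs H" using arcsH False ab by (simp add: VD)
      finally show ?thesis using False by (simp add: h_def disjoint_sum_def complete_graph_def)
    qed
  qed
  with memH show ?thesis by blast
next
  case False
  have p: "sgn_index 1 G = 2" using mem two_pos_iff[OF G] by blast
  obtain A B where AB: "A \<union> B = pverts G" "A \<inter> B = {}" "A \<noteq> {}" "B \<noteq> {}"
    and sep: "\<And>u v. (u, v) \<in> parcs G \<Longrightarrow> u \<in> A \<longleftrightarrow> v \<in> A"
    using disconnected_parts[OF G V dis] by blast
  \<comment> \<open>With \<open>b\<close> on the other side, \<open>x\<close>, \<open>y\<close>,
    \<open>b\<close> are independent and their columns dependent. A neighbour of \<open>b\<close> is
    seen by neither \<open>x\<close> nor \<open>y\<close>, so the coefficient of \<open>b\<close> is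
    0, and the remaining relation between two nonzero indicators forces equality.\<close>
  have twins: "nbhd G x = nbhd G y" if x: "x \<in> pverts G" "y \<in> pverts G" "x \<in> A \<longleftrightarrow> y \<in> A" "(x, y) \<notin> parcs G" for x y
  proof (cases "x = y")
    case False
    obtain b where b: "b \<in> pverts G" "(b \<in> A) \<noteq> (x \<in> A)" using AB by blast
    have "indep3 G x y b"
      unfolding indep3_def using x b False sep by auto
    then obtain \<alpha> \<beta> \<gamma> where nz: "\<alpha> \<noteq> 0 \<or> \<beta> \<noteq> 0 \<or> \<gamma> \<noteq> 0"
      and rel: "\<And>w. w \<in> pverts G \<Longrightarrow> \<alpha> * adj G w x + \<beta> * adj G w y + \<gamma> * adj G w b = 0"
      using indep3_dependent[OF G p] by blast
    have nb: "w \<in> pverts G" "w \<in> A \<longleftrightarrow> v \<in> A" if "w \<in> nbhd G v" for v w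
      using that sep[of v w] pair_graph_verts[OF G, of v w] by (auto simp: nbhd_def)
    have ne: "nbhd G v \<noteq> {}" if "v \<in> pverts G" for v using \<open>\<not> (\<exists>u\<in>pverts G. nbhd G u = {})\<close> that by blast
    obtain w where "w \<in> nbhd G b" using ne b by blast
    moreover from this have "w \<notin> nbhd G x" "w \<notin> nbhd G y" using nb b x(3) by blast+
    ultimately have "\<gamma> = 0" using rel[of w] nb by (simp add: adj_nbhd[OF G])
    then have rel': "\<alpha> * adj G w x + \<beta> * adj G w y = 0" if "w \<in> pverts G" for w using rel[OF that] by simp
    have "\<alpha> \<noteq> 0 \<and> \<beta> \<noteq> 0"
    proof (rule ccontr)
      assume "\<not> ?thesis"
      moreover obtain v where "v \<in> nbhd G x" using ne x by blast
      moreover obtain w where "w \<in> nbhd G y" using ne x by blast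
      ultimately show False using rel'[of v] rel'[of w] nb nz \<open>\<gamma> = 0\<close> by (auto simp: adj_nbhd[OF G])
    qed
    then have "w \<in> nbhd G x \<longleftrightarrow> w \<in> nbhd G y" for w
      using rel'[of w] nb[of w] by (auto simp: adj_nbhd[OF G] split: if_splits)
    then show ?thesis by blast
  qed simp
  have arcs: "(u, v) \<in> parcs G \<longleftrightarrow> nbhd G u \<noteq> nbhd G v \<and> (u \<in> A \<longleftrightarrow> v \<in> A)"
    if "u \<in> pverts G" "v \<in> pverts G" for u v
  proof -
    have "nbhd G u \<noteq> nbhd G v" if "(u, v) \<in> parcs G"
      using that pair_graph_irrefl[OF G, of v] by (auto simp: nbhd_def)
    then show ?thesis using twins[OF that] sep by blast
  qed
  have fin: "finite A" "finite B" using pair_graph_finite[OF G] AB(1) by (auto intro: finite_subset)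
  have two: "card (nbhd G ` D) \<ge> 2" if D: "D = A \<or> D = B" for D
  proof -
    obtain u where u: "u \<in> D" using D AB by blast
    then have uV: "u \<in> pverts G" using D AB by blast
    then obtain v where v: "(u, v) \<in> parcs G" using False by (auto simp: nbhd_def)
    then have vD: "v \<in> pverts G" "v \<in> D" using pair_graph_verts[OF G v] sep[OF v] D u AB by blast+
    have "nbhd G u \<noteq> nbhd G v" using arcs[OF uV vD(1)] v by blast
    then have "card {nbhd G u, nbhd G v} = 2" by simp
    moreover have "card {nbhd G u, nbhd G v} \<le> card (nbhd G ` D)"
      using fin D u vD by (intro card_mono) auto
    ultimately show ?thesis by simp
  qed
  obtain ts h where h: "bij_betw h A (pverts (complete_multipartite ts))" "\<forall>t\<in>set ts. t \<ge> 1"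
    "length ts = card (nbhd G ` A)" "\<forall>u\<in>A. \<forall>v\<in>A. fst (h u) = fst (h v) \<longleftrightarrow> nbhd G u = nbhd G v"
    by (rule multipartite_bij[OF fin(1), of "nbhd G"])
  obtain rs k where k: "bij_betw k B (pverts (complete_multipartite rs))" "\<forall>t\<in>set rs. t \<ge> 1"
    "length rs = card (nbhd G ` B)" "\<forall>u\<in>B. \<forall>v\<in>B. fst (k u) = fst (k v) \<longleftrightarrow> nbhd G u = nbhd G v"
    by (rule multipartite_bij[OF fin(2), of "nbhd G"])
  let ?L = "disjoint_sum (complete_multipartite ts) (complete_multipartite rs)"
  define g where "g v = (if v \<in> A then Inl (h v) else Inr (k v))" for v
  have gA: "g v = Inl (h v)" if "v \<in> A" for v using that by (simp add: g_def)
  have gB: "g v = Inr (k v)" if "v \<in> B" for v using that AB(2) by (auto simp: g_def)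
  have "graph_iso g G ?L"
    unfolding graph_iso_def
  proof (intro conjI ballI)
    have "bij_betw g A (Inl ` pverts (complete_multipartite ts))"
      using h(1) gA by (auto simp: bij_betw_def inj_on_def image_iff)
    moreover have "bij_betw g B (Inr ` pverts (complete_multipartite rs))"
      using k(1) gB by (auto simp: bij_betw_def inj_on_def image_iff)
    ultimately have "bij_betw g (A \<union> B) (Inl ` pverts (complete_multipartite ts) \<union> Inr ` pverts (complete_multipartite rs))"
      by (rule bij_betw_combine) auto
    then show "bij_betw g (pverts G) (pverts ?L)" unfolding AB(1) by (simp add: disjoint_sum_def Plus_def)
    fix a b assume ab: "a \<in> pverts G" "b \<in> pverts G"
    have hV: "h v \<in> pverts (complete_multipartite ts)" if "v \<in> A" for v using bij_betwE[OF h(1)] that by blast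
    have kV: "k v \<in> pverts (complete_multipartite rs)" if "v \<in> B" for v using bij_betwE[OF k(1)] that by blast
    have cm: "(x, y) \<in> parcs (complete_multipartite us) \<longleftrightarrow> fst x \<noteq> fst y"
      if "x \<in> pverts (complete_multipartite us)" "y \<in> pverts (complete_multipartite us)" for x y us
      using that by (auto simp: complete_multipartite_def Let_def)
    consider "a \<in> A" "b \<in> A" | "a \<in> A" "b \<in> B" | "a \<in> B" "b \<in> A" | "a \<in> B" "b \<in> B" using ab AB(1) by blast
    then show "(a, b) \<in> parcs G \<longleftrightarrow> (g a, g b) \<in> parcs ?L"
    proof cases
      case 1
      have "(g a, g b) \<in> parcs ?L \<longleftrightarrow> (h a, h b) \<in> parcs (complete_multipartite ts)"
        using 1 by (simp add: gA)
      then show ?thesis using arcs[OF ab] 1 cm[OF hV hV, OF 1] h(4) by blast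
    next
      case 2
      then have "(g a, g b) \<notin> parcs ?L" by (simp add: gA gB)
      then show ?thesis using arcs[OF ab] 2 AB(2) by blast
    next
      case 3
      then have "(g a, g b) \<notin> parcs ?L" by (simp add: gA gB)
      then show ?thesis using arcs[OF ab] 3 AB(2) by blast
    next
      case 4
      have "(g a, g b) \<in> parcs ?L \<longleftrightarrow> (k a, k b) \<in> parcs (complete_multipartite rs)"
        using 4 by (simp add: gB)
      then show ?thesis using arcs[OF ab] 4 AB(2) cm[OF kV kV, OF 4] k(4) by blast
    qed
  qed
  then show ?thesis using h(2,3) k(2,3) two[of A] two[of B] by metis
qed

section \<open>The exceptional graphs\<close>

text \<open>In the decreasing list positive eigenvalues come first and zeros next, so two zeros in
  places 3 and 4 mean at most two positive eigenvalues and nullity at least 2. The assumed opposite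
  bounds turn both into equalities. Places count from 1, list positions from 0.\<close>

lemma nth_eigenvalues_iff:
  assumes G: "pair_graph G" and n: "card (pverts G) \<ge> 4"
    and p: "sgn_index 1 G \<ge> 2" and nul: "nullity G \<le> 2"
  shows "nth_eigenvalue G 3 = 0 \<and> nth_eigenvalue G 4 = 0 \<longleftrightarrow> sgn_index 1 G = 2 \<and> nullity G = 2"
proof -
  define es where "es = eigenvalues G"
  obtain f lam where "eigenbasis G (card (pverts G)) f lam" using eigenbasis_exists[OF G] by blast
  from eigenbasisD(4)[OF this] have len: "length es \<ge> 4"
    using n unfolding es_def by (metis diff_zero length_map length_upt size_mset)
  have mono: "es ! j \<le> es ! i" if "i \<le> j" "j < length es" for i j
    using sorted_rev_nth_mono[of es i j] that by (simp add: es_def eigenvalues_def)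
  define P where "P = {i. i < length es \<and> es ! i > 0}"
  define Z where "Z = {i. i < length es \<and> es ! i = 0}"
  have fin: "finite P" "finite Z" and PZ: "P \<inter> Z = {}" by (auto simp: P_def Z_def)
  have card: "sgn_index 1 G = card P" "nullity G = card Z"
    by (simp_all add: sgn_index_def nullity_def length_filter_conv_card P_def Z_def es_def)
  have ev: "nth_eigenvalue G 3 = es ! 2" "nth_eigenvalue G 4 = es ! 3"
    by (simp_all add: nth_eigenvalue_def es_def)
  show ?thesis
  proof
    assume 0: "nth_eigenvalue G 3 = 0 \<and> nth_eigenvalue G 4 = 0"
    have "i < 2" if "i \<in> P" for i
      using mono[of 2 i] that 0 unfolding ev P_def by (cases "i < 2") auto
    then have "P \<subseteq> {..<2}" by blast
    then have "card P \<le> 2" using card_mono[of "{..<2::nat}" P] by simp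
    moreover have "{2, 3} \<subseteq> Z" using 0 len unfolding ev Z_def by simp
    then have "card Z \<ge> 2" using card_mono[OF fin(2), of "{2, 3}"] by simp
    ultimately show "sgn_index 1 G = 2 \<and> nullity G = 2" using p nul card by simp
  next
    assume *: "sgn_index 1 G = 2 \<and> nullity G = 2"
    then have c4: "card (P \<union> Z) = 4" using card fin PZ by (simp add: card_Un_disjoint)
    have le: "es ! 2 \<le> 0"
    proof (rule ccontr)
      assume "\<not> ?thesis"
      then have "i \<in> P" if "i < 3" for i using mono[of i 2] that len unfolding P_def by simp
      then have "{..<3} \<subseteq> P" by blast
      then show False using card_mono[OF fin(1), of "{..<3}"] card * by simp
    qed
    \<comment> \<open>Two positive and two zero eigenvalues occupy four positions, so the
      nonnegative part of the list cannot end before place 4.\<close>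
    have ge: "es ! 3 \<ge> 0"
    proof (rule ccontr)
      assume "\<not> ?thesis"
      then have "i < 3" if "i \<in> P \<union> Z" for i
        using mono[of 3 i] that unfolding P_def Z_def by (cases "i < 3") auto
      then have "P \<union> Z \<subseteq> {..<3}" by blast
      then show False using card_mono[of "{..<3::nat}" "P \<union> Z"] c4 by simp
    qed
    have "es ! 3 \<le> es ! 2" using mono[of 2 3] len by simp
    with le ge show "nth_eigenvalue G 3 = 0 \<and> nth_eigenvalue G 4 = 0" unfolding ev by linarith
  qed
qed

text \<open>The bounds needed to read the two vanishing eigenvalues as exact indices come from the
  shape alone: nullity at most 2 from the chain structure, two positive eigenvalues from the induced
  path.\<close>

lemma D_star_two_pos:
  assumes G: "pair_graph G" and n: "card (pverts G) \<ge> 4" and D: "G \<in> D_star"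
  shows "G \<in> two_pos 2 (card (pverts G))"
proof -
  obtain k c where kc: "4 \<le> k" "\<forall>u\<in>pverts (G_graph k). c u \<ge> 1"
    and iso: "digraph_iso (with_proj G) (with_proj (lex_cliques (G_graph k) c))"
    and ev: "nth_eigenvalue G 3 = 0 \<and> nth_eigenvalue G 4 = 0"
    using D unfolding D_star_def by blast
  let ?L = "lex_cliques (G_graph k) c"
  have L: "pair_graph ?L" by (rule pair_graph_lex_cliques)
  obtain h where h: "graph_iso h G ?L" using iso digraph_iso_iff[OF G L] by blast
  have "nullity ?L \<le> 2"
    using chain_map_list[OF L chain_map_lex_cliques] chain_nullity_le_2[OF L] by blast
  moreover have "sgn_index 1 ?L \<ge> 2" using lex_cliques_index_ge_2 kc by blast
  ultimately have "sgn_index 1 G \<ge> 2" "nullity G \<le> 2" using graph_iso_index[OF G L h] by simp_all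
  then show ?thesis using nth_eigenvalues_iff[OF G n] ev two_pos_iff[OF G] by blast
qed

lemma connected_not_congruent:
  assumes G: "pair_graph G" and conn: "Digraph_Component.connected (with_proj G)"
    and n: "card (pverts G) \<ge> 4" and mem: "G \<in> two_pos s (card (pverts G))" and s: "s \<ge> 2"
    and nc: "\<And>u. \<not> congruent G u"
  shows "s = 2 \<and> G \<in> D_star"
proof -
  have p: "sgn_index 1 G = 2" and nul: "nullity G = s" using mem two_pos_iff[OF G] by blast+
  have V: "pverts G \<noteq> {}" using n by auto
  have "nbhd G v \<noteq> {}" if "v \<in> pverts G" for v
    using connected_nbhd[OF G conn _ that] n by simp
  then obtain f k where f: "chain_map G f" "f ` pverts G = {..<k}"
    using no_congruent_chain_map[OF G V p _ nc] by blast
  obtain vs where ch: "chain_list G (\<lambda>v. even (f v)) vs" using chain_map_list[OF G f(1)] by blast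
  have s2: "s = 2" using chain_nullity_le_2[OF G ch] nul s by simp
  have n14: "card (pverts G) \<le> 14" using chain_card_le_14[OF G ch p] nul s2 by simp
  have k4: "k \<ge> 4" using chain_blocks_ge_4[OF G f(1) _ _ f(2)] nul s2 n by simp
  have "k \<le> 14"
    using card_image_le[OF pair_graph_finite[OF G], of f] n14 unfolding f(2) by simp
  obtain c h where c: "\<forall>u\<in>pverts (G_graph k). c u \<ge> 1"
    and h: "graph_iso h G (lex_cliques (G_graph k) c)"
    by (rule chain_map_iso_lex_cliques[OF G f])
  have "(\<Sum>u\<in>pverts (G_graph k). c u) \<le> 14"
    using graph_iso_index(3)[OF G pair_graph_lex_cliques h] n14 card_lex_cliques[of k c] by simp
  moreover have "digraph_iso (with_proj G) (with_proj (lex_cliques (G_graph k) c))"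
    using digraph_iso_iff[OF G pair_graph_lex_cliques] h by blast
  moreover have "nth_eigenvalue G 3 = 0 \<and> nth_eigenvalue G 4 = 0"
    using nth_eigenvalues_iff[OF G n] p nul s2 by simp
  ultimately have "G \<in> D_star" using G k4 \<open>k \<le> 14\<close> c unfolding D_star_def by blast
  with s2 show ?thesis ..
qed

lemma disconnected_iff:
  fixes G :: "'a pair_pre_digraph"
  assumes G: "pair_graph G" and V: "pverts G \<noteq> {}" and n: "card (pverts G) = n"
    and dis: "\<not> Digraph_Component.connected (with_proj G)" and s: "s \<ge> 1"
  shows "G \<in> two_pos s n \<longleftrightarrow>
    (\<exists>H :: nat pair_pre_digraph. H \<in> two_pos (s - 1) (n - 1) \<and>
      digraph_iso (with_proj G) (with_proj (disjoint_sum H (complete_graph 1)))) \<or>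
    (\<exists>ts rs. length ts \<ge> 2 \<and> length rs \<ge> 2 \<and> (\<forall>t\<in>set ts. t \<ge> 1) \<and> (\<forall>r\<in>set rs. r \<ge> 1) \<and>
      digraph_iso (with_proj G) (with_proj (disjoint_sum (complete_multipartite ts) (complete_multipartite rs))) \<and>
      (\<Sum>t\<leftarrow>ts. t - 1) + (\<Sum>r\<leftarrow>rs. r - 1) = s)"
    (is "_ \<longleftrightarrow> ?K1 \<or> ?multi")
proof -
  let ?M = "\<lambda>ts rs. disjoint_sum (complete_multipartite ts) (complete_multipartite rs)"
  have M: "pair_graph (?M ts rs)" for ts rs
    by (intro pair_graph_disjoint_sum pair_graph_complete_multipartite)
  have K: "pair_graph (disjoint_sum H (complete_graph 1))" if "H \<in> two_pos t m"
    for H :: "nat pair_pre_digraph" and t m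
    using that by (auto simp: two_pos_def intro: pair_graph_disjoint_sum pair_graph_complete_graph)
  have "n \<noteq> 0" using V n pair_graph_finite[OF G] by auto
  then have n1: "n \<ge> 1" by simp
  show ?thesis
  proof (intro iffI)
    assume mem: "G \<in> two_pos s n"
    from disconnected_two_pos[OF G V dis mem s] show "?K1 \<or> ?multi"
    proof (elim disjE exE conjE)
      fix H :: "nat pair_pre_digraph" and h
      assume H: "H \<in> two_pos (s - 1) (n - 1)" "graph_iso h G (disjoint_sum H (complete_graph 1))"
      then show ?thesis using digraph_iso_iff[OF G K[OF H(1)]] by blast
    next
      fix ts rs h
      assume *: "2 \<le> length ts" "2 \<le> length rs" "\<forall>t\<in>set ts. 1 \<le> t" "\<forall>r\<in>set rs. 1 \<le> r"
        and h: "graph_iso h G (?M ts rs)"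
      have "(\<Sum>t\<leftarrow>ts. t - 1) + (\<Sum>r\<leftarrow>rs. r - 1) = s"
        using multipartite_sum_index(2)[OF *] graph_iso_index(2)[OF G M h] mem two_pos_iff[OF G] by metis
      moreover have "digraph_iso (with_proj G) (with_proj (?M ts rs))"
        using digraph_iso_iff[OF G M] h by blast
      ultimately show ?thesis using * by blast
    qed
  next
    assume "?K1 \<or> ?multi"
    then show "G \<in> two_pos s n"
    proof (elim disjE exE conjE)
      fix H :: "nat pair_pre_digraph"
      assume H: "H \<in> two_pos (s - 1) (n - 1)"
        and "digraph_iso (with_proj G) (with_proj (disjoint_sum H (complete_graph 1)))"
      then obtain h where "graph_iso h G (disjoint_sum H (complete_graph 1))"
        using digraph_iso_iff[OF G K[OF H]] by blast
      moreover have "pair_graph H" using H by (simp add: two_pos_def)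
      ultimately show ?thesis
        using two_pos_iso[OF G K[OF H]] two_pos_plus_K1[OF _ s n1] H by blast
    next
      fix ts rs
      assume *: "2 \<le> length ts" "2 \<le> length rs" "\<forall>t\<in>set ts. 1 \<le> t" "\<forall>r\<in>set rs. 1 \<le> r"
        and iso: "digraph_iso (with_proj G) (with_proj (?M ts rs))"
        and sum: "(\<Sum>t\<leftarrow>ts. t - 1) + (\<Sum>r\<leftarrow>rs. r - 1) = s"
      obtain h where h: "graph_iso h G (?M ts rs)" using iso digraph_iso_iff[OF G M] by blast
      show ?thesis
        using multipartite_sum_index[OF *] graph_iso_index(1)[OF G M h, of 1] graph_iso_index(2)[OF G M h] sum n two_pos_iff[OF G] by simp
    qed
  qed
qed

theorem theorem4p2:
  fixes G :: "'a pair_pre_digraph" and n :: nat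
  assumes "pair_graph G" and "card (pverts G) = n" and "n \<ge> 6"
  shows
    "(\<not> Digraph_Component.connected (with_proj G) \<longrightarrow>
        (\<forall>s. 2 \<le> s \<and> s \<le> n - 3 \<longrightarrow>
          (G \<in> two_pos s n \<longleftrightarrow>
             (\<exists>H :: nat pair_pre_digraph. H \<in> two_pos (s - 1) (n - 1) \<and>
                digraph_iso (with_proj G) (with_proj (disjoint_sum H (complete_graph 1)))) \<or>
             (\<exists>ts rs. length ts \<ge> 2 \<and> length rs \<ge> 2 \<and>
                (\<forall>t \<in> set ts. t \<ge> 1) \<and> (\<forall>r \<in> set rs. r \<ge> 1) \<and>
                digraph_iso (with_proj G)
                  (with_proj (disjoint_sum (complete_multipartite ts) (complete_multipartite rs))) \<and>
                (\<Sum>t\<leftarrow>ts. t - 1) + (\<Sum>r\<leftarrow>rs. r - 1) = s)))) \<and>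
     (Digraph_Component.connected (with_proj G) \<longrightarrow>
        (G \<in> two_pos 2 n \<longleftrightarrow>
           G \<in> two_pos_I 2 n \<union> two_pos_II 2 n \<union> two_pos_III 2 n \<or> G \<in> D_star) \<and>
        (\<forall>s. 3 \<le> s \<and> s \<le> n - 3 \<longrightarrow>
          (G \<in> two_pos s n \<longleftrightarrow>
             G \<in> two_pos_I s n \<union> two_pos_II s n \<union> two_pos_III s n)))"
proof (intro conjI impI allI)
  have V: "pverts G \<noteq> {}" using assms(2,3) by auto
  {
    fix s
    assume "\<not> Digraph_Component.connected (with_proj G)" "2 \<le> s \<and> s \<le> n - 3"
    then show "G \<in> two_pos s n \<longleftrightarrow>
             (\<exists>H :: nat pair_pre_digraph. H \<in> two_pos (s - 1) (n - 1) \<and>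
                digraph_iso (with_proj G) (with_proj (disjoint_sum H (complete_graph 1)))) \<or>
             (\<exists>ts rs. length ts \<ge> 2 \<and> length rs \<ge> 2 \<and>
                (\<forall>t \<in> set ts. t \<ge> 1) \<and> (\<forall>r \<in> set rs. r \<ge> 1) \<and>
                digraph_iso (with_proj G)
                  (with_proj (disjoint_sum (complete_multipartite ts) (complete_multipartite rs))) \<and>
                (\<Sum>t\<leftarrow>ts. t - 1) + (\<Sum>r\<leftarrow>rs. r - 1) = s)"
      by (intro disconnected_iff[OF assms(1) V assms(2)]) auto
  next
    assume conn: "Digraph_Component.connected (with_proj G)"
    have ext: "G \<in> two_pos_I s n \<union> two_pos_II s n \<union> two_pos_III s n \<longleftrightarrow>
        G \<in> two_pos s n \<and> (\<exists>u. congruent G u)" if "s \<ge> 1" for s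
      by (rule one_vertex_ext_union[OF assms(1) conn assms(2)]) (use assms(3) that in auto)
    \<comment> \<open>Graphs without congruent vertices occur only for \<open>s = 2\<close>; hence
      for \<open>s \<ge> 3\<close> a congruent vertex always exists and no exceptional class
      appears.\<close>
    have not_congruent: "s = 2 \<and> G \<in> D_star" if "G \<in> two_pos s n" "s \<ge> 2" "\<nexists>u. congruent G u" for s
      using connected_not_congruent[OF assms(1) conn, of s] assms(2,3) that by auto
    have "G \<in> two_pos 2 n" if "G \<in> D_star"
      using D_star_two_pos[OF assms(1) _ that] assms(2,3) by simp
    with ext[of 2] not_congruent[of 2] show "G \<in> two_pos 2 n \<longleftrightarrow>
        G \<in> two_pos_I 2 n \<union> two_pos_II 2 n \<union> two_pos_III 2 n \<or> G \<in> D_star" by auto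
    fix s assume "3 \<le> s \<and> s \<le> n - 3"
    then show "G \<in> two_pos s n \<longleftrightarrow> G \<in> two_pos_I s n \<union> two_pos_II s n \<union> two_pos_III s n"
      using ext[of s] not_congruent[of s] by auto
  }
qed


end
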